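(* Let $1<p<\infty$, $0<q<p-1$, $0<\alpha<\frac np$, and let $\sigma$ be a nonnegative locally finite Radon measure on $\mathbb{R}^n$. Consider the equation $$(\mathrm{E})\qquad u=\mathbf{W}_{\alpha,p}(u^q\,d\sigma)\quad\text{in }\mathbb{R}^n.$$ Suppose that $\frac{n(p-1)}{n-\alpha p}<r<\infty$. If $\sigma\not\equiv0$, then there exists a positive solution $u\in L^r(\mathbb{R}^n)$ to $(\mathrm{E})$ if and only if $\mathbf{K}_{\alpha,p,q}\sigma\in L^r(\mathbb{R}^n)$. Moreover, $$\Vert\mathbf{K}_{\alpha,p,q}\sigma\Vert^r_{L^r(\mathbb{R}^n)}\approx\int_{\mathbb{R}^n}\sup_{\rho>0}\left(\frac{[\kappa(B(x,\rho))]^{\frac{q(p-1)}{p-1-q}}}{\rho^{n-\alpha p}}\right)^{\frac r{p-1}}dx,$$ where the constants of equivalence depend only on $\alpha,p,q,r$, and $n$. If $0<r\le\frac{n(p-1)}{n-\alpha p}$, then there is only a trivial supersolution $u\in L^r(\mathbb{R}^n)$ to $(\mathrm{E})$.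
   Context: $B(x,\rho)$ is the ball in $\mathbb{R}^n$ with center $x$ and radius $\rho$. $A\approx B$ means $c_1B\le A\le c_2B$ with positive constants $c_1,c_2$ (both sides may be $+\infty$). $L^r(\mathbb{R}^n)$ is taken with respect to Lebesgue measure. For a nonnegative Radon measure $\nu$ on $\mathbb{R}^n$, the Wolff potential is $\mathbf{W}_{\alpha,p}\nu(x)=\int_0^\infty\left[\frac{\nu(B(x,\rho))}{\rho^{n-\alpha p}}\right]^{\frac1{p-1}}\frac{d\rho}{\rho}$. For a ball $B$, $\kappa(B)\in[0,+\infty]$ is the least constant in $$\left(\int_B(\mathbf{W}_{\alpha,p}\nu)^q\,d\sigma\right)^{1/q}\le\kappa(B)\,\nu(\mathbb{R}^n)^{\frac1{p-1}}$$ for all nonnegative (finite) Radon measures $\nu$ on $\mathbb{R}^n$ ($\kappa(B)=+\infty$ if there is no finite constant). The intrinsic nonlinear potential is $$\mathbf{K}_{\alpha,p,q}\sigma(x)=\int_0^\infty\left[\frac{\kappa(B(x,\rho))^{\frac{q(p-1)}{p-1-q}}}{\rho^{n-\alpha p}}\right]^{\frac1{p-1}}\frac{d\rho}{\rho},\quad x\in\mathbb{R}^n.$$ A solution of $(\mathrm{E})$ is a function $u\ge0$ with $u\in L^q_{\mathrm{loc}}(\mathbb{R}^n,\sigma)$ satisfying the equation $d\sigma$-a.e. and quasi-everywhere (q.e.), i.e. outside a set of zero $(\alpha,p)$-capacity, where $\mathrm{cap}_{\alpha,p}(E)=\inf\{\Vert f\Vert_{L^p(\mathbb{R}^n)}^p: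 f\ge0,\ \int_{\mathbb{R}^n}|x-y|^{\alpha-n}f(y)\,dy\ge1\text{ for }x\in E\}$. A supersolution is defined in the same way with $u\ge\mathbf{W}_{\alpha,p}(u^q\,d\sigma)$. A (super)solution is trivial if $u=0$ $d\sigma$-a.e. *)

theory Defs
  imports "HOL-Analysis.Analysis"
begin

text \<open>Powers of extended nonnegative numbers; only exponents \<open>s > 0\<close> are used below, for which
  \<open>\<infinity>\<close> to the power \<open>s\<close> is \<open>\<infinity>\<close> and \<open>0\<close> to the power \<open>s\<close> is \<open>0\<close>.\<close>

definition epowr :: "ennreal \<Rightarrow> real \<Rightarrow> ennreal"  (infixr "epowr" 80) where
  "x epowr s = (if x = \<infinity> then \<infinity> else ennreal (enn2real x powr s))"

text \<open>On \<open>\<real>\<^sup>n\<close> a locally finite Borel measure is automatically inner and outer regular, so the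
  definition of a Radon measure does not mention regularity.\<close>

definition radon_measure :: "(real^'n) measure \<Rightarrow> bool" where
  "radon_measure \<nu> \<longleftrightarrow> sets \<nu> = sets borel \<and> (\<forall>K. compact K \<longrightarrow> emeasure \<nu> K < \<infinity>)"

definition Lnorm :: "real \<Rightarrow> (real^'n \<Rightarrow> ennreal) \<Rightarrow> ennreal" where
  "Lnorm r f = (\<integral>\<^sup>+x. f x epowr r \<partial>lebesgue) epowr (1 / r)"

definition in_L :: "real \<Rightarrow> (real^'n \<Rightarrow> ennreal) \<Rightarrow> bool" where
  "in_L r f \<longleftrightarrow> f \<in> borel_measurable lebesgue \<and> Lnorm r f < \<infinity>"

definition in_L_loc :: "real \<Rightarrow> (real^'n) measure \<Rightarrow> (real^'n \<Rightarrow> ennreal) \<Rightarrow> bool" where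
  "in_L_loc q \<sigma> u \<longleftrightarrow> u \<in> borel_measurable (completion \<sigma>) \<and>
     (\<forall>K. compact K \<longrightarrow> (\<integral>\<^sup>+x\<in>K. u x epowr q \<partial>completion \<sigma>) < \<infinity>)"

definition wolff :: "real \<Rightarrow> real \<Rightarrow> (real^'n) measure \<Rightarrow> real^'n \<Rightarrow> ennreal" where
  "wolff \<alpha> p \<nu> x =
     (\<integral>\<^sup>+\<rho>\<in>{0<..}. (emeasure \<nu> (ball x \<rho>) / ennreal (\<rho> powr (real CARD('n) - \<alpha> * p))) epowr (1 / (p - 1))
        / ennreal \<rho> \<partial>lborel)"

definition kappa :: "real \<Rightarrow> real \<Rightarrow> real \<Rightarrow> (real^'n) measure \<Rightarrow> (real^'n) set \<Rightarrow> ennreal" where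
  "kappa \<alpha> p q \<sigma> B = Inf {c :: ennreal. \<forall>\<nu>. radon_measure \<nu> \<longrightarrow> emeasure \<nu> UNIV < \<infinity> \<longrightarrow>
     (\<integral>\<^sup>+x\<in>B. wolff \<alpha> p \<nu> x epowr q \<partial>\<sigma>) epowr (1 / q) \<le> c * emeasure \<nu> UNIV epowr (1 / (p - 1))}"

text \<open>The quotient that appears both in the intrinsic potential and in its maximal counterpart.\<close>

definition kappa_quot :: "real \<Rightarrow> real \<Rightarrow> real \<Rightarrow> (real^'n) measure \<Rightarrow> real^'n \<Rightarrow> real \<Rightarrow> ennreal" where
  "kappa_quot \<alpha> p q \<sigma> x \<rho> =
     kappa \<alpha> p q \<sigma> (ball x \<rho>) epowr (q * (p - 1) / (p - 1 - q))
       / ennreal (\<rho> powr (real CARD('n) - \<alpha> * p))"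

definition intrinsic_potential ::
    "real \<Rightarrow> real \<Rightarrow> real \<Rightarrow> (real^'n) measure \<Rightarrow> real^'n \<Rightarrow> ennreal" where
  "intrinsic_potential \<alpha> p q \<sigma> x =
     (\<integral>\<^sup>+\<rho>\<in>{0<..}. kappa_quot \<alpha> p q \<sigma> x \<rho> epowr (1 / (p - 1)) / ennreal \<rho> \<partial>lborel)"

text \<open>The kernel takes the value \<open>0\<close> instead of \<open>\<infinity>\<close> on the diagonal \<open>y = x\<close>, which is Lebesgue-null.\<close>

definition riesz_potential :: "real \<Rightarrow> (real^'n \<Rightarrow> ennreal) \<Rightarrow> real^'n \<Rightarrow> ennreal" where
  "riesz_potential \<alpha> f x =
     (\<integral>\<^sup>+y. ennreal (norm (x - y) powr (\<alpha> - real CARD('n))) * f y \<partial>lebesgue)"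

definition capacity :: "real \<Rightarrow> real \<Rightarrow> (real^'n) set \<Rightarrow> ennreal" where
  "capacity \<alpha> p E = Inf {Lnorm p f epowr p | f.
     f \<in> borel_measurable lebesgue \<and> (\<forall>x\<in>E. riesz_potential \<alpha> f x \<ge> 1)}"

definition quasi_everywhere :: "real \<Rightarrow> real \<Rightarrow> (real^'n \<Rightarrow> bool) \<Rightarrow> bool" where
  "quasi_everywhere \<alpha> p P \<longleftrightarrow> capacity \<alpha> p {x. \<not> P x} = 0"

definition weighted_measure ::
    "real \<Rightarrow> (real^'n) measure \<Rightarrow> (real^'n \<Rightarrow> ennreal) \<Rightarrow> (real^'n) measure" where
  "weighted_measure q \<sigma> u = density (completion \<sigma>) (\<lambda>x. u x epowr q)"

definition solution ::
    "real \<Rightarrow> real \<Rightarrow> real \<Rightarrow> (real^'n) measure \<Rightarrow> (real^'n \<Rightarrow> ennreal) \<Rightarrow> bool" where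
  "solution \<alpha> p q \<sigma> u \<longleftrightarrow> in_L_loc q \<sigma> u \<and>
     (AE x in \<sigma>. u x = wolff \<alpha> p (weighted_measure q \<sigma> u) x) \<and>
     quasi_everywhere \<alpha> p (\<lambda>x. u x = wolff \<alpha> p (weighted_measure q \<sigma> u) x)"

definition supersolution ::
    "real \<Rightarrow> real \<Rightarrow> real \<Rightarrow> (real^'n) measure \<Rightarrow> (real^'n \<Rightarrow> ennreal) \<Rightarrow> bool" where
  "supersolution \<alpha> p q \<sigma> u \<longleftrightarrow> in_L_loc q \<sigma> u \<and>
     (AE x in \<sigma>. u x \<ge> wolff \<alpha> p (weighted_measure q \<sigma> u) x) \<and>
     quasi_everywhere \<alpha> p (\<lambda>x. u x \<ge> wolff \<alpha> p (weighted_measure q \<sigma> u) x)"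

definition trivial_for :: "(real^'n) measure \<Rightarrow> (real^'n \<Rightarrow> ennreal) \<Rightarrow> bool" where
  "trivial_for \<sigma> u \<longleftrightarrow> (AE x in \<sigma>. u x = 0)"

text \<open>Positivity is understood in the same sense as the equation itself.\<close>

definition positive_solution ::
    "real \<Rightarrow> real \<Rightarrow> real \<Rightarrow> (real^'n) measure \<Rightarrow> (real^'n \<Rightarrow> ennreal) \<Rightarrow> bool" where
  "positive_solution \<alpha> p q \<sigma> u \<longleftrightarrow> solution \<alpha> p q \<sigma> u \<and>
     (AE x in \<sigma>. u x > 0) \<and> quasi_everywhere \<alpha> p (\<lambda>x. u x > 0)"

end

theory Submission
  imports Defs
begin

text \<open>Write \<open>n\<close> for the dimension, \<open>N = n - \<alpha> p\<close>, which lies strictly between \<open>0\<close> and \<open>n\<close>,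
  \<open>s = 1/(p-1)\<close>, \<open>\<theta> = q s < 1\<close> and \<open>\<gamma> = q(p-1)/(p-1-q) = q/(1-\<theta>)\<close>. Both the Wolff potential and
  the intrinsic potential have the form \<open>\<integral> (\<eta>(x,\<rho>)/\<rho>\<^sup>N)\<^sup>s d\<rho>/\<rho>\<close>, with \<open>\<eta>(x,\<rho>) = \<nu>(B(x,\<rho>))\<close> in the first
  case and \<open>\<eta>(x,\<rho>) = \<kappa>(B(x,\<rho>))\<close> to the power \<open>\<gamma>\<close> in the second. The key observation is that \<open>\<kappa>\<close> to the
  power \<open>\<gamma>\<close> behaves like a measure: it is increasing, superadditive on disjoint sets
  (\<open>kappa_superadditive2\<close>; \<open>\<gamma>\<close> is exactly the exponent that makes this true) and continuous from
  inside on balls. These properties make up the notion of a ball gauge.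

  For every ball gauge the potential and the maximal function \<open>M = sup\<^sub>\<rho> (\<eta>(x,\<rho>)/\<rho>\<^sup>N)\<^sup>s\<close> have
  comparable integrals to any power \<open>r > 0\<close>. One direction is pointwise, because \<open>\<eta>\<close> is increasing;
  the other one, \<open>potential_power_integral_le_maximal\<close>, is an inequality of Muckenhoupt--Wheeden
  type. For \<open>s < 1\<close>, superadditivity bounds the average, over a ball of radius \<open>\<tau>\<close>, of the part of
  the potential below scale \<open>\<tau>\<close> by a multiple of the density at scale \<open>\<tau>\<close> (\<open>gauge_packing\<close>). Expanding the \<open>r\<close>-th power of
  the potential around the middle third of its scales and averaging over balls then bounds it by the integral
  of \<open>M\<close> times the \<open>(r-1)\<close>-st power of the potential, and the latter is absorbed. This gives the
  equivalence of norms.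

  Let \<open>u\<close> be a nontrivial supersolution, \<open>\<mu> = u\<^sup>q \<sigma>\<close>, and let \<open>\<nu>\<close> be a finite measure. The ratio of the Wolff
  potentials of \<open>\<nu>\<close> and \<open>\<mu>\<close>, raised to the power \<open>p-1\<close>, satisfies a weak \<open>(1,1)\<close> estimate with
  respect to \<open>\<mu>\<close>, by Vitali's covering lemma. Since \<open>u\<close> dominates the potential of \<open>\<mu>\<close> and
  \<open>q < p-1\<close>, Kolmogorov's inequality turns this into a bound of \<open>\<kappa>(B)\<close> to the power \<open>\<gamma>\<close> by a
  multiple of \<open>\<mu>(B)\<close> (\<open>kappa_le_supersolution\<close>). Hence the intrinsic potential is at most a
  multiple of the Wolff potential of \<open>\<mu>\<close>, thus of \<open>u\<close>, which gives one half of the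
  characterization. Here an inequality that holds quasi-everywhere is needed Lebesgue almost
  everywhere, so sets of capacity zero are shown to be Lebesgue null.

  Conversely let the intrinsic potential be in \<open>L\<^sup>r\<close>, and let \<open>M\<close> be the maximal function built from
  \<open>\<kappa>\<close>. If \<open>u\<close> is the Wolff potential of \<open>\<omega>\<close>, splitting \<open>u\<close> near and far from a ball gives a pointwise
  bound of the maximal function of \<open>u\<^sup>q \<sigma>\<close> by a multiple of \<open>M\<^bsup>1-\<theta>\<^esup> u\<^sup>\<theta>\<close> (\<open>iterate_quot_le\<close>).
  Because \<open>\<theta> < 1\<close>, the iteration \<open>u \<mapsto> W(u\<^sup>q \<sigma>)\<close> stays bounded in \<open>L\<^sup>r\<close>. Started at a small multiple
  of \<open>\<sigma>\<close> on a ball it is increasing, and its limit solves the equation everywhere, not merely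
  quasi-everywhere.

  Finally, the Wolff potential of a nonzero measure decays no faster than
  \<open>\<bar>x\<bar>\<^bsup>-Ns\<^esup>\<close>, which is not in \<open>L\<^sup>r\<close> when \<open>r N s \<le> n\<close>; this forces supersolutions to be trivial
  in that range.\<close>

section \<open>Powers of extended nonnegative numbers\<close>

lemma epowr_ennreal [simp]: "0 \<le> x \<Longrightarrow> ennreal x epowr s = ennreal (x powr s)"
  by (simp add: epowr_def)

lemma epowr_top [simp]: "top epowr s = top"
  by (simp add: epowr_def)

lemma epowr_zero [simp]: "0 epowr s = 0"
  by (simp add: epowr_def)

lemma epowr_one [simp]: "x epowr 1 = x"
  by (cases x) auto

lemma one_epowr [simp]: "1 epowr s = 1"
  by (simp add: epowr_def)

lemma epowr_epowr [simp]: "(x epowr a) epowr b = x epowr (a * b)"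
  by (cases x) (auto simp: powr_powr)

lemma epowr_add: "x epowr (a + b) = x epowr a * x epowr b"
  by (cases x) (auto simp: powr_add ennreal_mult ennreal_top_mult)

lemma epowr_mono: "x \<le> y \<Longrightarrow> 0 \<le> s \<Longrightarrow> x epowr s \<le> y epowr s"
  by (cases x; cases y) (auto simp: top_unique intro!: ennreal_leI powr_mono2)

lemma epowr_mult: "0 < s \<Longrightarrow> (x * y) epowr s = x epowr s * y epowr s"
  by (cases x; cases y; cases "x = 0"; cases "y = 0")
    (auto simp: ennreal_mult[symmetric] powr_mult ennreal_mult_eq_top_iff ennreal_top_mult ennreal_mult_top)

lemma epowr_eq_0_iff [simp]: "x epowr s = 0 \<longleftrightarrow> x = 0"
  by (cases x) auto

lemma epowr_eq_top_iff [simp]: "x epowr s = top \<longleftrightarrow> x = top"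
  by (cases x) auto

lemma epowr_less_top_iff [simp]: "x epowr s < top \<longleftrightarrow> x < top"
  by (cases x) auto

lemma epowr_le_iff: "0 < s \<Longrightarrow> x epowr s \<le> y \<longleftrightarrow> x \<le> y epowr (1 / s)"
  using epowr_mono[of "x epowr s" y "1/s"] epowr_mono[of x "y epowr (1/s)" s] by auto

lemma epowr_le_cancel [simp]: "0 < s \<Longrightarrow> x epowr s \<le> y epowr s \<longleftrightarrow> x \<le> y"
  by (simp add: epowr_le_iff)

lemma epowr_less_cancel [simp]: "0 < s \<Longrightarrow> x epowr s < y epowr s \<longleftrightarrow> x < y"
  by (metis epowr_le_cancel linorder_not_le)

lemma epowr_measurable [measurable]:
  assumes [measurable]: "f \<in> borel_measurable M"
  shows "(\<lambda>x. f x epowr s) \<in> borel_measurable M"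
  unfolding epowr_def by measurable

lemma epowr_SUP:
  assumes "0 < s" "I \<noteq> {}"
  shows "(SUP i\<in>I. f i) epowr s = (SUP i\<in>I. f i epowr s)"
proof (rule antisym)
  show "(SUP i\<in>I. f i) epowr s \<le> (SUP i\<in>I. f i epowr s)"
    unfolding epowr_le_iff[OF assms(1)]
    by (rule SUP_least) (metis SUP_upper assms(1) epowr_le_iff)
  show "(SUP i\<in>I. f i epowr s) \<le> (SUP i\<in>I. f i) epowr s"
    using assms by (intro SUP_least epowr_mono SUP_upper) auto
qed

lemma epowr_sum_le:
  assumes "0 < s"
  shows "(x + y) epowr s \<le> ennreal (2 powr s) * (x epowr s + y epowr s)"
proof -
  have "x + y \<le> 2 * max x y"
    unfolding mult_2 by (intro add_mono) auto
  then have "(x + y) epowr s \<le> (2 * max x y) epowr s"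
    using assms by (intro epowr_mono) auto
  also have "\<dots> = 2 epowr s * max x y epowr s"
    using assms by (simp add: epowr_mult)
  also have "2 epowr s = ennreal (2 powr s)"
    using epowr_ennreal[of 2 s] by simp
  also have "max x y epowr s \<le> x epowr s + y epowr s"
    by (auto simp: max_def)
  finally show ?thesis by (simp add: mult_left_mono)
qed

lemma divide_ennreal_eq: "0 < c \<Longrightarrow> x / ennreal c = ennreal (1 / c) * x"
  by (simp add: divide_ennreal_def inverse_ennreal mult.commute divide_inverse)

lemma ennreal_mult_left: "0 \<le> a \<Longrightarrow> 0 \<le> b \<Longrightarrow> ennreal a * (ennreal b * x) = ennreal (a * b) * x"
  by (simp add: ennreal_mult mult.assoc)

lemma epowr_ennreal_mult: "0 \<le> a \<Longrightarrow> 0 < s \<Longrightarrow> (ennreal a * x) epowr s = ennreal (a powr s) * x epowr s"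
  by (simp add: epowr_mult)

lemma ennreal_mult3: "0 \<le> a \<Longrightarrow> 0 \<le> b \<Longrightarrow> 0 \<le> c \<Longrightarrow> ennreal (a * b * c) = ennreal a * ennreal b * ennreal c"
  by (simp add: ennreal_mult)

lemma divide_ennreal_le_iff:
  assumes "0 < c"
  shows "x / ennreal c \<le> d \<longleftrightarrow> x \<le> ennreal c * d"
proof -
  have eq: "ennreal c * (ennreal (1 / c) * y) = y" "ennreal (1 / c) * (ennreal c * y) = y" for y
    using assms by (simp_all add: mult.assoc[symmetric] ennreal_mult[symmetric])
  show ?thesis
    using mult_left_mono[of "ennreal (1 / c) * x" d "ennreal c"] mult_left_mono[of x "ennreal c * d" "ennreal (1/c)"]
    by (auto simp: divide_ennreal_eq[OF assms] eq)
qed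

lemma ennreal_divide_le:
  fixes a b c :: ennreal
  assumes "a \<le> c * b"
  shows "a / b \<le> c"
proof (cases "b = 0 \<or> b = top")
  case True
  then show ?thesis using assms by auto
next
  case False
  then obtain r where r: "b = ennreal r" "0 < r"
    by (metis ennreal_cases ennreal_eq_0_iff not_le)
  then show ?thesis using assms by (simp add: divide_ennreal_le_iff mult.commute)
qed

lemma ennreal_divide_mult_cancel:
  fixes a b :: ennreal
  assumes "0 < b" "b < top"
  shows "a / b * b = a"
proof -
  obtain r where r: "b = ennreal r" "0 < r"
    using assms by (metis ennreal_cases ennreal_less_zero_iff less_irrefl)
  then show ?thesis
    by (simp add: divide_ennreal_eq mult.commute[of _ "ennreal r"] ennreal_mult_left)
qed

text \<open>The finiteness of \<open>J\<close> is what allows half of it to be subtracted.\<close>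

lemma ennreal_absorb:
  assumes "J \<le> ennreal (1/2) * J + B" "J < top"
  shows "J \<le> 2 * B"
proof (cases B)
  case (real b)
  obtain j where j: "J = ennreal j" "0 \<le> j" using assms(2) by (metis ennreal_cases less_irrefl)
  have "ennreal (1/2 * j + b) = ennreal (1/2 * j) + ennreal b"
    using j real by (intro ennreal_plus) auto
  also have "ennreal (1/2 * j) = ennreal (1/2) * ennreal j"
    using j by (intro ennreal_mult) auto
  finally have "ennreal j \<le> ennreal (1/2 * j + b)"
    using assms(1) j real by simp
  then have "j \<le> 2 * b" using j real by (subst (asm) ennreal_le_iff) auto
  then have "ennreal j \<le> ennreal (2 * b)" by (rule ennreal_leI)
  also have "\<dots> = 2 * B" using real by (simp add: ennreal_mult)
  finally show ?thesis using j by simp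
qed (simp add: ennreal_mult_top)

lemma AE_less_top_of_power_integral:
  assumes "f \<in> borel_measurable M" "(\<integral>\<^sup>+x. f x epowr r \<partial>M) < top"
  shows "AE x in M. f x < top"
proof -
  have "AE x in M. f x epowr r \<noteq> \<infinity>"
    using assms by (intro nn_integral_PInf_AE) auto
  then show ?thesis by eventually_elim (auto simp: top.not_eq_extremum)
qed

text \<open>The weighted Young inequality. If \<open>y\<close> exceeds a large multiple of \<open>x\<close>, the left side is a small
  multiple of \<open>y\<close>; otherwise it is at most a multiple of \<open>x\<close>.\<close>

lemma young_absorb:
  fixes C \<epsilon> \<theta> :: real
  assumes "0 < \<theta>" "\<theta> < 1" "0 < C" "0 < \<epsilon>"
  shows "\<exists>C'>0. \<forall>x y. ennreal C * (x epowr (1 - \<theta>) * y epowr \<theta>) \<le> ennreal C' * x + ennreal \<epsilon> * y"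
proof -
  \<comment> \<open>the threshold at which \<open>C D\<^bsup>\<theta>-1\<^esup> = \<epsilon>\<close>\<close>
  define D where "D = (C / \<epsilon>) powr (1 / (1 - \<theta>))"
  have D: "D > 0"
    using assms by (simp add: D_def)
  have "D powr (1 - \<theta>) = C / \<epsilon>"
    using assms by (simp add: D_def powr_powr)
  then have D': "C * (1 / D) powr (1 - \<theta>) = \<epsilon>"
    using assms D by (simp add: powr_divide)
  have "ennreal C * (x epowr (1 - \<theta>) * y epowr \<theta>) \<le> ennreal (C * D powr \<theta>) * x + ennreal \<epsilon> * y" for x y
  proof (cases "y \<le> ennreal D * x")
    case True
    then have "x epowr (1 - \<theta>) * y epowr \<theta> \<le> x epowr (1 - \<theta>) * (ennreal D * x) epowr \<theta>"
      using assms by (intro mult_left_mono epowr_mono) auto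
    also have "\<dots> = ennreal (D powr \<theta>) * (x epowr (1 - \<theta>) * x epowr \<theta>)"
      using assms D by (simp add: epowr_mult mult_ac)
    also have "\<dots> = ennreal (D powr \<theta>) * x"
      by (simp flip: epowr_add)
    finally have "ennreal C * (x epowr (1 - \<theta>) * y epowr \<theta>) \<le> ennreal C * (ennreal (D powr \<theta>) * x)"
      by (rule mult_left_mono) simp
    also have "\<dots> = ennreal (C * D powr \<theta>) * x"
      using assms by (simp add: ennreal_mult mult_ac)
    finally show ?thesis
      by (rule order_trans) simp
  next
    case False
    then have "ennreal D * x \<le> y" by simp
    then have "ennreal (1 / D) * (ennreal D * x) \<le> ennreal (1 / D) * y"
      by (rule mult_left_mono) simp
    then have "x \<le> ennreal (1 / D) * y"
      using D by (simp add: mult.assoc[symmetric] ennreal_mult[symmetric])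
    then have "x epowr (1 - \<theta>) * y epowr \<theta> \<le> (ennreal (1 / D) * y) epowr (1 - \<theta>) * y epowr \<theta>"
      using assms by (intro mult_right_mono epowr_mono) auto
    also have "\<dots> = ennreal ((1 / D) powr (1 - \<theta>)) * (y epowr (1 - \<theta>) * y epowr \<theta>)"
      using assms D by (simp add: epowr_mult mult_ac)
    also have "\<dots> = ennreal ((1 / D) powr (1 - \<theta>)) * y"
      by (simp flip: epowr_add)
    finally have "ennreal C * (x epowr (1 - \<theta>) * y epowr \<theta>)
        \<le> ennreal C * (ennreal ((1 / D) powr (1 - \<theta>)) * y)"
      by (rule mult_left_mono) simp
    also have "\<dots> = ennreal (C * (1 / D) powr (1 - \<theta>)) * y"
      using assms by (simp add: ennreal_mult mult_ac)
    also have "C * (1 / D) powr (1 - \<theta>) = \<epsilon>"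
      by (rule D')
    finally show ?thesis
      by (rule order_trans) simp
  qed
  moreover have "C * D powr \<theta> > 0" using assms D by auto
  ultimately show ?thesis by blast
qed

section \<open>The multiplicative Haar measure of the half-line\<close>

text \<open>The measure \<open>d\<rho>/\<rho>\<close> on \<open>(0,\<infinity>)\<close>. It turns radial integrals into integrals that are invariant
  under \<open>\<rho> \<mapsto> c \<rho>\<close>.\<close>

definition mult_haar :: "real measure" where
  "mult_haar = density lborel (\<lambda>\<rho>. ennreal (1 / \<rho>) * indicator {0<..} \<rho>)"

lemma sets_mult_haar [simp, measurable_cong]: "sets mult_haar = sets borel"
  by (simp add: mult_haar_def)

lemma space_mult_haar [simp]: "space mult_haar = UNIV"
  by (simp add: mult_haar_def)

lemma sigma_finite_mult_haar [simp]: "sigma_finite_measure mult_haar"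
  unfolding mult_haar_def
  by (subst sigma_finite_measure.sigma_finite_iff_density_finite[OF lborel.sigma_finite_measure_axioms]) (auto simp: indicator_def ennreal_mult_eq_top_iff)

lemma nn_integral_mult_haar:
  assumes [measurable]: "f \<in> borel_measurable borel"
  shows "(\<integral>\<^sup>+\<rho>. f \<rho> \<partial>mult_haar) = (\<integral>\<^sup>+\<rho>\<in>{0<..}. f \<rho> / ennreal \<rho> \<partial>lborel)"
  unfolding mult_haar_def
  by (subst nn_integral_density)
     (auto intro!: nn_integral_cong simp: divide_ennreal_eq indicator_def)

lemma AE_mult_haar_pos: "AE \<rho> in mult_haar. 0 < \<rho>"
  unfolding mult_haar_def by (subst AE_density) (auto simp: indicator_def)

lemma nn_integral_mult_haar_scale:
  assumes [measurable]: "f \<in> borel_measurable borel" and "0 < c"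
  shows "(\<integral>\<^sup>+\<rho>. f (c * \<rho>) \<partial>mult_haar) = (\<integral>\<^sup>+\<rho>. f \<rho> \<partial>mult_haar)"
proof -
  have "(\<integral>\<^sup>+\<rho>. f \<rho> \<partial>mult_haar) = ennreal c * (\<integral>\<^sup>+\<rho>. f (c * \<rho>) / ennreal (c * \<rho>) * indicator {0<..} (c * \<rho>) \<partial>lborel)"
    using assms by (subst nn_integral_mult_haar, simp, subst nn_integral_real_affine[where c=c and t=0]) auto
  also have "\<dots> = (\<integral>\<^sup>+\<rho>. ennreal c * (f (c * \<rho>) / ennreal (c * \<rho>) * indicator {0<..} (c * \<rho>)) \<partial>lborel)"
    by (subst nn_integral_cmult) auto
  also have "\<dots> = (\<integral>\<^sup>+\<rho>\<in>{0<..}. f (c * \<rho>) / ennreal \<rho> \<partial>lborel)"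
    using assms(2)
    by (auto intro!: nn_integral_cong simp: divide_ennreal_eq indicator_def zero_less_mult_iff
         mult.assoc[symmetric] ennreal_mult[symmetric])
  also have "\<dots> = (\<integral>\<^sup>+\<rho>. f (c * \<rho>) \<partial>mult_haar)"
    by (subst nn_integral_mult_haar) auto
  finally show ?thesis by simp
qed

lemma nn_integral_mult_haar_Icc:
  assumes "0 < a" "a \<le> b"
  shows "emeasure mult_haar {a..b} = ennreal (ln b - ln a)"
proof -
  have "emeasure mult_haar {a..b} = (\<integral>\<^sup>+\<rho>. indicator {a..b} \<rho> \<partial>mult_haar)" by simp
  also have "\<dots> = (\<integral>\<^sup>+\<rho>. ennreal (1 / \<rho>) * indicator {a..b} \<rho> \<partial>lborel)"
    using assms by (subst nn_integral_mult_haar)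
      (auto intro!: nn_integral_cong simp: divide_ennreal_eq indicator_def)
  also have "\<dots> = ennreal (ln b - ln a)"
    using assms by (intro nn_integral_FTC_Icc)
     (auto intro!: derivative_eq_intros simp: has_real_derivative_iff_has_vector_derivative[symmetric])
  finally show ?thesis .
qed

lemma nn_integral_powr_above:
  assumes "0 < a" "0 < b"
  shows "(\<integral>\<^sup>+\<rho>\<in>{a..}. ennreal (\<rho> powr (-b)) \<partial>mult_haar) = ennreal (a powr (-b) / b)"
proof -
  have "(\<integral>\<^sup>+\<rho>\<in>{a..}. ennreal (\<rho> powr (-b)) \<partial>mult_haar) = (\<integral>\<^sup>+\<rho>. ennreal (\<rho> powr (-b - 1)) * indicator {a..} \<rho> \<partial>lborel)"
    using assms by (subst nn_integral_mult_haar)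
      (auto intro!: nn_integral_cong simp: divide_ennreal_eq indicator_def ennreal_mult[symmetric] powr_diff)
  also have "\<dots> = ennreal (0 - (- (a powr (-b) / b)))"
  proof (rule nn_integral_FTC_atLeast)
    show "((\<lambda>x. - (x powr - b / b)) \<longlongrightarrow> 0) at_top"
      using assms tendsto_divide_zero[OF tendsto_neg_powr[OF _ filterlim_ident, of "-b"], of b]
        tendsto_minus by fastforce
    show "((\<lambda>x. - (x powr - b / b)) has_real_derivative x powr (- b - 1)) (at x)" if "a \<le> x" for x
      using assms that by (auto intro!: derivative_eq_intros simp: field_simps)
  qed (use assms in auto)
  finally show ?thesis by simp
qed

lemma nn_integral_powr_below:
  assumes "0 < a" "0 < b"
  shows "(\<integral>\<^sup>+\<rho>\<in>{..a}. ennreal (\<rho> powr b) \<partial>mult_haar) = ennreal (a powr b / b)"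
proof -
  have "(\<integral>\<^sup>+\<rho>\<in>{..a}. ennreal (\<rho> powr b) \<partial>mult_haar) = (\<integral>\<^sup>+\<rho>. ennreal (\<rho> powr (b - 1)) * indicator {0..a} \<rho> \<partial>lborel)"
    using assms by (subst nn_integral_mult_haar)
      (auto intro!: nn_integral_cong simp: divide_ennreal_eq indicator_def ennreal_mult[symmetric] powr_diff)
  also have "\<dots> = ennreal (a powr b / b)"
  proof (rule nn_integral_has_integral_lebesgue')
    show "((\<lambda>x. x powr (b - 1)) has_integral a powr b / b) {0..a}"
      using has_integral_powr_from_0[of "b - 1" a] assms by simp
  qed (use assms in auto)
  finally show ?thesis .
qed

section \<open>From weak type to strong type\<close>

text \<open>Kolmogorov's inequality: on a space of finite mass \<open>V\<close>, a weak \<open>(1,1)\<close> bound \<open>A\<close> controls the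
  \<open>s\<close>-th power for \<open>s < 1\<close>. Cutting dyadically above the height \<open>A/V\<close>, the contribution of the level
  \<open>2\<^sup>k A/V\<close> is proportional to \<open>2\<^bsup>k(s-1)\<^esup>\<close>, so a geometric series remains. The constant is
  the same for all measures and functions.\<close>

lemma weak_type_imp_power_bound:
  fixes s :: real
  assumes s: "0 < s" "s < 1"
  shows "\<exists>C>0. \<forall>M. \<forall>g\<in>borel_measurable M. \<forall>A. emeasure M (space M) < top \<longrightarrow>
     (\<forall>l>0. ennreal l * emeasure M {x\<in>space M. ennreal l < g x} \<le> A) \<longrightarrow>
     (\<integral>\<^sup>+x. g x epowr s \<partial>M) \<le> ennreal C * (emeasure M (space M) epowr (1 - s) * A epowr s)"
proof -
  define q where "q = 2 powr (s - 1)"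
  have q: "0 < q" "q < 1" using s by (auto simp: q_def powr_less_one)
  define C where "C = 1 + 2 powr s * (1 / (1 - q))"
  have "C > 0" using q by (auto simp: C_def intro!: add_pos_nonneg)
  have main: "(\<integral>\<^sup>+x. g x epowr s \<partial>M) \<le> ennreal C * (emeasure M (space M) epowr (1 - s) * A epowr s)"
    if [measurable]: "g \<in> borel_measurable M" and fin: "emeasure M (space M) < top"
    and weak: "\<And>l. l > 0 \<Longrightarrow> ennreal l * emeasure M {x\<in>space M. ennreal l < g x} \<le> A"
    for M :: "'a measure" and g A
  proof (cases "emeasure M (space M) = 0 \<or> A = 0")
    case True
    have "AE x in M. g x = 0"
    proof (cases "emeasure M (space M) = 0")
      case True
      then have "space M \<in> null_sets M" by auto
      then show ?thesis by (rule AE_I') auto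
    next
      case False
      with True have "A = 0" by auto
      have "AE x in M. \<not> ennreal (1 / real (Suc k)) < g x" for k
      proof (rule AE_I')
        show "{x\<in>space M. ennreal (1 / real (Suc k)) < g x} \<in> null_sets M"
          using weak[of "1 / real (Suc k)"] \<open>A = 0\<close> by (auto simp: null_sets_def)
      qed auto
      then have "AE x in M. \<forall>k. \<not> ennreal (1 / real (Suc k)) < g x"
        by (simp add: AE_all_countable)
      then show ?thesis
      proof eventually_elim
        case (elim x)
        have "\<not> 0 < g x"
        proof
          assume "0 < g x"
          then obtain e where e: "0 < e" "ennreal e < g x"
            by (metis dense ennreal_cases ennreal_eq_0_iff less_irrefl not_gr_zero not_le order_less_imp_le top.not_eq_extremum)
          then obtain k where "1 / real (Suc k) < e"
            by (metis nat_approx_posE)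
          then have "ennreal (1 / real (Suc k)) < g x"
            using e by (meson ennreal_leI less_imp_le order_le_less_trans)
          with elim show False by blast
        qed
        then show ?case by simp
      qed
    qed
    then have "(\<integral>\<^sup>+x. g x epowr s \<partial>M) = (\<integral>\<^sup>+x. 0 \<partial>M)"
      by (intro nn_integral_cong_AE) auto
    then show ?thesis by simp
  next
    case False
    show ?thesis
    proof (cases "A = top")
      case True
      then show ?thesis using False fin \<open>C > 0\<close> by (simp add: ennreal_mult_top)
    next
      case fA: False
      obtain V where V: "emeasure M (space M) = ennreal V" "V > 0"
        using False fin by (metis ennreal_cases ennreal_eq_0_iff less_irrefl not_le order_le_less)
      obtain a where a: "A = ennreal a" "a > 0"
        using False fA by (metis ennreal_cases ennreal_eq_0_iff less_irrefl not_le order_le_less)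
      \<comment> \<open>below this height the trivial bound by the mass of the space is the better one\<close>
      define l where "l = a / V"
      have l: "l > 0" using a V by (simp add: l_def)
      define h where "h k x = (ennreal ((2 ^ Suc k * l) powr s) * indicator {x\<in>space M. ennreal (2 ^ k * l) < g x} x)" for k x
      have [measurable]: "h k \<in> borel_measurable M" for k
        unfolding h_def by measurable
      have pw: "g x epowr s \<le> ennreal (l powr s) + (\<Sum>k. h k x)" if x: "x \<in> space M" for x
      proof (cases "g x = top")
        case True
        have "ennreal (l powr s) \<le> h k x" for k
        proof -
          have "l \<le> 2 ^ Suc k * l" using l by (simp add: mult_le_cancel_right1 del: power_Suc)
          then show ?thesis using True x l s
            by (auto simp: h_def intro!: ennreal_leI powr_mono2)
        qed
        then have "(\<Sum>k. ennreal (l powr s)) \<le> (\<Sum>k. h k x)"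
          by (intro suminf_le) auto
        moreover have "(\<Sum>k::nat. ennreal (l powr s)) = top"
          using l summable_suminf_not_top[of "\<lambda>_::nat. l powr s"] by (metis powr_gt_zero powr_ge_zero summable_const_iff less_irrefl)
        ultimately show ?thesis by (simp add: top_unique)
      next
        case False
        then obtain y where y: "g x = ennreal y" "0 \<le> y" by (metis ennreal_cases)
        show ?thesis
        proof (cases "y \<le> l")
          case True
          then have "g x epowr s \<le> ennreal (l powr s)"
            using y s by (auto intro!: ennreal_leI powr_mono2)
          then show ?thesis by (rule order_trans) simp
        next
          case yl: False
          obtain k0 :: nat where "y / l < 2 ^ k0"
            using real_arch_pow[of 2 "y/l"] by auto
          then have ex: "\<exists>k. y \<le> 2 ^ k * l" using l by (intro exI[of _ k0]) (simp add: field_simps)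
          define k where "k = (LEAST k. y \<le> 2 ^ k * l)"
          have k1: "y \<le> 2 ^ k * l" using LeastI_ex[OF ex] by (simp add: k_def)
          have "k \<noteq> 0" using k1 yl by (intro notI) simp
          then obtain j where j: "k = Suc j" by (cases k) auto
          have "\<not> y \<le> 2 ^ j * l" using not_less_Least[of j "\<lambda>k. y \<le> 2 ^ k * l"] j by (simp add: k_def)
          then have "h j x = ennreal ((2 ^ k * l) powr s)"
            using x y l by (simp add: h_def j ennreal_less_iff del: power_Suc)
          moreover have "g x epowr s \<le> ennreal ((2 ^ k * l) powr s)"
            using y k1 s by (auto intro!: ennreal_leI powr_mono2)
          moreover have "h j x \<le> (\<Sum>k. h k x)"
            using sum_le_suminf[of "\<lambda>k. h k x" "{j}"] by simp
          ultimately show ?thesis by (simp add: add_increasing)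
        qed
      qed
      have hk: "(\<integral>\<^sup>+x. h k x \<partial>M) \<le> ennreal (2 powr s * V * l powr s * q ^ k)" for k
      proof -
        let ?E = "{x\<in>space M. ennreal (2 ^ k * l) < g x}"
        have "emeasure M ?E \<le> emeasure M (space M)" by (intro emeasure_mono) auto
        then obtain e where e: "emeasure M ?E = ennreal e" "0 \<le> e"
          using fin by (metis ennreal_cases less_le_not_le top.extremum)
        have "ennreal (2 ^ k * l * e) \<le> ennreal a"
          using weak[of "2^k * l"] l e a by (simp add: ennreal_mult)
        then have "2 ^ k * l * e \<le> a" using a by (subst (asm) ennreal_le_iff) auto
        then have e2: "e \<le> V / 2 ^ k" using l V by (simp add: l_def field_simps)
        have "(\<integral>\<^sup>+x. h k x \<partial>M) = ennreal ((2 ^ Suc k * l) powr s) * ennreal e"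
          unfolding h_def e(1)[symmetric] by (subst nn_integral_cmult_indicator) auto
        also have "\<dots> = ennreal ((2 ^ Suc k * l) powr s * e)"
          using e by (simp add: ennreal_mult)
        also have "\<dots> \<le> ennreal ((2 ^ Suc k * l) powr s * (V / 2 ^ k))"
          using e2 by (intro ennreal_leI mult_left_mono) auto
        also have "(2 ^ Suc k * l) powr s * (V / 2 ^ k) = 2 powr s * V * l powr s * q ^ k"
        proof -
          have "q ^ k = 2 powr (s * real k) / 2 ^ k"
            by (simp add: q_def powr_diff power_divide powr_power mult.commute)
          moreover have "(2 ^ Suc k * l) powr s = 2 powr s * (2 powr (s * real k)) * l powr s"
            using l by (simp add: powr_mult powr_powr powr_realpow[symmetric] mult.commute)
          ultimately show ?thesis by simp
        qed
        finally show ?thesis .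
      qed
      have "(\<integral>\<^sup>+x. g x epowr s \<partial>M) \<le> (\<integral>\<^sup>+x. ennreal (l powr s) + (\<Sum>k. h k x) \<partial>M)"
        by (intro nn_integral_mono pw)
      also have "\<dots> = ennreal (l powr s) * ennreal V + (\<Sum>k. \<integral>\<^sup>+x. h k x \<partial>M)"
        by (simp add: nn_integral_add nn_integral_suminf V)
      also have "(\<Sum>k. \<integral>\<^sup>+x. h k x \<partial>M) \<le> (\<Sum>k. ennreal (2 powr s * V * l powr s * q ^ k))"
        by (intro suminf_le hk) auto
      also have "\<dots> = ennreal (2 powr s * V * l powr s * (1 / (1 - q)))"
        using q V by (intro suminf_ennreal_eq sums_mult geometric_sums) auto
      also have "ennreal (l powr s) * ennreal V + ennreal (2 powr s * V * l powr s * (1 / (1 - q)))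
          = ennreal (C * (V powr (1 - s) * a powr s))"
      proof -
        have "V * l powr s = V powr (1 - s) * a powr s"
          using V a by (simp add: l_def powr_divide powr_diff)
        then have "C * (V powr (1 - s) * a powr s) = l powr s * V + 2 powr s * V * l powr s * (1 / (1 - q))"
          by (simp add: C_def algebra_simps flip: \<open>V * l powr s = V powr (1 - s) * a powr s\<close>)
        then show ?thesis using V q by (simp add: ennreal_mult[symmetric] ennreal_plus[symmetric] del: ennreal_plus)
      qed
      also have "\<dots> = ennreal C * (emeasure M (space M) epowr (1 - s) * A epowr s)"
        using V a \<open>C > 0\<close> by (simp add: ennreal_mult)
      finally show ?thesis by (simp add: add_left_mono)
    qed
  qed
  show ?thesis using \<open>C > 0\<close> main by blast
qed

section \<open>Powers of the total mass of a measure on the line\<close>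

lemma borel_measurable_mono_ennreal:
  fixes f :: "real \<Rightarrow> ennreal"
  assumes "mono f"
  shows "f \<in> borel_measurable borel"
proof (rule borel_measurableI_greater)
  fix c
  have "is_interval {x. c < f x}"
    unfolding is_interval_1 using assms by (auto simp: mono_def intro: order_less_le_trans)
  then show "{x \<in> space borel. c < f x} \<in> sets borel"
    by (simp add: real_interval_borel_measurable)
qed

text \<open>The set of all \<open>t\<close> in question is itself an initial segment, and hence an increasing union of
  half-lines of mass less than \<open>c\<close>.\<close>

lemma emeasure_initial_segments_le:
  fixes m :: "real measure"
  assumes [simp, measurable_cong]: "sets m = sets borel"
  shows "emeasure m {t. emeasure m {..t} < c} \<le> c"
proof (cases "{t. emeasure m {..t} < c} = {}")
  case False
  define D where "D = {t. emeasure m {..t} < c}"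
  have down: "u \<in> D" if "t \<in> D" "u \<le> t" for t u
  proof -
    have "emeasure m {..u} \<le> emeasure m {..t}" using that by (intro emeasure_mono) auto
    then show ?thesis using that by (simp add: D_def)
  qed
  have chain: "emeasure m D \<le> c" if X: "D = (\<Union>k. {..X k})" "incseq X" "\<And>k. X k \<in> D" for X :: "nat \<Rightarrow> real"
  proof -
    have "emeasure m D = (SUP k. emeasure m {..X k})"
      unfolding X(1) using X(2) by (intro SUP_emeasure_incseq[symmetric]) (auto simp: incseq_def)
    also have "\<dots> \<le> c" using X(3) by (intro SUP_least) (auto simp: D_def less_imp_le)
    finally show ?thesis .
  qed
  show ?thesis
  proof (cases "bdd_above D")
    case False
    then have "\<And>x. \<exists>y\<in>D. x < y" by (auto simp: bdd_above_def not_le)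
    then have "x \<in> D" for x using down by (meson less_imp_le)
    then have "D = UNIV" by auto
    moreover have "(\<Union>k. {..real k}) = (UNIV::real set)" by (auto intro: real_arch_simple)
    ultimately show ?thesis using chain[of real] by (auto simp: D_def incseq_def)
  next
    case True
    define b where "b = Sup D"
    have ne: "D \<noteq> {}" using False by (simp add: D_def)
    have ub: "t \<le> b" if "t \<in> D" for t using that True by (simp add: b_def cSup_upper)
    show ?thesis
    proof (cases "b \<in> D")
      case True
      then have "D = {..b}" using ub down by auto
      moreover have "emeasure m {..b} < c" using True by (simp add: D_def)
      ultimately show ?thesis by (metis D_def less_imp_le)
    next
      case bD: False
      have in_D: "t \<in> D" if "t < b" for t
        using less_cSupD[OF ne that[unfolded b_def]] down by (auto simp: less_imp_le)
      have "D = (\<Union>k. {..b - 1 / real (Suc k)})"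
      proof (intro set_eqI iffI)
        fix t assume t: "t \<in> D"
        then have "t < b" using ub[of t] bD by (cases "t = b") auto
        then obtain k where "1 / real (Suc k) < b - t" using nat_approx_posE[of "b - t"] by auto
        then show "t \<in> (\<Union>k. {..b - 1 / real (Suc k)})" by (auto intro!: exI[of _ k])
      next
        fix t assume "t \<in> (\<Union>k. {..b - 1 / real (Suc k)})"
        then obtain k where "t \<le> b - 1 / real (Suc k)" by auto
        moreover have "1 / real (Suc k) > 0" by simp
        ultimately show "t \<in> D" by (intro in_D) linarith
      qed
      then show ?thesis
        using chain[of "\<lambda>k. b - 1 / real (Suc k)"] in_D
        by (auto simp: D_def incseq_def frac_le)
    qed
  qed
qed simp

lemma emeasure_final_segments_le:
  fixes m :: "real measure"
  assumes [simp, measurable_cong]: "sets m = sets borel"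
  shows "emeasure m {t. emeasure m {t..} < c} \<le> c"
proof -
  let ?m = "distr m borel uminus"
  have [measurable]: "uminus \<in> measurable m borel" by simp
  have 1: "emeasure ?m {..t} = emeasure m {-t..}" for t
  proof -
    have "uminus -` {..t} = {-t..}" by auto
    then show ?thesis using sets_eq_imp_space_eq[of m borel] by (simp add: emeasure_distr)
  qed
  have meas: "(\<lambda>t. emeasure m {-t..}) \<in> borel_measurable borel"
    by (rule borel_measurable_mono_ennreal) (auto simp: mono_def intro!: emeasure_mono)
  have "emeasure m {t. emeasure m {t..} < c} = emeasure ?m {t. emeasure ?m {..t} < c}"
  proof -
    have "uminus -` {t. emeasure m {-t..} < c} = {t. emeasure m {t..} < c}" by auto
    moreover have "{t. emeasure m {-t..} < c} \<in> sets borel" using meas by measurable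
    ultimately show ?thesis using sets_eq_imp_space_eq[of m borel] unfolding 1 by (simp add: emeasure_distr)
  qed
  also have "\<dots> \<le> c" by (rule emeasure_initial_segments_le) simp
  finally show ?thesis .
qed

text \<open>At most a third of the mass sits where the mass to the left is less than a third of the total,
  and likewise on the right. On what remains, which carries at least a third, both factors of the
  integrand are bounded below.\<close>

lemma total_mass_power_le:
  fixes m :: "real measure"
  assumes [simp, measurable_cong]: "sets m = sets borel" and fin: "emeasure m UNIV < top" and r: "2 < r"
  shows "emeasure m UNIV epowr r
    \<le> ennreal (3 powr r) * (\<integral>\<^sup>+t. emeasure m {..t} * emeasure m {t..} epowr (r - 2) \<partial>m)"
proof -
  have space: "space m = UNIV" using sets_eq_imp_space_eq[of m borel] by simp
  obtain v where v: "emeasure m UNIV = ennreal v" "0 \<le> v" using fin by (metis ennreal_cases less_irrefl)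
  define c where "c = ennreal (v / 3)"
  let ?L = "{t. emeasure m {..t} < c}" and ?R = "{t. emeasure m {t..} < c}"
  have [measurable]: "(\<lambda>t. emeasure m {..t}) \<in> borel_measurable borel"
    by (rule borel_measurable_mono_ennreal) (auto simp: mono_def intro!: emeasure_mono)
  have [measurable]: "(\<lambda>t. emeasure m {t..}) \<in> borel_measurable borel"
  proof -
    have "(\<lambda>t. emeasure m {-t..}) \<in> borel_measurable borel"
      by (rule borel_measurable_mono_ennreal) (auto simp: mono_def intro!: emeasure_mono)
    then have "(\<lambda>t. emeasure m {-(-t)..}) \<in> borel_measurable borel"
      by (rule measurable_compose[rotated]) simp
    then show ?thesis by simp
  qed
  have [measurable]: "?L \<in> sets borel" "?R \<in> sets borel" by measurable
  let ?G = "UNIV - (?L \<union> ?R)"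
  have c_le: "c \<le> emeasure m ?G"
  proof -
    have "emeasure m UNIV \<le> emeasure m ?G + emeasure m (?L \<union> ?R)"
      by (intro order_trans[OF emeasure_mono emeasure_subadditive]) auto
    also have "emeasure m (?L \<union> ?R) \<le> emeasure m ?L + emeasure m ?R"
      by (intro emeasure_subadditive) auto
    also have "\<dots> \<le> c + c"
      by (intro add_mono emeasure_initial_segments_le emeasure_final_segments_le) auto
    finally have *: "ennreal v \<le> emeasure m ?G + ennreal (2 * v / 3)"
      using v by (simp add: c_def add_left_mono ennreal_plus[symmetric] del: ennreal_plus)
    show ?thesis
    proof (cases "emeasure m ?G")
      case (real g)
      then show ?thesis using * v by (simp add: c_def ennreal_plus[symmetric] del: ennreal_plus)
    qed simp
  qed
  have "c epowr r = c * c epowr (r - 2) * c"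
    using epowr_add[of c "1 + (r - 2)" 1] epowr_add[of c 1 "r - 2"] by simp
  also have "\<dots> \<le> c * c epowr (r - 2) * emeasure m ?G"
    by (intro mult_left_mono c_le) auto
  also have "\<dots> = (\<integral>\<^sup>+t. (c * c epowr (r - 2)) * indicator ?G t \<partial>m)"
    by (subst nn_integral_cmult_indicator) auto
  also have "\<dots> \<le> (\<integral>\<^sup>+t. emeasure m {..t} * emeasure m {t..} epowr (r - 2) \<partial>m)"
    using r by (intro nn_integral_mono) (auto simp: indicator_def not_less intro!: mult_mono epowr_mono)
  finally have "ennreal (3 powr r) * c epowr r \<le> ennreal (3 powr r) * (\<integral>\<^sup>+t. emeasure m {..t} * emeasure m {t..} epowr (r - 2) \<partial>m)"
    by (rule mult_left_mono) simp
  moreover have "ennreal (3 powr r) * c epowr r = emeasure m UNIV epowr r"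
    using v r by (simp add: c_def ennreal_mult[symmetric] powr_divide)
  ultimately show ?thesis by simp
qed

section \<open>Gauges on balls\<close>

text \<open>Besides vanishing on empty balls, these are the properties common to \<open>\<nu>(B(x,\<rho>))\<close> for a measure \<open>\<nu>\<close> and to \<open>\<kappa>(B(x,\<rho>))\<close> raised to the power
  \<open>\<gamma>\<close>: monotonicity under inclusion of balls, superadditivity for disjoint balls of equal radius,
  and continuity from inside. Inclusion and disjointness of balls are expressed through distances of
  centres, which is the only form in which they are used.\<close>

definition ball_gauge :: "('a::euclidean_space \<Rightarrow> real \<Rightarrow> ennreal) \<Rightarrow> bool" where
  "ball_gauge \<eta> \<longleftrightarrow>
     (\<forall>x \<rho>. \<rho> \<le> 0 \<longrightarrow> \<eta> x \<rho> = 0) \<and>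
     (\<forall>x \<rho> y \<tau>. dist x y + \<rho> \<le> \<tau> \<longrightarrow> \<eta> x \<rho> \<le> \<eta> y \<tau>) \<and>
     (\<forall>I \<rho> y \<tau>. finite I \<longrightarrow> (\<forall>x\<in>I. dist x y + \<rho> \<le> \<tau>) \<longrightarrow> pairwise (\<lambda>x z. 2 * \<rho> \<le> dist x z) I \<longrightarrow>
        (\<Sum>x\<in>I. \<eta> x \<rho>) \<le> \<eta> y \<tau>) \<and>
     (\<forall>x \<rho> c. c < \<eta> x \<rho> \<longrightarrow> (\<exists>\<rho>'<\<rho>. c < \<eta> x \<rho>'))"

text \<open>Integrated against \<open>d\<rho>/\<rho>\<close>, this is the integrand of the Wolff potential when \<open>\<eta>(x,\<rho>) = \<nu>(B(x,\<rho>))\<close>,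
  \<open>N = n - \<alpha> p\<close> and \<open>s = 1/(p-1)\<close>.\<close>

definition gauge_quot :: "real \<Rightarrow> real \<Rightarrow> ('a::euclidean_space \<Rightarrow> real \<Rightarrow> ennreal) \<Rightarrow> 'a \<Rightarrow> real \<Rightarrow> ennreal" where
  "gauge_quot N s \<eta> x \<rho> = (\<eta> x \<rho> / ennreal (\<rho> powr N)) epowr s"

definition gauge_potential :: "real \<Rightarrow> real \<Rightarrow> ('a::euclidean_space \<Rightarrow> real \<Rightarrow> ennreal) \<Rightarrow> 'a \<Rightarrow> ennreal" where
  "gauge_potential N s \<eta> x = (\<integral>\<^sup>+\<rho>. gauge_quot N s \<eta> x \<rho> \<partial>mult_haar)"

definition gauge_maximal :: "real \<Rightarrow> real \<Rightarrow> ('a::euclidean_space \<Rightarrow> real \<Rightarrow> ennreal) \<Rightarrow> 'a \<Rightarrow> ennreal" where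
  "gauge_maximal N s \<eta> x = (SUP \<rho>\<in>{0<..}. gauge_quot N s \<eta> x \<rho>)"

abbreviation truncated_potential ::
    "real \<Rightarrow> real \<Rightarrow> ('a::euclidean_space \<Rightarrow> real \<Rightarrow> ennreal) \<Rightarrow> real \<Rightarrow> real \<Rightarrow> 'a \<Rightarrow> ennreal" where
  "truncated_potential N s \<eta> \<delta> R x \<equiv> (\<integral>\<^sup>+\<rho>\<in>{\<delta>..R}. gauge_quot N s \<eta> x \<rho> \<partial>mult_haar)"

lemma ball_gauge_nonpos: "ball_gauge \<eta> \<Longrightarrow> \<rho> \<le> 0 \<Longrightarrow> \<eta> x \<rho> = 0"
  by (simp add: ball_gauge_def)

lemma ball_gauge_mono:
  assumes "ball_gauge \<eta>" "dist x y + \<rho> \<le> \<tau>"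
  shows "\<eta> x \<rho> \<le> \<eta> y \<tau>"
  using assms(1)[unfolded ball_gauge_def, THEN conjunct2, THEN conjunct1] assms(2) by iprover

lemma ball_gauge_sum_le:
  assumes "ball_gauge \<eta>" "finite I" "\<And>x. x \<in> I \<Longrightarrow> dist x y + \<rho> \<le> \<tau>"
    "pairwise (\<lambda>x z. 2 * \<rho> \<le> dist x z) I"
  shows "(\<Sum>x\<in>I. \<eta> x \<rho>) \<le> \<eta> y \<tau>"
proof -
  have "\<forall>x\<in>I. dist x y + \<rho> \<le> \<tau>" using assms(3) by blast
  with assms(1)[unfolded ball_gauge_def, THEN conjunct2, THEN conjunct2, THEN conjunct1] assms(2,4)
  show ?thesis by iprover
qed

lemma ball_gauge_inner:
  assumes "ball_gauge \<eta>" "c < \<eta> x \<rho>"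
  shows "\<exists>\<rho>'<\<rho>. c < \<eta> x \<rho>'"
  using assms(1)[unfolded ball_gauge_def, THEN conjunct2, THEN conjunct2, THEN conjunct2] assms(2)
  by iprover

lemma gauge_quot_eq:
  assumes "0 < \<rho>" "0 < s"
  shows "gauge_quot N s \<eta> x \<rho> = ennreal (\<rho> powr (- (N * s))) * \<eta> x \<rho> epowr s"
proof -
  have "gauge_quot N s \<eta> x \<rho> = (ennreal (1 / \<rho> powr N) * \<eta> x \<rho>) epowr s"
    using assms by (simp add: gauge_quot_def divide_ennreal_eq)
  also have "\<dots> = ennreal (\<rho> powr (- (N * s))) * \<eta> x \<rho> epowr s"
    using assms by (simp add: epowr_mult powr_minus[symmetric] powr_powr flip: inverse_eq_divide)
  finally show ?thesis .
qed

lemma gauge_quot_nonpos: "ball_gauge \<eta> \<Longrightarrow> \<rho> \<le> 0 \<Longrightarrow> gauge_quot N s \<eta> x \<rho> = 0"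
  by (simp add: gauge_quot_def ball_gauge_nonpos)

lemma gauge_quot_epowr: "gauge_quot N s \<eta> x \<rho> epowr t = gauge_quot N (s * t) \<eta> x \<rho>"
  by (simp add: gauge_quot_def)

lemma gauge_quot_le_maximal:
  "ball_gauge \<eta> \<Longrightarrow> gauge_quot N s \<eta> x \<rho> \<le> gauge_maximal N s \<eta> x"
  by (cases "0 < \<rho>") (auto simp: gauge_maximal_def gauge_quot_nonpos intro: SUP_upper)

lemma gauge_maximal_epowr:
  "0 < t \<Longrightarrow> gauge_maximal N s \<eta> x epowr t = gauge_maximal N (s * t) \<eta> x"
  unfolding gauge_maximal_def by (subst epowr_SUP) (auto simp: gauge_quot_epowr)

lemma gauge_quot_double:
  assumes \<eta>: "ball_gauge \<eta>" and "0 < \<rho>" "0 < s" "dist x y \<le> \<rho>"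
  shows "gauge_quot N s \<eta> x \<rho> \<le> ennreal (2 powr (N * s)) * gauge_quot N s \<eta> y (2 * \<rho>)"
proof -
  have "\<eta> x \<rho> epowr s \<le> \<eta> y (2 * \<rho>) epowr s"
    using assms by (intro epowr_mono ball_gauge_mono) auto
  then have "gauge_quot N s \<eta> x \<rho> \<le> ennreal (\<rho> powr (- (N * s))) * \<eta> y (2 * \<rho>) epowr s"
    using assms by (simp add: gauge_quot_eq mult_left_mono)
  also have "\<rho> powr (- (N * s)) = 2 powr (N * s) * (2 * \<rho>) powr (- (N * s))"
    using assms by (simp add: powr_mult powr_add[symmetric])
  also have "ennreal \<dots> * \<eta> y (2 * \<rho>) epowr s = ennreal (2 powr (N * s)) * gauge_quot N s \<eta> y (2 * \<rho>)"
    using assms by (simp add: gauge_quot_eq ennreal_mult mult_ac)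
  finally show ?thesis .
qed

text \<open>Monotonicity together with continuity from inside makes a gauge lower semicontinuous in centre and
  radius jointly; this is the source of all measurability statements about gauges.\<close>

lemma open_gauge_superlevel:
  assumes \<eta>: "ball_gauge \<eta>"
  shows "open {(x, \<rho>). c < \<eta> x \<rho>}"
proof -
  have eq: "{(x, \<rho>). c < \<eta> x \<rho>} = (\<Union>(x,\<rho>)\<in>{(x, \<rho>). c < \<eta> x \<rho>}. {z. dist x (fst z) + \<rho> < snd z})" (is "?A = ?B")
  proof (rule set_eqI, rule iffI)
    fix z assume "z \<in> ?A"
    moreover obtain x \<rho> where z: "z = (x, \<rho>)" by (cases z)
    ultimately obtain \<rho>' where "\<rho>' < \<rho>" "c < \<eta> x \<rho>'" using ball_gauge_inner[OF \<eta>, of c x \<rho>] by auto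
    then show "z \<in> ?B" using z by force
  next
    fix z assume "z \<in> ?B"
    then obtain x \<rho> where *: "c < \<eta> x \<rho>" "dist x (fst z) + \<rho> < snd z" by auto
    then have "\<eta> x \<rho> \<le> \<eta> (fst z) (snd z)" by (intro ball_gauge_mono[OF \<eta>]) auto
    with * show "z \<in> ?A" by (auto simp: case_prod_beta)
  qed
  have "open {z::'a \<times> real. dist x (fst z) + \<rho> < snd z}" for x \<rho>
    by (intro open_Collect_less continuous_intros)
  then have "open ?B" by (intro open_UN) auto
  with arg_cong[of _ _ "open", OF eq] show ?thesis by (rule iffD2)
qed

lemma gauge_measurable:
  assumes \<eta>: "ball_gauge \<eta>"
  shows "(\<lambda>(x, \<rho>). \<eta> x \<rho>) \<in> borel_measurable (borel \<Otimes>\<^sub>M borel)"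
  unfolding borel_prod
proof (rule borel_measurableI_greater)
  fix c
  have "{z \<in> space borel. c < (case z of (x, \<rho>) \<Rightarrow> \<eta> x \<rho>)} = {(x, \<rho>). c < \<eta> x \<rho>}" by auto
  then show "{z \<in> space borel. c < (case z of (x, \<rho>) \<Rightarrow> \<eta> x \<rho>)} \<in> sets borel"
    using borel_open[OF open_gauge_superlevel[OF \<eta>, of c]] by simp
qed

lemma gauge_measurable':
  assumes \<eta>: "ball_gauge \<eta>"
    and [measurable]: "f \<in> borel_measurable M" "g \<in> borel_measurable M"
  shows "(\<lambda>w. \<eta> (f w) (g w)) \<in> borel_measurable M"
proof -
  have "(\<lambda>w. (\<lambda>(x, \<rho>). \<eta> x \<rho>) (f w, g w)) \<in> borel_measurable M"
    using gauge_measurable[OF \<eta>] by (rule measurable_compose[rotated]) measurable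
  then show ?thesis by simp
qed

lemma gauge_quot_measurable:
  assumes \<eta>: "ball_gauge \<eta>"
    and [measurable]: "f \<in> borel_measurable M" "g \<in> borel_measurable M"
  shows "(\<lambda>w. gauge_quot N s \<eta> (f w) (g w)) \<in> borel_measurable M"
  unfolding gauge_quot_def using gauge_measurable'[OF assms] by measurable

lemma gauge_potential_measurable [measurable]:
  assumes \<eta>: "ball_gauge \<eta>"
  shows "gauge_potential N s \<eta> \<in> borel_measurable borel"
proof -
  interpret sigma_finite_measure mult_haar by simp
  show ?thesis unfolding gauge_potential_def[abs_def]
    using gauge_quot_measurable[OF \<eta>] by measurable
qed

lemma gauge_maximal_measurable [measurable]:
  assumes \<eta>: "ball_gauge \<eta>" and s: "0 < s"
  shows "gauge_maximal N s \<eta> \<in> borel_measurable borel"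
proof (rule borel_measurableI_greater)
  fix c
  have "{x. c < gauge_maximal N s \<eta> x} = (\<Union>\<rho>\<in>{0<..}. {x. c < gauge_quot N s \<eta> x \<rho>})"
    by (auto simp: gauge_maximal_def less_SUP_iff)
  moreover have "open {x. c < gauge_quot N s \<eta> x \<rho>}" if "\<rho> > 0" for \<rho>
  proof -
    have "c < gauge_quot N s \<eta> x \<rho> \<longleftrightarrow> (ennreal (\<rho> powr N) * c epowr (1/s)) < \<eta> x \<rho>" for x
    proof -
      have "gauge_quot N s \<eta> x \<rho> \<le> c \<longleftrightarrow> \<eta> x \<rho> / ennreal (\<rho> powr N) \<le> c epowr (1/s)"
        using s by (simp add: gauge_quot_def epowr_le_iff)
      also have "\<dots> \<longleftrightarrow> \<eta> x \<rho> \<le> ennreal (\<rho> powr N) * c epowr (1/s)"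
        using that by (simp add: divide_ennreal_le_iff)
      finally show ?thesis by (metis linorder_not_le)
    qed
    moreover have "open {x. d < \<eta> x \<rho>}" for d
    proof -
      have "continuous_on UNIV (\<lambda>x::'a. (x, \<rho>))" by (intro continuous_intros)
      then show ?thesis
        using continuous_open_preimage[OF _ _ open_gauge_superlevel[OF \<eta>], of UNIV "\<lambda>x. (x, \<rho>)" d]
        by (simp add: vimage_def)
    qed
    ultimately show ?thesis by simp
  qed
  ultimately show "{x \<in> space borel. c < gauge_maximal N s \<eta> x} \<in> sets borel"
    by (auto intro!: borel_open open_UN)
qed

text \<open>On the scales between \<open>\<rho>\<close> and \<open>2\<rho>\<close>, which have mass \<open>ln 2\<close>, the integrand of the potential is at
  least a fixed fraction of its value at \<open>\<rho>\<close>.\<close>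

lemma gauge_quot_le_potential:
  assumes \<eta>: "ball_gauge \<eta>" and "0 < \<rho>" "0 < s" "0 < N"
  shows "gauge_quot N s \<eta> x \<rho> \<le> ennreal (2 powr (N * s) / ln 2) * gauge_potential N s \<eta> x"
proof -
  have le: "ennreal (2 powr (- (N * s))) * gauge_quot N s \<eta> x \<rho> * indicator {\<rho>..2*\<rho>} t \<le> gauge_quot N s \<eta> x t" for t
  proof (cases "t \<in> {\<rho>..2*\<rho>}")
    case True
    have "(2 * \<rho>) powr (- (N * s)) \<le> t powr (- (N * s))"
      using True assms by (intro powr_mono2') auto
    moreover have "\<eta> x \<rho> epowr s \<le> \<eta> x t epowr s"
      using True assms by (intro epowr_mono ball_gauge_mono[OF \<eta>]) auto
    ultimately have "ennreal ((2 * \<rho>) powr (- (N * s))) * \<eta> x \<rho> epowr s \<le> gauge_quot N s \<eta> x t"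
      using True assms by (auto simp: gauge_quot_eq intro!: mult_mono ennreal_leI)
    then show ?thesis
      using True assms by (simp add: gauge_quot_eq powr_mult ennreal_mult mult_ac)
  qed simp
  have "ennreal (2 powr (- (N * s))) * gauge_quot N s \<eta> x \<rho> * ennreal (ln 2)
      = (\<integral>\<^sup>+t. ennreal (2 powr (- (N * s))) * gauge_quot N s \<eta> x \<rho> * indicator {\<rho>..2*\<rho>} t \<partial>mult_haar)"
    using assms by (subst nn_integral_cmult_indicator) (auto simp: nn_integral_mult_haar_Icc ln_mult)
  also have "\<dots> \<le> gauge_potential N s \<eta> x"
    unfolding gauge_potential_def by (intro nn_integral_mono le)
  finally have "ennreal (2 powr (N * s) / ln 2) * (ennreal (2 powr (- (N * s))) * gauge_quot N s \<eta> x \<rho> * ennreal (ln 2))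
     \<le> ennreal (2 powr (N * s) / ln 2) * gauge_potential N s \<eta> x"
    by (rule mult_left_mono) simp
  also have "ennreal (2 powr (N * s) / ln 2) * (ennreal (2 powr (- (N * s))) * gauge_quot N s \<eta> x \<rho> * ennreal (ln 2))
     = ennreal (2 powr (N * s) / ln 2 * 2 powr (- (N * s)) * ln 2) * gauge_quot N s \<eta> x \<rho>"
    by (subst ennreal_mult3) (auto simp: mult_ac)
  also have "2 powr (N * s) / ln 2 * 2 powr (- (N * s)) * ln 2 = (1::real)"
    by (simp add: powr_add[symmetric])
  finally show ?thesis by simp
qed

lemma gauge_maximal_le_potential:
  assumes "ball_gauge \<eta>" "0 < s" "0 < N"
  shows "gauge_maximal N s \<eta> x \<le> ennreal (2 powr (N * s) / ln 2) * gauge_potential N s \<eta> x"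
  unfolding gauge_maximal_def using assms by (intro SUP_least gauge_quot_le_potential) auto

lemma maximal_power_integral_le_potential:
  assumes \<eta>: "ball_gauge \<eta>" and s: "0 < s" and N: "0 < N" and r: "0 < r"
  shows "(\<integral>\<^sup>+x. gauge_maximal N s \<eta> x epowr r \<partial>lborel)
    \<le> ennreal ((2 powr (N * s) / ln 2) powr r) * (\<integral>\<^sup>+x. gauge_potential N s \<eta> x epowr r \<partial>lborel)"
proof -
  note [measurable] = gauge_potential_measurable[OF \<eta>, of N s]
  let ?c = "2 powr (N * s) / ln 2"
  have "(\<integral>\<^sup>+x. gauge_maximal N s \<eta> x epowr r \<partial>lborel)
      \<le> (\<integral>\<^sup>+x. ennreal (?c powr r) * gauge_potential N s \<eta> x epowr r \<partial>lborel)"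
  proof (rule nn_integral_mono)
    fix x
    have "gauge_maximal N s \<eta> x epowr r \<le> (ennreal ?c * gauge_potential N s \<eta> x) epowr r"
      using r s N by (intro epowr_mono gauge_maximal_le_potential \<eta>) auto
    then show "gauge_maximal N s \<eta> x epowr r \<le> ennreal (?c powr r) * gauge_potential N s \<eta> x epowr r"
      using r by (subst (asm) epowr_ennreal_mult) auto
  qed
  also have "\<dots> = ennreal (?c powr r) * (\<integral>\<^sup>+x. gauge_potential N s \<eta> x epowr r \<partial>lborel)"
    by (rule nn_integral_cmult) measurable
  finally show ?thesis .
qed

section \<open>The packing estimate\<close>

text \<open>Take a maximal \<open>2\<rho>\<close>-separated subset of the superlevel set. The balls of radius \<open>\<rho>\<close> around its points
  are disjoint and each of them has gauge at least \<open>l\<close>, so superadditivity bounds their number; by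
  maximality the balls of radius \<open>2\<rho>\<close> cover.\<close>

lemma gauge_weak_type:
  fixes \<eta> :: "'a::euclidean_space \<Rightarrow> real \<Rightarrow> ennreal"
  assumes \<eta>: "ball_gauge \<eta>" and "0 < \<rho>" "\<rho> \<le> \<tau>" "0 < l"
  shows "ennreal l * emeasure lborel {x\<in>ball y \<tau>. ennreal l < \<eta> x \<rho>}
    \<le> ennreal (unit_ball_vol DIM('a) * (2 * \<rho>) ^ DIM('a)) * \<eta> y (2 * \<tau>)"
proof (cases "\<eta> y (2 * \<tau>) = top")
  case True
  have "0 < unit_ball_vol (real DIM('a)) * (2 * \<rho>) ^ DIM('a)" using assms by simp
  then have "ennreal (unit_ball_vol DIM('a) * (2 * \<rho>) ^ DIM('a)) \<noteq> 0" by (simp only: ennreal_eq_0_iff not_le)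
  with True show ?thesis by (simp only: ennreal_mult_top) simp
next
  case False
  let ?v = "unit_ball_vol DIM('a) * (2 * \<rho>) ^ DIM('a)"
  define E where "E = {x\<in>ball y \<tau>. ennreal l < \<eta> x \<rho>}"
  define sep where "sep I \<longleftrightarrow> I \<subseteq> E \<and> finite I \<and> pairwise (\<lambda>x z. 2 * \<rho> \<le> dist x z) I" for I
  have count: "of_nat (card I) * ennreal l \<le> \<eta> y (2 * \<tau>)" if "sep I" for I
  proof -
    have "of_nat (card I) * ennreal l = (\<Sum>x\<in>I. ennreal l)" by simp
    also have "\<dots> \<le> (\<Sum>x\<in>I. \<eta> x \<rho>)"
      using that by (intro sum_mono) (auto simp: sep_def E_def)
    also have "\<dots> \<le> \<eta> y (2 * \<tau>)"
      using that assms by (intro ball_gauge_sum_le[OF \<eta>]) (auto simp: sep_def E_def dist_commute)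
    finally show ?thesis .
  qed
  obtain h where h: "\<eta> y (2 * \<tau>) = ennreal h" "0 \<le> h" using False by (metis ennreal_cases)
  have bound: "card I \<le> nat \<lceil>h / l\<rceil>" if "sep I" for I
  proof -
    have "ennreal (real (card I) * l) \<le> ennreal h"
      using count[OF that] h assms by (simp add: ennreal_mult ennreal_of_nat_eq_real_of_nat)
    then have "real (card I) \<le> h / l" using h assms by (simp add: field_simps)
    then show ?thesis by linarith
  qed
  have "sep {}" by (simp add: sep_def)
  then obtain I where I: "sep I" "\<And>J. sep J \<Longrightarrow> card J \<le> card I"
    using ex_has_greatest_nat[of sep "{}" card "Suc (nat \<lceil>h / l\<rceil>)"] bound by (auto simp: less_Suc_eq_le)
  have cover: "E \<subseteq> (\<Union>x\<in>I. ball x (2 * \<rho>))"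
  proof
    fix z assume z: "z \<in> E"
    show "z \<in> (\<Union>x\<in>I. ball x (2 * \<rho>))"
    proof (rule ccontr)
      assume "\<not> ?thesis"
      then have far: "\<And>x. x \<in> I \<Longrightarrow> 2 * \<rho> \<le> dist x z" by (auto simp: not_less)
      then have "z \<notin> I" using assms by fastforce
      moreover have "sep (insert z I)"
        using I(1) z far by (auto simp: sep_def pairwise_insert dist_commute)
      ultimately show False using I(2)[of "insert z I"] I(1) by (auto simp: sep_def)
    qed
  qed
  have "emeasure lborel E \<le> emeasure lborel (\<Union>x\<in>I. ball x (2 * \<rho>))"
    by (rule emeasure_mono[OF cover]) (simp add: borel_open open_UN)
  also have "\<dots> \<le> (\<Sum>x\<in>I. emeasure lborel (ball x (2 * \<rho>)))"
    using I(1) by (intro emeasure_subadditive_finite) (auto simp: sep_def)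
  also have "\<dots> = of_nat (card I) * ennreal ?v"
    using assms by (simp add: emeasure_ball)
  finally have "ennreal l * emeasure lborel E \<le> ennreal l * (of_nat (card I) * ennreal ?v)"
    by (rule mult_left_mono) simp
  also have "\<dots> = ennreal ?v * (of_nat (card I) * ennreal l)" by (simp add: mult_ac)
  also have "\<dots> \<le> ennreal ?v * \<eta> y (2 * \<tau>)" by (intro mult_left_mono count I) auto
  finally show ?thesis by (simp add: E_def)
qed

lemma gauge_power_integral_le:
  assumes s: "0 < s" "s < 1"
  shows "\<exists>C>0. \<forall>(\<eta> :: 'a::euclidean_space \<Rightarrow> real \<Rightarrow> ennreal) y \<rho> \<tau>. ball_gauge \<eta> \<longrightarrow> 0 < \<rho> \<longrightarrow> \<rho> \<le> \<tau> \<longrightarrow>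
    (\<integral>\<^sup>+x\<in>ball y \<tau>. \<eta> x \<rho> epowr s \<partial>lborel)
      \<le> ennreal (C * \<tau> powr (real DIM('a) * (1 - s)) * \<rho> powr (real DIM('a) * s)) * \<eta> y (2 * \<tau>) epowr s"
proof -
  let ?n = "DIM('a)" and ?w = "unit_ball_vol DIM('a)"
  obtain C where C: "C > 0" and K: "\<forall>M :: 'a measure. \<forall>g\<in>borel_measurable M. \<forall>A. emeasure M (space M) < top \<longrightarrow>
     (\<forall>l>0. ennreal l * emeasure M {x\<in>space M. ennreal l < g x} \<le> A) \<longrightarrow>
     (\<integral>\<^sup>+x. g x epowr s \<partial>M) \<le> ennreal C * (emeasure M (space M) epowr (1 - s) * A epowr s)"
    using weak_type_imp_power_bound[OF s, where 'a='a] by (elim exE conjE) (rule that)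
  define C' where "C' = C * (?w powr (1 - s) * (?w * 2 ^ ?n) powr s)"
  have w: "?w > 0" by simp
  then have w0: "?w \<noteq> 0" by linarith
  have "C' > 0" using C w w0 unfolding C'_def by (intro mult_pos_pos powr_gt_zero[THEN iffD2]) (auto simp: w0)
  moreover have "(\<integral>\<^sup>+x\<in>ball y \<tau>. \<eta> x \<rho> epowr s \<partial>lborel)
      \<le> ennreal (C' * \<tau> powr (real ?n * (1 - s)) * \<rho> powr (real ?n * s)) * \<eta> y (2 * \<tau>) epowr s"
    if \<eta>: "ball_gauge \<eta>" and \<rho>: "0 < \<rho>" "\<rho> \<le> \<tau>" for \<eta> :: "'a \<Rightarrow> real \<Rightarrow> ennreal" and y \<rho> \<tau>
  proof -
    note [measurable (raw)] = gauge_measurable'[OF \<eta>]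
    let ?M = "restrict_space lborel (ball y \<tau>)"
    have sp: "space ?M = ball y \<tau>" by (simp add: space_restrict_space)
    have em: "emeasure ?M (space ?M) = ennreal (?w * \<tau> ^ ?n)"
      using \<rho> by (simp add: sp emeasure_restrict_space emeasure_ball)
    have "(\<integral>\<^sup>+x\<in>ball y \<tau>. \<eta> x \<rho> epowr s \<partial>lborel) = (\<integral>\<^sup>+x. \<eta> x \<rho> epowr s \<partial>?M)"
      by (subst nn_integral_restrict_space) auto
    also have "\<dots> \<le> ennreal C * (ennreal (?w * \<tau> ^ ?n) epowr (1 - s) *
        (ennreal (?w * (2 * \<rho>) ^ ?n) * \<eta> y (2 * \<tau>)) epowr s)"
      unfolding em[symmetric]
    proof (rule K[rule_format])
      show "(\<lambda>x. \<eta> x \<rho>) \<in> borel_measurable ?M" by (intro measurable_restrict_space1) measurable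
      show "emeasure ?M (space ?M) < top" unfolding em by simp
      fix l :: real assume l: "l > 0"
      have "emeasure ?M {x \<in> space ?M. ennreal l < \<eta> x \<rho>} = emeasure lborel {x\<in>ball y \<tau>. ennreal l < \<eta> x \<rho>}"
        unfolding sp by (rule emeasure_restrict_space) auto
      then show "ennreal l * emeasure ?M {x \<in> space ?M. ennreal l < \<eta> x \<rho>}
          \<le> ennreal (?w * (2 * \<rho>) ^ ?n) * \<eta> y (2 * \<tau>)"
        using gauge_weak_type[OF \<eta> \<rho> l] by simp
    qed
    also have "\<dots> = ennreal (C * ((?w * \<tau> ^ ?n) powr (1 - s) * (?w * (2 * \<rho>) ^ ?n) powr s)) * \<eta> y (2 * \<tau>) epowr s"
      using s \<rho> C by (simp add: epowr_ennreal_mult ennreal_mult_left)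
    also have "(?w * \<tau> ^ ?n) powr (1 - s) = ?w powr (1 - s) * \<tau> powr (real ?n * (1 - s))"
      using \<rho> w by (simp add: powr_mult powr_powr powr_realpow[symmetric])
    also have "(?w * (2 * \<rho>) ^ ?n) powr s = (?w * 2 ^ ?n) powr s * \<rho> powr (real ?n * s)"
      using \<rho> w by (simp add: powr_mult powr_powr powr_realpow[symmetric] power_mult_distrib)
    finally show ?thesis by (simp add: C'_def mult_ac)
  qed
  ultimately show ?thesis by blast
qed

text \<open>Superadditivity of \<open>\<eta>\<close> and \<open>N < n\<close> make the mean of \<open>\<eta>(x,\<rho>)\<^sup>s/\<rho>\<^bsup>Ns\<^esup>\<close> over a ball of radius
  \<open>\<tau>\<close> decay like \<open>(\<rho>/\<tau>)\<^bsup>(n-N)s\<^esup>\<close> as \<open>\<rho>\<close> decreases, so the sum over all scales below \<open>\<tau>\<close> is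
  dominated by scale \<open>\<tau>\<close>.\<close>

lemma gauge_packing:
  assumes s: "0 < s" "s < 1" and N: "0 < N" "N < real DIM('a)"
  shows "\<exists>C>0. \<forall>(\<eta> :: 'a::euclidean_space \<Rightarrow> real \<Rightarrow> ennreal) y \<tau>. ball_gauge \<eta> \<longrightarrow> 0 < \<tau> \<longrightarrow>
    (\<integral>\<^sup>+x\<in>ball y \<tau>. (\<integral>\<^sup>+\<rho>\<in>{..\<tau>}. gauge_quot N s \<eta> x \<rho> \<partial>mult_haar) \<partial>lborel)
      \<le> ennreal (C * \<tau> ^ DIM('a)) * gauge_quot N s \<eta> y (2 * \<tau>)"
proof -
  let ?n = "DIM('a)"
  obtain C where C: "C > 0" and K: "\<forall>(\<eta> :: 'a::euclidean_space \<Rightarrow> real \<Rightarrow> ennreal) y \<rho> \<tau>. ball_gauge \<eta> \<longrightarrow> 0 < \<rho> \<longrightarrow> \<rho> \<le> \<tau> \<longrightarrow>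
    (\<integral>\<^sup>+x\<in>ball y \<tau>. \<eta> x \<rho> epowr s \<partial>lborel)
      \<le> ennreal (C * \<tau> powr (real ?n * (1 - s)) * \<rho> powr (real ?n * s)) * \<eta> y (2 * \<tau>) epowr s"
    using gauge_power_integral_le[OF s, where 'a='a] by (elim exE conjE) (rule that)
  define b where "b = (real ?n - N) * s"
  have b: "b > 0" using s N by (simp add: b_def)
  define C' where "C' = C * 2 powr (N * s) / b"
  have "C' > 0" using C b by (simp add: C'_def)
  moreover have "(\<integral>\<^sup>+x\<in>ball y \<tau>. (\<integral>\<^sup>+\<rho>\<in>{..\<tau>}. gauge_quot N s \<eta> x \<rho> \<partial>mult_haar) \<partial>lborel)
      \<le> ennreal (C' * \<tau> ^ DIM('a)) * gauge_quot N s \<eta> y (2 * \<tau>)"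
    if \<eta>: "ball_gauge \<eta>" and \<tau>: "0 < \<tau>" for \<eta> :: "'a \<Rightarrow> real \<Rightarrow> ennreal" and y \<tau>
  proof -
    note [measurable (raw)] = gauge_quot_measurable[OF \<eta>] gauge_measurable'[OF \<eta>]
    have [measurable]: "ball y \<tau> \<in> sets borel" by simp
    interpret h: sigma_finite_measure mult_haar by simp
    interpret pair_sigma_finite "lborel :: 'a measure" mult_haar ..
    have "(\<integral>\<^sup>+x\<in>ball y \<tau>. (\<integral>\<^sup>+\<rho>\<in>{..\<tau>}. gauge_quot N s \<eta> x \<rho> \<partial>mult_haar) \<partial>lborel)
      = (\<integral>\<^sup>+x. (\<integral>\<^sup>+\<rho>. gauge_quot N s \<eta> x \<rho> * indicator {..\<tau>} \<rho> * indicator (ball y \<tau>) x \<partial>mult_haar) \<partial>lborel)"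
      by (intro nn_integral_cong nn_integral_multc[symmetric]) measurable
    also have "\<dots> = (\<integral>\<^sup>+\<rho>. (\<integral>\<^sup>+x. gauge_quot N s \<eta> x \<rho> * indicator {..\<tau>} \<rho> * indicator (ball y \<tau>) x \<partial>lborel) \<partial>mult_haar)"
      by (rule Fubini'[symmetric]) measurable
    also have "\<dots> \<le> (\<integral>\<^sup>+\<rho>. (ennreal (C * \<tau> powr (real ?n * (1 - s))) * \<eta> y (2 * \<tau>) epowr s) *
        (ennreal (\<rho> powr b) * indicator {..\<tau>} \<rho>) \<partial>mult_haar)"
    proof (rule nn_integral_mono_AE)
      show "AE \<rho> in mult_haar. (\<integral>\<^sup>+x. gauge_quot N s \<eta> x \<rho> * indicator {..\<tau>} \<rho> * indicator (ball y \<tau>) x \<partial>lborel)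
         \<le> (ennreal (C * \<tau> powr (real ?n * (1 - s))) * \<eta> y (2 * \<tau>) epowr s) * (ennreal (\<rho> powr b) * indicator {..\<tau>} \<rho>)"
        using AE_mult_haar_pos
      proof eventually_elim
        case (elim \<rho>)
        show ?case
        proof (cases "\<rho> \<le> \<tau>")
          case True
          have "(\<integral>\<^sup>+x. gauge_quot N s \<eta> x \<rho> * indicator {..\<tau>} \<rho> * indicator (ball y \<tau>) x \<partial>lborel)
            = (\<integral>\<^sup>+x. ennreal (\<rho> powr (- (N * s))) * (\<eta> x \<rho> epowr s * indicator (ball y \<tau>) x) \<partial>lborel)"
            using True elim s by (simp add: gauge_quot_eq mult_ac)
          also have "\<dots> = ennreal (\<rho> powr (- (N * s))) * (\<integral>\<^sup>+x\<in>ball y \<tau>. \<eta> x \<rho> epowr s \<partial>lborel)"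
            by (rule nn_integral_cmult) measurable
          also have "\<dots> \<le> ennreal (\<rho> powr (- (N * s))) * (ennreal (C * \<tau> powr (real ?n * (1 - s)) * \<rho> powr (real ?n * s)) * \<eta> y (2 * \<tau>) epowr s)"
            by (intro mult_left_mono K[rule_format] \<eta> elim True) simp
          also have "\<dots> = (ennreal (C * \<tau> powr (real ?n * (1 - s))) * \<eta> y (2 * \<tau>) epowr s) * (ennreal (\<rho> powr (- (N * s)) * \<rho> powr (real ?n * s)))"
            using C by (simp add: ennreal_mult mult_ac)
          also have "\<rho> powr (- (N * s)) * \<rho> powr (real ?n * s) = \<rho> powr b"
            by (simp add: powr_add[symmetric] b_def algebra_simps)
          finally show ?thesis using True by simp
        qed simp
      qed
    qed
    also have "\<dots> = (ennreal (C * \<tau> powr (real ?n * (1 - s))) * \<eta> y (2 * \<tau>) epowr s) * ennreal (\<tau> powr b / b)"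
      using \<tau> b by (subst nn_integral_cmult) (auto simp: nn_integral_powr_below)
    also have "\<dots> = ennreal (C / b * (\<tau> powr (real ?n * (1 - s)) * \<tau> powr b)) * \<eta> y (2 * \<tau>) epowr s"
      using C b by (subst mult.commute, subst ennreal_mult_left) (auto simp: mult_ac)
    also have "\<tau> powr (real ?n * (1 - s)) * \<tau> powr b = 2 powr (N * s) * \<tau> ^ ?n * (2 * \<tau>) powr (- (N * s))"
      using \<tau> by (simp add: powr_mult powr_realpow[symmetric] powr_add[symmetric] b_def algebra_simps powr_minus)
         (simp add: powr_add[symmetric] powr_minus[symmetric] algebra_simps)
    also have "ennreal (C / b * (2 powr (N * s) * \<tau> ^ ?n * (2 * \<tau>) powr (- (N * s)))) * \<eta> y (2 * \<tau>) epowr s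
       = ennreal (C' * \<tau> ^ ?n) * gauge_quot N s \<eta> y (2 * \<tau>)"
      using C b \<tau> s by (simp add: gauge_quot_eq C'_def ennreal_mult[symmetric] mult.assoc[symmetric])
    finally show ?thesis .
  qed
  ultimately show ?thesis by blast
qed

section \<open>The maximal function controls the potential\<close>

text \<open>The heart of the comparison. The potential \<open>F\<close> at \<open>x\<close> is the total mass of a measure on the scales,
  so \<open>total_mass_power_le\<close> bounds \<open>F\<^sup>r\<close> by an integral over scales \<open>\<tau>\<close> of the density at \<open>\<tau>\<close> times
  the mass \<open>S\<close> below \<open>\<tau>\<close> times a power of the mass \<open>T\<close> above \<open>\<tau>\<close>. The density and \<open>T\<close> hardly change when
  \<open>x\<close> moves by less than \<open>\<tau>\<close>, so the point \<open>x\<close> may be replaced there by any \<open>y\<close> within distance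
  \<open>\<tau>\<close>, and averaging over these leaves the mean of \<open>S\<close> over a ball of radius \<open>\<tau>\<close>, to which the packing
  estimate applies. Moving the point doubles the scales, whence \<open>2 * R\<close> on the right.\<close>

lemma truncated_potential_power_integral_le:
  assumes s: "0 < s" "s < 1" and N: "0 < N" "N < real DIM('a)" and r: "2 < r"
  shows "\<exists>C>0. \<forall>(\<eta> :: 'a::euclidean_space \<Rightarrow> real \<Rightarrow> ennreal) \<delta> R. ball_gauge \<eta> \<longrightarrow> 0 < \<delta> \<longrightarrow> \<delta> \<le> R \<longrightarrow>
    (AE x in lborel. truncated_potential N s \<eta> \<delta> R x < top) \<longrightarrow>
    (\<integral>\<^sup>+x. truncated_potential N s \<eta> \<delta> R x epowr r \<partial>lborel)
      \<le> ennreal C * (\<integral>\<^sup>+x. gauge_maximal N s \<eta> x *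
            truncated_potential N s \<eta> \<delta> (2 * R) x epowr (r - 1) \<partial>lborel)"
proof -
  let ?n = "DIM('a)" and ?w = "unit_ball_vol DIM('a)"
  obtain P where P: "P > 0" and packing: "\<forall>(\<eta> :: 'a::euclidean_space \<Rightarrow> real \<Rightarrow> ennreal) y \<tau>. ball_gauge \<eta> \<longrightarrow> 0 < \<tau> \<longrightarrow>
    (\<integral>\<^sup>+x\<in>ball y \<tau>. (\<integral>\<^sup>+\<rho>\<in>{..\<tau>}. gauge_quot N s \<eta> x \<rho> \<partial>mult_haar) \<partial>lborel)
      \<le> ennreal (P * \<tau> ^ DIM('a)) * gauge_quot N s \<eta> y (2 * \<tau>)"
    using gauge_packing[OF s N] by (elim exE conjE) (rule that)
  define D where "D = 2 powr (N * s)"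
  have D: "D > 0" by (simp add: D_def)
  have w: "?w > 0" by simp
  then have w0: "?w \<noteq> 0" by linarith
  define C where "C = 3 powr r * (D powr (r - 2) * D * P / ?w)"
  have C: "C > 0"
    unfolding C_def using D P w by (intro mult_pos_pos divide_pos_pos) auto
  show ?thesis
  proof (intro exI[of _ C] conjI C allI impI)
    fix \<eta> :: "'a \<Rightarrow> real \<Rightarrow> ennreal" and \<delta> R :: real
    assume \<eta>: "ball_gauge \<eta>" and \<delta>: "0 < \<delta>" "\<delta> \<le> R"
      and fin: "AE x in lborel. truncated_potential N s \<eta> \<delta> R x < top"
    note [measurable (raw)] = gauge_quot_measurable[OF \<eta>]
    interpret h: sigma_finite_measure mult_haar by simp
    interpret xh: pair_sigma_finite "lborel :: 'a measure" mult_haar ..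
    define a where "a = gauge_quot N s \<eta>"
    define f where "f x \<rho> = a x \<rho> * indicator {\<delta>..R} \<rho>" for x \<rho>
    define F where "F x = (\<integral>\<^sup>+\<rho>. f x \<rho> \<partial>mult_haar)" for x
    define H where "H x = (\<integral>\<^sup>+\<rho>\<in>{\<delta>..2*R}. a x \<rho> \<partial>mult_haar)" for x
    define S where "S x \<tau> = (\<integral>\<^sup>+\<rho>. f x \<rho> * (if \<rho> \<le> \<tau> then 1 else 0) \<partial>mult_haar)" for x \<tau>
    define T where "T x \<tau> = (\<integral>\<^sup>+\<rho>. f x \<rho> * (if \<tau> \<le> \<rho> then 1 else 0) \<partial>mult_haar)" for x \<tau>
    define M where "M = gauge_maximal N s \<eta>"
    have a_meas [measurable (raw)]: "(\<lambda>w. a (g w) (g' w)) \<in> borel_measurable K"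
      if "g \<in> borel_measurable K" "g' \<in> borel_measurable K" for g g' and K :: "'z measure"
      unfolding a_def using that by measurable
    have f_meas [measurable (raw)]: "(\<lambda>w. f (g w) (g' w)) \<in> borel_measurable K"
      if "g \<in> borel_measurable K" "g' \<in> borel_measurable K" for g g' and K :: "'z measure"
      unfolding f_def a_def using that by measurable
    have S_meas: "(\<lambda>(x, \<tau>). S x \<tau>) \<in> borel_measurable (borel \<Otimes>\<^sub>M borel)"
      unfolding S_def f_def a_def by measurable
    have T_meas: "(\<lambda>(x, \<tau>). T x \<tau>) \<in> borel_measurable (borel \<Otimes>\<^sub>M borel)"
      unfolding T_def f_def a_def by measurable
    have S_meas' [measurable (raw)]: "(\<lambda>w. S (g w) (g' w)) \<in> borel_measurable K"
      if [measurable]: "g \<in> borel_measurable K" "g' \<in> borel_measurable K" for g g' and K :: "'z measure"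
      using measurable_compose[OF measurable_Pair[OF that] S_meas] by simp
    have T_meas' [measurable (raw)]: "(\<lambda>w. T (g w) (g' w)) \<in> borel_measurable K"
      if [measurable]: "g \<in> borel_measurable K" "g' \<in> borel_measurable K" for g g' and K :: "'z measure"
      using measurable_compose[OF measurable_Pair[OF that] T_meas] by simp
    have [measurable]: "H \<in> borel_measurable borel" "F \<in> borel_measurable borel"
      unfolding H_def F_def f_def a_def by measurable
    have [measurable]: "M \<in> borel_measurable borel" unfolding M_def by (rule gauge_maximal_measurable[OF \<eta> s(1)])
    have aM: "a x \<rho> \<le> M x" for x \<rho> unfolding a_def M_def by (rule gauge_quot_le_maximal[OF \<eta>])

    \<comment> \<open>expansion of the power around the middle third of the scales\<close>
    have median: "F x epowr r \<le> ennreal (3 powr r) * (\<integral>\<^sup>+\<tau>. f x \<tau> * (S x \<tau> * T x \<tau> epowr (r - 2)) \<partial>mult_haar)"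
      if x: "F x < top" for x
    proof -
      let ?m = "density mult_haar (f x)"
      have e: "emeasure ?m UNIV = F x" by (simp add: emeasure_density F_def)
      have e1: "emeasure ?m {..t} = S x t" for t
        unfolding S_def by (subst emeasure_density) (auto intro!: nn_integral_cong simp: indicator_def)
      have e2: "emeasure ?m {t..} = T x t" for t
        unfolding T_def by (subst emeasure_density) (auto intro!: nn_integral_cong simp: indicator_def)
      have "emeasure ?m UNIV epowr r
        \<le> ennreal (3 powr r) * (\<integral>\<^sup>+t. emeasure ?m {..t} * emeasure ?m {t..} epowr (r - 2) \<partial>?m)"
        by (rule total_mass_power_le) (use x r e in auto)
      also have "(\<integral>\<^sup>+t. emeasure ?m {..t} * emeasure ?m {t..} epowr (r - 2) \<partial>?m)
         = (\<integral>\<^sup>+t. f x t * (S x t * T x t epowr (r - 2)) \<partial>mult_haar)"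
        unfolding e1 e2 by (rule nn_integral_density) measurable
      finally show ?thesis unfolding e .
    qed

    \<comment> \<open>the mass above scale \<open>\<tau>\<close> is almost unchanged at distance less than \<open>\<tau>\<close>\<close>
    have T_le: "T x \<tau> \<le> ennreal D * H y" if "dist x y < \<tau>" "\<delta> \<le> \<tau>" for x y \<tau>
    proof -
      have "T x \<tau> \<le> (\<integral>\<^sup>+\<rho>. ennreal D * (a y (2 * \<rho>) * indicator {\<delta>..2*R} (2 * \<rho>)) \<partial>mult_haar)"
        unfolding T_def
      proof (rule nn_integral_mono)
        fix \<rho>
        show "f x \<rho> * (if \<tau> \<le> \<rho> then 1 else 0) \<le> ennreal D * (a y (2 * \<rho>) * indicator {\<delta>..2*R} (2 * \<rho>))"
        proof (cases "\<tau> \<le> \<rho> \<and> \<rho> \<in> {\<delta>..R}")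
          case True
          then have "a x \<rho> \<le> ennreal D * a y (2 * \<rho>)"
            unfolding a_def D_def using that \<delta> s by (intro gauge_quot_double[OF \<eta>]) auto
          then show ?thesis using True \<delta> by (simp add: f_def)
        qed (auto simp: f_def)
      qed
      also have "\<dots> = ennreal D * (\<integral>\<^sup>+\<rho>. a y (2 * \<rho>) * indicator {\<delta>..2*R} (2 * \<rho>) \<partial>mult_haar)"
        by (rule nn_integral_cmult) measurable
      also have "(\<integral>\<^sup>+\<rho>. a y (2 * \<rho>) * indicator {\<delta>..2*R} (2 * \<rho>) \<partial>mult_haar) = H y"
        unfolding H_def using nn_integral_mult_haar_scale[of "\<lambda>\<rho>. a y \<rho> * indicator {\<delta>..2*R} \<rho>" 2] by simp
      finally show ?thesis .
    qed

    \<comment> \<open>averaging over the ball of radius \<open>\<tau>\<close>, for a fixed scale\<close>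
    have slice: "(\<integral>\<^sup>+x. f x \<tau> * (S x \<tau> * T x \<tau> epowr (r - 2)) \<partial>lborel)
        \<le> ennreal (D powr (r - 2) * D * P / ?w) *
            (\<integral>\<^sup>+y. M y * H y epowr (r - 2) * (a y (2 * \<tau>) * indicator {\<delta>..R} \<tau>) \<partial>lborel)" for \<tau>
    proof (cases "\<tau> \<in> {\<delta>..R}")
      case True
      then have \<tau>: "0 < \<tau>" "\<delta> \<le> \<tau>" "\<tau> \<le> R" using \<delta> by auto
      define B where "B x y = (if dist x y < \<tau> then 1 else 0::ennreal)" for x y :: 'a
      have B_meas [measurable (raw)]: "(\<lambda>w. B (g w) (g' w)) \<in> borel_measurable K"
        if [measurable]: "g \<in> borel_measurable K" "g' \<in> borel_measurable K" for g g' and K :: "'z measure"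
        unfolding B_def by measurable
      have ball_B: "(\<integral>\<^sup>+y. B x y \<partial>lborel) = ennreal (?w * \<tau> ^ ?n)" for x
      proof -
        have "(\<integral>\<^sup>+y. B x y \<partial>lborel) = (\<integral>\<^sup>+y. indicator (ball x \<tau>) y \<partial>lborel)"
          by (intro nn_integral_cong) (auto simp: B_def indicator_def)
        then show ?thesis using \<tau> by (simp add: emeasure_ball)
      qed
      let ?g = "\<lambda>x. f x \<tau> * (S x \<tau> * T x \<tau> epowr (r - 2))"
      have "ennreal (?w * \<tau> ^ ?n) * (\<integral>\<^sup>+x. ?g x \<partial>lborel) = (\<integral>\<^sup>+x. ennreal (?w * \<tau> ^ ?n) * ?g x \<partial>lborel)"
        by (rule nn_integral_cmult[symmetric]) measurable
      also have "\<dots> = (\<integral>\<^sup>+x. (\<integral>\<^sup>+y. B x y * ?g x \<partial>lborel) \<partial>lborel)"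
      proof (rule nn_integral_cong)
        fix x
        have "(\<integral>\<^sup>+y. B x y * ?g x \<partial>lborel) = (\<integral>\<^sup>+y. B x y \<partial>lborel) * ?g x"
          by (rule nn_integral_multc) measurable
        then show "ennreal (?w * \<tau> ^ ?n) * ?g x = (\<integral>\<^sup>+y. B x y * ?g x \<partial>lborel)"
          by (simp only: ball_B)
      qed
      also have "\<dots> \<le> (\<integral>\<^sup>+x. (\<integral>\<^sup>+y. ennreal (D powr (r - 2) * D) * (H y epowr (r - 2) * a y (2 * \<tau>)) * (S x \<tau> * B x y) \<partial>lborel) \<partial>lborel)"
      proof (intro nn_integral_mono)
        fix x y
        show "B x y * ?g x \<le> ennreal (D powr (r - 2) * D) * (H y epowr (r - 2) * a y (2 * \<tau>)) * (S x \<tau> * B x y)"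
        proof (cases "dist x y < \<tau>")
          case xy: True
          have "f x \<tau> \<le> ennreal D * a y (2 * \<tau>)"
            using gauge_quot_double[OF \<eta> \<tau>(1) s(1), of x y N] xy
            by (auto simp: f_def a_def D_def indicator_def)
          moreover have "T x \<tau> epowr (r - 2) \<le> ennreal (D powr (r - 2)) * H y epowr (r - 2)"
            using epowr_mono[OF T_le[OF xy \<tau>(2)], of "r - 2"] r D by (simp add: epowr_ennreal_mult)
          ultimately have "?g x \<le> (ennreal D * a y (2 * \<tau>)) * (S x \<tau> * (ennreal (D powr (r - 2)) * H y epowr (r - 2)))"
            by (intro mult_mono) auto
          also have "\<dots> = ennreal (D powr (r - 2) * D) * (H y epowr (r - 2) * a y (2 * \<tau>)) * S x \<tau>"
            using D by (simp add: ennreal_mult mult_ac)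
          finally show ?thesis using xy by (simp add: B_def)
        qed (simp add: B_def)
      qed
      also have "\<dots> = (\<integral>\<^sup>+y. (\<integral>\<^sup>+x. ennreal (D powr (r - 2) * D) * (H y epowr (r - 2) * a y (2 * \<tau>)) * (S x \<tau> * B x y) \<partial>lborel) \<partial>lborel)"
        by (rule lborel_pair.Fubini'[symmetric]) measurable
      also have "\<dots> = (\<integral>\<^sup>+y. ennreal (D powr (r - 2) * D) * (H y epowr (r - 2) * a y (2 * \<tau>)) * (\<integral>\<^sup>+x. S x \<tau> * B x y \<partial>lborel) \<partial>lborel)"
        by (intro nn_integral_cong nn_integral_cmult) measurable
      also have "\<dots> \<le> (\<integral>\<^sup>+y. ennreal (D powr (r - 2) * D) * (H y epowr (r - 2) * a y (2 * \<tau>)) * (ennreal (P * \<tau> ^ ?n) * M y) \<partial>lborel)"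
      proof (intro nn_integral_mono mult_left_mono)
        fix y
        have "(\<integral>\<^sup>+x. S x \<tau> * B x y \<partial>lborel) \<le> (\<integral>\<^sup>+x\<in>ball y \<tau>. (\<integral>\<^sup>+\<rho>\<in>{..\<tau>}. gauge_quot N s \<eta> x \<rho> \<partial>mult_haar) \<partial>lborel)"
        proof (intro nn_integral_mono)
          fix x
          have "S x \<tau> \<le> (\<integral>\<^sup>+\<rho>\<in>{..\<tau>}. gauge_quot N s \<eta> x \<rho> \<partial>mult_haar)"
            unfolding S_def f_def a_def by (intro nn_integral_mono) (auto simp: indicator_def)
          then show "S x \<tau> * B x y \<le> (\<integral>\<^sup>+\<rho>\<in>{..\<tau>}. gauge_quot N s \<eta> x \<rho> \<partial>mult_haar) * indicator (ball y \<tau>) x"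
            by (simp add: B_def dist_commute)
        qed
        also have "\<dots> \<le> ennreal (P * \<tau> ^ ?n) * gauge_quot N s \<eta> y (2 * \<tau>)"
          using packing \<eta> \<tau>(1) by blast
        also have "\<dots> \<le> ennreal (P * \<tau> ^ ?n) * M y"
          using aM[of y "2 * \<tau>"] by (intro mult_left_mono) (auto simp: a_def)
        finally show "(\<integral>\<^sup>+x. S x \<tau> * B x y \<partial>lborel) \<le> ennreal (P * \<tau> ^ ?n) * M y" .
      qed auto
      also have "\<dots> = (\<integral>\<^sup>+y. ennreal (D powr (r - 2) * D * (P * \<tau> ^ ?n)) * (M y * H y epowr (r - 2) * (a y (2 * \<tau>) * indicator {\<delta>..R} \<tau>)) \<partial>lborel)"
        using D P \<tau> True by (intro nn_integral_cong) (simp add: ennreal_mult mult_ac)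
      also have "\<dots> = ennreal (D powr (r - 2) * D * (P * \<tau> ^ ?n)) * (\<integral>\<^sup>+y. M y * H y epowr (r - 2) * (a y (2 * \<tau>) * indicator {\<delta>..R} \<tau>) \<partial>lborel)"
        by (rule nn_integral_cmult) measurable
      finally have "ennreal (?w * \<tau> ^ ?n) * (\<integral>\<^sup>+x. ?g x \<partial>lborel) \<le> ennreal (D powr (r - 2) * D * (P * \<tau> ^ ?n)) * (\<integral>\<^sup>+y. M y * H y epowr (r - 2) * (a y (2 * \<tau>) * indicator {\<delta>..R} \<tau>) \<partial>lborel)" .
      then have "ennreal (1 / (?w * \<tau> ^ ?n)) * (ennreal (?w * \<tau> ^ ?n) * (\<integral>\<^sup>+x. ?g x \<partial>lborel)) \<le>
         ennreal (1 / (?w * \<tau> ^ ?n)) * (ennreal (D powr (r - 2) * D * (P * \<tau> ^ ?n)) * (\<integral>\<^sup>+y. M y * H y epowr (r - 2) * (a y (2 * \<tau>) * indicator {\<delta>..R} \<tau>) \<partial>lborel))"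
        by (rule mult_left_mono) simp
      moreover have "1 / (?w * \<tau> ^ ?n) * (?w * \<tau> ^ ?n) = 1"
        "1 / (?w * \<tau> ^ ?n) * (D powr (r - 2) * D * (P * \<tau> ^ ?n)) = D powr (r - 2) * D * P / ?w"
        using w0 \<tau> by (auto simp: field_simps)
      ultimately show ?thesis using w \<tau> P D
        by (simp only: ennreal_mult_left divide_nonneg_nonneg mult_nonneg_nonneg zero_le_power less_imp_le zero_le_one powr_ge_zero ennreal_1 mult_1)
    qed (simp add: f_def)

    have "(\<integral>\<^sup>+x. F x epowr r \<partial>lborel) \<le> (\<integral>\<^sup>+x. ennreal (3 powr r) * (\<integral>\<^sup>+\<tau>. f x \<tau> * (S x \<tau> * T x \<tau> epowr (r - 2)) \<partial>mult_haar) \<partial>lborel)"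
    proof (rule nn_integral_mono_AE)
      have "AE x in lborel. F x < top" using fin by (simp add: F_def f_def a_def)
      then show "AE x in lborel. F x epowr r \<le> ennreal (3 powr r) *
          (\<integral>\<^sup>+\<tau>. f x \<tau> * (S x \<tau> * T x \<tau> epowr (r - 2)) \<partial>mult_haar)"
        by (rule AE_mp) (rule AE_I2, rule impI, erule median)
    qed
    also have "\<dots> = ennreal (3 powr r) * (\<integral>\<^sup>+x. (\<integral>\<^sup>+\<tau>. f x \<tau> * (S x \<tau> * T x \<tau> epowr (r - 2)) \<partial>mult_haar) \<partial>lborel)"
      by (rule nn_integral_cmult) measurable
    also have "(\<integral>\<^sup>+x. (\<integral>\<^sup>+\<tau>. f x \<tau> * (S x \<tau> * T x \<tau> epowr (r - 2)) \<partial>mult_haar) \<partial>lborel)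
       = (\<integral>\<^sup>+\<tau>. (\<integral>\<^sup>+x. f x \<tau> * (S x \<tau> * T x \<tau> epowr (r - 2)) \<partial>lborel) \<partial>mult_haar)"
      by (rule xh.Fubini'[symmetric]) measurable
    also have "\<dots> \<le> (\<integral>\<^sup>+\<tau>. ennreal (D powr (r - 2) * D * P / ?w) *
            (\<integral>\<^sup>+y. M y * H y epowr (r - 2) * (a y (2 * \<tau>) * indicator {\<delta>..R} \<tau>) \<partial>lborel) \<partial>mult_haar)"
      by (intro nn_integral_mono slice)
    also have "\<dots> = ennreal (D powr (r - 2) * D * P / ?w) *
            (\<integral>\<^sup>+\<tau>. (\<integral>\<^sup>+y. M y * H y epowr (r - 2) * (a y (2 * \<tau>) * indicator {\<delta>..R} \<tau>) \<partial>lborel) \<partial>mult_haar)"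
      by (rule nn_integral_cmult) measurable
    also have "(\<integral>\<^sup>+\<tau>. (\<integral>\<^sup>+y. M y * H y epowr (r - 2) * (a y (2 * \<tau>) * indicator {\<delta>..R} \<tau>) \<partial>lborel) \<partial>mult_haar)
       = (\<integral>\<^sup>+y. (\<integral>\<^sup>+\<tau>. M y * H y epowr (r - 2) * (a y (2 * \<tau>) * indicator {\<delta>..R} \<tau>) \<partial>mult_haar) \<partial>lborel)"
      by (rule xh.Fubini') measurable
    also have "\<dots> = (\<integral>\<^sup>+y. M y * H y epowr (r - 2) * (\<integral>\<^sup>+\<tau>. a y (2 * \<tau>) * indicator {\<delta>..R} \<tau> \<partial>mult_haar) \<partial>lborel)"
      by (intro nn_integral_cong nn_integral_cmult) measurable
    also have "\<dots> \<le> (\<integral>\<^sup>+y. M y * H y epowr (r - 1) \<partial>lborel)"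
    proof (intro nn_integral_mono)
      fix y
      have "(\<integral>\<^sup>+\<tau>. a y (2 * \<tau>) * indicator {\<delta>..R} \<tau> \<partial>mult_haar) \<le> (\<integral>\<^sup>+\<tau>. a y (2 * \<tau>) * indicator {\<delta>..2*R} (2 * \<tau>) \<partial>mult_haar)"
        using \<delta> by (intro nn_integral_mono) (auto simp: indicator_def)
      also have "\<dots> = H y"
        unfolding H_def using nn_integral_mult_haar_scale[of "\<lambda>\<rho>. a y \<rho> * indicator {\<delta>..2*R} \<rho>" 2] by simp
      finally have "M y * H y epowr (r - 2) * (\<integral>\<^sup>+\<tau>. a y (2 * \<tau>) * indicator {\<delta>..R} \<tau> \<partial>mult_haar) \<le> M y * H y epowr (r - 2) * H y"
        by (rule mult_left_mono) simp
      also have "\<dots> = M y * H y epowr (r - 1)"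
        using epowr_add[of "H y" "r - 2" 1] by (simp add: mult.assoc)
      finally show "M y * H y epowr (r - 2) * (\<integral>\<^sup>+\<tau>. a y (2 * \<tau>) * indicator {\<delta>..R} \<tau> \<partial>mult_haar) \<le> M y * H y epowr (r - 1)" .
    qed
    finally have "(\<integral>\<^sup>+x. F x epowr r \<partial>lborel)
       \<le> ennreal (3 powr r) * (ennreal (D powr (r - 2) * D * P / ?w) * (\<integral>\<^sup>+y. M y * H y epowr (r - 1) \<partial>lborel))"
      by (simp add: mult_left_mono)
    also have "\<dots> = ennreal C * (\<integral>\<^sup>+y. M y * H y epowr (r - 1) \<partial>lborel)"
      unfolding C_def using D P w by (intro ennreal_mult_left) (auto intro!: divide_nonneg_nonneg mult_nonneg_nonneg)
    finally show "(\<integral>\<^sup>+x. truncated_potential N s \<eta> \<delta> R x epowr r \<partial>lborel)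
      \<le> ennreal C * (\<integral>\<^sup>+x. gauge_maximal N s \<eta> x *
            truncated_potential N s \<eta> \<delta> (2 * R) x epowr (r - 1) \<partial>lborel)"
      by (simp add: F_def f_def H_def M_def a_def)
  qed
qed

text \<open>With \<open>M\<close> the maximal function and \<open>H \<le> F + M\<close> the potential truncated at \<open>2R\<close> instead of \<open>R\<close>, Young's
  inequality splits \<open>M H\<^bsup>r-1\<^esup>\<close> into a multiple of \<open>M\<^sup>r\<close> and a small multiple of \<open>F\<^sup>r\<close>, which is
  absorbed. Truncation to a bounded range of scales guarantees that the absorbed integral is finite,
  as \<open>F\<close> is then at most a multiple of \<open>M\<close>.\<close>

lemma potential_power_integral_le_small_exponent:
  assumes s: "0 < s" "s < 1" and N: "0 < N" "N < real DIM('a)" and r: "2 < r"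
  shows "\<exists>C>0. \<forall>\<eta> :: 'a::euclidean_space \<Rightarrow> real \<Rightarrow> ennreal. ball_gauge \<eta> \<longrightarrow>
    (\<integral>\<^sup>+x. gauge_potential N s \<eta> x epowr r \<partial>lborel) \<le> ennreal C * (\<integral>\<^sup>+x. gauge_maximal N s \<eta> x epowr r \<partial>lborel)"
proof -
  obtain C where C: "C > 0" and K: "\<forall>(\<eta> :: 'a::euclidean_space \<Rightarrow> real \<Rightarrow> ennreal) \<delta> R. ball_gauge \<eta> \<longrightarrow> 0 < \<delta> \<longrightarrow> \<delta> \<le> R \<longrightarrow>
    (AE x in lborel. truncated_potential N s \<eta> \<delta> R x < top) \<longrightarrow>
    (\<integral>\<^sup>+x. truncated_potential N s \<eta> \<delta> R x epowr r \<partial>lborel)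
      \<le> ennreal C * (\<integral>\<^sup>+x. gauge_maximal N s \<eta> x *
            truncated_potential N s \<eta> \<delta> (2 * R) x epowr (r - 1) \<partial>lborel)"
    using truncated_potential_power_integral_le[OF s N r] by (elim exE conjE) (rule that)
  obtain Y where Y: "Y > 0" and young: "\<forall>x y. ennreal C * (x epowr (1 - (1 - 1 / r)) * y epowr (1 - 1 / r))
      \<le> ennreal Y * x + ennreal ((1/2) / 2 powr r) * y"
    using young_absorb[of "1 - 1 / r" C "(1/2) / 2 powr r"] r C by (auto simp: field_simps)
  define C' where "C' = 2 * (Y + 1 / 2)"
  show ?thesis
  proof (intro exI[of _ C'] conjI allI impI)
    show "C' > 0" using Y by (simp add: C'_def)
    fix \<eta> :: "'a \<Rightarrow> real \<Rightarrow> ennreal" assume \<eta>: "ball_gauge \<eta>"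
    note [measurable (raw)] = gauge_quot_measurable[OF \<eta>]
    interpret h: sigma_finite_measure mult_haar by simp
    define M where "M = gauge_maximal N s \<eta>"
    have [measurable]: "M \<in> borel_measurable borel" unfolding M_def by (rule gauge_maximal_measurable[OF \<eta> s(1)])
    define I where "I = (\<integral>\<^sup>+x. M x epowr r \<partial>lborel)"
    define F where "F \<delta> R x = truncated_potential N s \<eta> \<delta> R x" for \<delta> R x
    have F_meas [measurable]: "F \<delta> R \<in> borel_measurable borel" for \<delta> R
      unfolding F_def[abs_def] by measurable
    have F_le: "F \<delta> R x \<le> ennreal (ln R - ln \<delta>) * M x" if "0 < \<delta>" "\<delta> \<le> R" for \<delta> R x
    proof -
      have "F \<delta> R x \<le> (\<integral>\<^sup>+\<rho>. M x * indicator {\<delta>..R} \<rho> \<partial>mult_haar)"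
        unfolding F_def M_def by (intro nn_integral_mono mult_right_mono gauge_quot_le_maximal[OF \<eta>]) auto
      also have "\<dots> = ennreal (ln R - ln \<delta>) * M x"
        using that by (subst nn_integral_cmult_indicator) (auto simp: nn_integral_mult_haar_Icc mult.commute)
      finally show ?thesis .
    qed
    have trunc: "(\<integral>\<^sup>+x. F \<delta> R x epowr r \<partial>lborel) \<le> ennreal C' * I" if \<delta>: "0 < \<delta>" "\<delta> \<le> R" for \<delta> R
    proof (cases "I = top")
      case True
      then show ?thesis using \<open>C' > 0\<close> by (simp add: ennreal_mult_top)
    next
      case False
      then have I: "I < top" by (simp add: top.not_eq_extremum)
      have Mfin: "AE x in lborel. M x < top"
        using I by (intro AE_less_top_of_power_integral[of _ _ r]) (auto simp: I_def)
      let ?J = "\<integral>\<^sup>+x. F \<delta> R x epowr r \<partial>lborel"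
      have "?J \<le> (\<integral>\<^sup>+x. ennreal ((ln R - ln \<delta>) powr r) * M x epowr r \<partial>lborel)"
      proof (intro nn_integral_mono)
        fix x
        have "F \<delta> R x epowr r \<le> (ennreal (ln R - ln \<delta>) * M x) epowr r"
          using F_le[OF \<delta>] r by (intro epowr_mono) auto
        then show "F \<delta> R x epowr r \<le> ennreal ((ln R - ln \<delta>) powr r) * M x epowr r"
          using r \<delta> by (simp add: epowr_ennreal_mult)
      qed
      also have "\<dots> = ennreal ((ln R - ln \<delta>) powr r) * I"
        unfolding I_def by (rule nn_integral_cmult) measurable
      also have "\<dots> < top" using I by (simp add: ennreal_mult_less_top)
      finally have Jfin: "?J < top" .
      have "AE x in lborel. F \<delta> R x < top"
        using Mfin
      proof eventually_elim
        case (elim x)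
        then show ?case using F_le[OF \<delta>, of x] by (auto intro: order_le_less_trans simp: ennreal_mult_less_top)
      qed
      then have "?J \<le> ennreal C * (\<integral>\<^sup>+x. M x * F \<delta> (2 * R) x epowr (r - 1) \<partial>lborel)"
        using K \<eta> \<delta> unfolding M_def F_def by blast
      also have "\<dots> = (\<integral>\<^sup>+x. ennreal C * (M x * F \<delta> (2 * R) x epowr (r - 1)) \<partial>lborel)"
        by (rule nn_integral_cmult[symmetric]) measurable
      also have "\<dots> \<le> (\<integral>\<^sup>+x. ennreal (Y + 1/2) * M x epowr r + ennreal (1/2) * F \<delta> R x epowr r \<partial>lborel)"
      proof (intro nn_integral_mono)
        fix x
        have Y1: "ennreal C * (M x * F \<delta> (2 * R) x epowr (r - 1)) \<le> ennreal Y * M x epowr r + ennreal ((1/2) / 2 powr r) * F \<delta> (2 * R) x epowr r"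
        proof -
          have "r * (1 - (1 - 1 / r)) = 1" "r * (1 - 1 / r) = r - 1" using r by (auto simp: field_simps)
          then show ?thesis
            using young[THEN spec[of _ "M x epowr r"], THEN spec[of _ "F \<delta> (2 * R) x epowr r"]]
            by (simp only: epowr_epowr epowr_one)
        qed
        have F2: "F \<delta> (2 * R) x \<le> F \<delta> R x + M x"
        proof -
          have "F \<delta> (2 * R) x \<le> (\<integral>\<^sup>+\<rho>. gauge_quot N s \<eta> x \<rho> * indicator {\<delta>..R} \<rho> + gauge_quot N s \<eta> x \<rho> * indicator {R..2*R} \<rho> \<partial>mult_haar)"
            unfolding F_def by (intro nn_integral_mono) (auto simp: indicator_def)
          also have "\<dots> = F \<delta> R x + F R (2 * R) x"
            unfolding F_def by (rule nn_integral_add) measurable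
          also have "F R (2 * R) x \<le> ennreal (ln 2) * M x"
            using F_le[of R "2 * R" x] \<delta> by (simp add: ln_mult)
          also have "\<dots> \<le> 1 * M x"
            using ln_le_minus_one[of 2] by (intro mult_right_mono) (auto simp: ennreal_le_1)
          finally show ?thesis by (simp add: add_left_mono)
        qed
        have "F \<delta> (2 * R) x epowr r \<le> (F \<delta> R x + M x) epowr r"
          using F2 r by (intro epowr_mono) auto
        also have "\<dots> \<le> ennreal (2 powr r) * (F \<delta> R x epowr r + M x epowr r)"
          using r by (intro epowr_sum_le) auto
        finally have "F \<delta> (2 * R) x epowr r \<le> ennreal (2 powr r) * (F \<delta> R x epowr r + M x epowr r)" .
        then have "ennreal ((1/2) / 2 powr r) * F \<delta> (2 * R) x epowr r
            \<le> ennreal ((1/2) / 2 powr r) * (ennreal (2 powr r) * (F \<delta> R x epowr r + M x epowr r))"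
          by (rule mult_left_mono) simp
        also have "\<dots> = ennreal (1/2) * F \<delta> R x epowr r + ennreal (1/2) * M x epowr r"
          by (simp add: ennreal_mult_left distrib_left)
        finally have "ennreal C * (M x * F \<delta> (2 * R) x epowr (r - 1))
          \<le> ennreal Y * M x epowr r + (ennreal (1/2) * F \<delta> R x epowr r + ennreal (1/2) * M x epowr r)"
          by (rule order_trans[OF Y1 add_left_mono])
        also have "\<dots> = ennreal (Y + 1/2) * M x epowr r + ennreal (1/2) * F \<delta> R x epowr r"
          using Y by (subst ennreal_plus) (auto simp: distrib_right add_ac)
        finally show "ennreal C * (M x * F \<delta> (2 * R) x epowr (r - 1)) \<le> ennreal (Y + 1/2) * M x epowr r + ennreal (1/2) * F \<delta> R x epowr r" .
      qed
      also have "\<dots> = ennreal (Y + 1/2) * I + ennreal (1/2) * ?J"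
        unfolding I_def by (subst nn_integral_add) (auto simp: nn_integral_cmult)
      finally have "?J \<le> 2 * (ennreal (Y + 1/2) * I)"
        using Jfin by (intro ennreal_absorb) (auto simp: add.commute)
      also have "\<dots> = ennreal C' * I"
        unfolding C'_def using Y ennreal_mult_left[of 2 "Y + 1/2" I] by simp
      finally show ?thesis .
    qed
    have sup: "gauge_potential N s \<eta> x = (SUP k. F (1 / real (Suc k)) (real (Suc k)) x)" for x
    proof -
      have inc: "incseq (\<lambda>k \<rho>. gauge_quot N s \<eta> x \<rho> * indicator {1 / real (Suc k)..real (Suc k)} \<rho>)"
      proof (intro incseq_SucI le_funI mult_left_mono)
        fix k \<rho>
        have "1 / real (Suc (Suc k)) \<le> 1 / real (Suc k)" by (intro divide_left_mono) auto
        then show "indicator {1 / real (Suc k)..real (Suc k)} \<rho> \<le> (indicator {1 / real (Suc (Suc k))..real (Suc (Suc k))} \<rho> :: ennreal)"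
          by (auto simp: indicator_def)
      qed simp
      have "(SUP k. F (1 / real (Suc k)) (real (Suc k)) x)
        = (\<integral>\<^sup>+\<rho>. (SUP k. gauge_quot N s \<eta> x \<rho> * indicator {1 / real (Suc k)..real (Suc k)} \<rho>) \<partial>mult_haar)"
        unfolding F_def by (rule nn_integral_monotone_convergence_SUP[OF inc, symmetric]) measurable
      also have "\<dots> = gauge_potential N s \<eta> x"
        unfolding gauge_potential_def
      proof (intro nn_integral_cong antisym SUP_least)
        fix \<rho>
        show "gauge_quot N s \<eta> x \<rho> \<le> (SUP k. gauge_quot N s \<eta> x \<rho> * indicator {1 / real (Suc k)..real (Suc k)} \<rho>)"
        proof (cases "0 < \<rho>")
          case True
          obtain k1 where k1: "1 / real (Suc k1) < \<rho>" using nat_approx_posE[OF True] by auto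
          obtain k2 where k2: "\<rho> < real k2" using reals_Archimedean2 by auto
          define k where "k = max k1 k2"
          have "1 / real (Suc k) \<le> 1 / real (Suc k1)" by (intro divide_left_mono) (auto simp: k_def)
          then have "\<rho> \<in> {1 / real (Suc k)..real (Suc k)}" using k1 k2 by (auto simp: k_def)
          then have "gauge_quot N s \<eta> x \<rho> = gauge_quot N s \<eta> x \<rho> * indicator {1 / real (Suc k)..real (Suc k)} \<rho>" by simp
          then show ?thesis by (metis (no_types, lifting) SUP_upper UNIV_I)
        qed (simp add: gauge_quot_nonpos[OF \<eta>])
      qed (auto simp: indicator_def)
      finally show ?thesis by simp
    qed
    have inc: "incseq (\<lambda>k. F (1 / real (Suc k)) (real (Suc k)))"
    proof (intro incseq_SucI le_funI)
      fix k x
      have "1 / real (Suc (Suc k)) \<le> 1 / real (Suc k)" by (intro divide_left_mono) auto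
      then show "F (1 / real (Suc k)) (real (Suc k)) x \<le> F (1 / real (Suc (Suc k))) (real (Suc (Suc k))) x"
        unfolding F_def by (intro nn_integral_mono mult_left_mono) (auto simp: indicator_def)
    qed
    have "(\<integral>\<^sup>+x. gauge_potential N s \<eta> x epowr r \<partial>lborel)
       = (\<integral>\<^sup>+x. (SUP k. F (1 / real (Suc k)) (real (Suc k)) x epowr r) \<partial>lborel)"
      unfolding sup using r by (simp add: epowr_SUP)
    also have "\<dots> = (SUP k. \<integral>\<^sup>+x. F (1 / real (Suc k)) (real (Suc k)) x epowr r \<partial>lborel)"
    proof (rule nn_integral_monotone_convergence_SUP)
      show "incseq (\<lambda>k x. F (1 / real (Suc k)) (real (Suc k)) x epowr r)"
        using inc r by (auto simp: incseq_def le_fun_def intro!: epowr_mono)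
    qed measurable
    also have "\<dots> \<le> ennreal C' * I"
    proof (intro SUP_least trunc)
      fix k :: nat
      show "0 < 1 / real (Suc k)" by simp
      have "1 / real (Suc k) \<le> 1" "1 \<le> real (Suc k)" by auto
      then show "1 / real (Suc k) \<le> real (Suc k)" by linarith
    qed
    finally show "(\<integral>\<^sup>+x. gauge_potential N s \<eta> x epowr r \<partial>lborel) \<le> ennreal C' * (\<integral>\<^sup>+x. gauge_maximal N s \<eta> x epowr r \<partial>lborel)"
      by (simp add: I_def M_def)
  qed
qed

text \<open>The product \<open>s r\<close> is what matters: bounding all but the power \<open>t\<close> of the density by the maximal
  function replaces \<open>(s, r)\<close> by \<open>(s t, r/t)\<close>, and for small \<open>t\<close> the new exponents are in the range of
  the previous lemma.\<close>

theorem potential_power_integral_le_maximal: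
  assumes s: "0 < s" and N: "0 < N" "N < real DIM('a)" and r: "0 < r"
  shows "\<exists>C>0. \<forall>\<eta> :: 'a::euclidean_space \<Rightarrow> real \<Rightarrow> ennreal. ball_gauge \<eta> \<longrightarrow>
    (\<integral>\<^sup>+x. gauge_potential N s \<eta> x epowr r \<partial>lborel) \<le> ennreal C * (\<integral>\<^sup>+x. gauge_maximal N s \<eta> x epowr r \<partial>lborel)"
proof -
  \<comment> \<open>small enough that \<open>s t < 1\<close> and \<open>r/t > 2\<close>\<close>
  define t where "t = min (1/2) (min (1 / (2 * s)) (r / 3))"
  have t: "0 < t" "t < 1" "s * t < 1" "2 < r / t"
  proof -
    show "0 < t" "t < 1" using s r by (auto simp: t_def)
    have "s * t \<le> s * (1 / (2 * s))" using s by (intro mult_left_mono) (auto simp: t_def)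
    then show "s * t < 1" using s by simp
    have "t \<le> r / 3" by (auto simp: t_def)
    then show "2 < r / t" using \<open>0 < t\<close> r by (simp add: field_simps)
  qed
  obtain C where C: "C > 0" and K: "\<forall>\<eta> :: 'a::euclidean_space \<Rightarrow> real \<Rightarrow> ennreal. ball_gauge \<eta> \<longrightarrow>
    (\<integral>\<^sup>+x. gauge_potential N (s * t) \<eta> x epowr (r / t) \<partial>lborel) \<le> ennreal C * (\<integral>\<^sup>+x. gauge_maximal N (s * t) \<eta> x epowr (r / t) \<partial>lborel)"
    using potential_power_integral_le_small_exponent[OF _ t(3) N t(4)] s t by (auto simp: zero_less_mult_iff)
  obtain Y where Y: "Y > 0" and young: "\<forall>x y. ennreal 1 * (x epowr (1 - t) * y epowr t) \<le> ennreal Y * x + ennreal 1 * y"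
    using young_absorb[of t 1 1] t by auto
  show ?thesis
  proof (intro exI[of _ "Y + C"] conjI allI impI)
    show "Y + C > 0" using Y C by simp
    fix \<eta> :: "'a \<Rightarrow> real \<Rightarrow> ennreal" assume \<eta>: "ball_gauge \<eta>"
    note [measurable (raw)] = gauge_quot_measurable[OF \<eta>]
    define M where "M = gauge_maximal N s \<eta>"
    have M_meas [measurable]: "M \<in> borel_measurable borel" unfolding M_def by (rule gauge_maximal_measurable[OF \<eta> s])
    define G where "G = gauge_potential N (s * t) \<eta>"
    have G_meas [measurable]: "G \<in> borel_measurable borel" unfolding G_def by (rule gauge_potential_measurable[OF \<eta>])
    have pot: "gauge_potential N s \<eta> x \<le> M x epowr (1 - t) * G x" for x
    proof -
      have "gauge_potential N s \<eta> x \<le> (\<integral>\<^sup>+\<rho>. M x epowr (1 - t) * gauge_quot N (s * t) \<eta> x \<rho> \<partial>mult_haar)"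
        unfolding gauge_potential_def
      proof (intro nn_integral_mono)
        fix \<rho>
        have "gauge_quot N s \<eta> x \<rho> = gauge_quot N s \<eta> x \<rho> epowr (1 - t) * gauge_quot N s \<eta> x \<rho> epowr t"
          by (simp flip: epowr_add)
        also have "\<dots> \<le> M x epowr (1 - t) * gauge_quot N (s * t) \<eta> x \<rho>"
          unfolding M_def gauge_quot_epowr[of N s \<eta> x \<rho> t]
          using t by (intro mult_right_mono epowr_mono gauge_quot_le_maximal[OF \<eta>]) auto
        finally show "gauge_quot N s \<eta> x \<rho> \<le> M x epowr (1 - t) * gauge_quot N (s * t) \<eta> x \<rho>" .
      qed
      also have "\<dots> = M x epowr (1 - t) * G x"
        unfolding G_def gauge_potential_def by (rule nn_integral_cmult) measurable
      finally show ?thesis .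
    qed
    have "(\<integral>\<^sup>+x. gauge_potential N s \<eta> x epowr r \<partial>lborel) \<le> (\<integral>\<^sup>+x. ennreal Y * M x epowr r + G x epowr (r / t) \<partial>lborel)"
    proof (intro nn_integral_mono)
      fix x
      have "gauge_potential N s \<eta> x epowr r \<le> (M x epowr (1 - t) * G x) epowr r"
        using r by (intro epowr_mono pot) auto
      also have "\<dots> = (M x epowr r) epowr (1 - t) * (G x epowr (r / t)) epowr t"
        using r t by (simp add: epowr_mult mult.commute)
      also have "\<dots> \<le> ennreal Y * M x epowr r + G x epowr (r / t)"
        using young[THEN spec[of _ "M x epowr r"], THEN spec[of _ "G x epowr (r / t)"]] by simp
      finally show "gauge_potential N s \<eta> x epowr r \<le> ennreal Y * M x epowr r + G x epowr (r / t)" .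
    qed
    also have "\<dots> = ennreal Y * (\<integral>\<^sup>+x. M x epowr r \<partial>lborel) + (\<integral>\<^sup>+x. G x epowr (r / t) \<partial>lborel)"
      by (subst nn_integral_add) (auto simp: nn_integral_cmult)
    also have "(\<integral>\<^sup>+x. G x epowr (r / t) \<partial>lborel) \<le> ennreal C * (\<integral>\<^sup>+x. gauge_maximal N (s * t) \<eta> x epowr (r / t) \<partial>lborel)"
      unfolding G_def using K \<eta> by blast
    also have "(\<lambda>x. gauge_maximal N (s * t) \<eta> x epowr (r / t)) = (\<lambda>x. M x epowr r)"
      using t by (simp add: M_def gauge_maximal_epowr[symmetric])
    also have "ennreal Y * (\<integral>\<^sup>+x. M x epowr r \<partial>lborel) + ennreal C * (\<integral>\<^sup>+x. M x epowr r \<partial>lborel)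
       = ennreal (Y + C) * (\<integral>\<^sup>+x. M x epowr r \<partial>lborel)"
      using Y C by (simp add: ennreal_plus distrib_right)
    finally show "(\<integral>\<^sup>+x. gauge_potential N s \<eta> x epowr r \<partial>lborel) \<le> ennreal (Y + C) * (\<integral>\<^sup>+x. gauge_maximal N s \<eta> x epowr r \<partial>lborel)"
      by (simp add: M_def add_left_mono)
  qed
qed

section \<open>Measures and the constants \<open>\<kappa>\<close> as gauges\<close>

lemma ball_subset_ball_dist: "dist x y + \<rho> \<le> \<tau> \<Longrightarrow> ball x \<rho> \<subseteq> ball (y::'a::metric_space) \<tau>"
proof
  fix z assume "dist x y + \<rho> \<le> \<tau>" "z \<in> ball x \<rho>"
  then show "z \<in> ball y \<tau>" using dist_triangle[of y z x] by (simp add: dist_commute)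
qed

lemma ball_eq_UN_smaller_balls: "ball x \<rho> = (\<Union>k. ball (x::'a::metric_space) (\<rho> - 1 / real (Suc k)))"
proof (intro set_eqI iffI)
  fix z assume "z \<in> ball x \<rho>"
  then obtain k where "1 / real (Suc k) < \<rho> - dist x z" using nat_approx_posE[of "\<rho> - dist x z"] by auto
  then show "z \<in> (\<Union>k. ball x (\<rho> - 1 / real (Suc k)))" by (auto intro!: exI[of _ k])
next
  fix z assume "z \<in> (\<Union>k. ball x (\<rho> - 1 / real (Suc k)))"
  then obtain k where "dist x z < \<rho> - 1 / real (Suc k)" by auto
  moreover have "0 < 1 / real (Suc k)" by simp
  ultimately have "dist x z < \<rho>" by linarith
  then show "z \<in> ball x \<rho>" by simp
qed

lemma incseq_smaller_balls: "incseq (\<lambda>k. ball (x::'a::metric_space) (\<rho> - 1 / real (Suc k)))"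
proof (intro incseq_SucI subset_ball)
  fix k have "1 / real (Suc (Suc k)) \<le> 1 / real (Suc k)" by (intro divide_left_mono) auto
  then show "\<rho> - 1 / real (Suc k) \<le> \<rho> - 1 / real (Suc (Suc k))" by simp
qed

lemma disjoint_family_on_far_balls:
  assumes "pairwise (\<lambda>x z. 2 * \<rho> \<le> dist x z) I"
  shows "disjoint_family_on (\<lambda>x. ball (x::'a::metric_space) \<rho>) I"
  unfolding disjoint_family_on_def
proof (intro ballI impI equals0I)
  fix x z w assume *: "x \<in> I" "z \<in> I" "x \<noteq> z" "w \<in> ball x \<rho> \<inter> ball z \<rho>"
  then have "2 * \<rho> \<le> dist x z" using assms by (auto simp: pairwise_def)
  moreover have "dist x z < \<rho> + \<rho>" using * by (intro dist_triangle_less_add[of _ w]) (auto simp: dist_commute)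
  ultimately show False by simp
qed

lemma ball_gauge_emeasure:
  fixes \<nu> :: "'a::euclidean_space measure"
  assumes [simp]: "sets \<nu> = sets borel"
  shows "ball_gauge (\<lambda>x \<rho>. emeasure \<nu> (ball x \<rho>))"
  unfolding ball_gauge_def
proof (intro conjI allI impI)
  fix x y :: 'a and \<rho> \<tau> :: real
  show "\<rho> \<le> 0 \<Longrightarrow> emeasure \<nu> (ball x \<rho>) = 0" by (simp add: ball_empty)
  show "dist x y + \<rho> \<le> \<tau> \<Longrightarrow> emeasure \<nu> (ball x \<rho>) \<le> emeasure \<nu> (ball y \<tau>)"
    by (intro emeasure_mono ball_subset_ball_dist) auto
next
  fix I and \<rho> \<tau> :: real and y :: 'a
  assume I: "finite I" "\<forall>x\<in>I. dist x y + \<rho> \<le> \<tau>" "pairwise (\<lambda>x z. 2 * \<rho> \<le> dist x z) I"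
  have "(\<Sum>x\<in>I. emeasure \<nu> (ball x \<rho>)) = emeasure \<nu> (\<Union>x\<in>I. ball x \<rho>)"
    using I by (intro sum_emeasure disjoint_family_on_far_balls) auto
  also have "\<dots> \<le> emeasure \<nu> (ball y \<tau>)"
    using I by (intro emeasure_mono UN_least ball_subset_ball_dist) auto
  finally show "(\<Sum>x\<in>I. emeasure \<nu> (ball x \<rho>)) \<le> emeasure \<nu> (ball y \<tau>)" .
next
  fix x :: 'a and \<rho> c assume "c < emeasure \<nu> (ball x \<rho>)"
  also have "emeasure \<nu> (ball x \<rho>) = (SUP k. emeasure \<nu> (ball x (\<rho> - 1 / real (Suc k))))"
    by (subst ball_eq_UN_smaller_balls, rule SUP_emeasure_incseq[symmetric, OF _ incseq_smaller_balls]) auto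
  finally obtain k where "c < emeasure \<nu> (ball x (\<rho> - 1 / real (Suc k)))" by (auto simp: less_SUP_iff)
  then show "\<exists>\<rho>'<\<rho>. c < emeasure \<nu> (ball x \<rho>')" by (intro exI[of _ "\<rho> - 1 / real (Suc k)"]) auto
qed

definition add_measure :: "'a measure \<Rightarrow> 'a measure \<Rightarrow> 'a measure" where
  "add_measure \<mu> \<nu> = measure_of (space \<mu>) (sets \<mu>) (\<lambda>A. emeasure \<mu> A + emeasure \<nu> A)"

lemma sets_add_measure [simp, measurable_cong]: "sets (add_measure \<mu> \<nu>) = sets \<mu>"
  by (simp add: add_measure_def)

lemma emeasure_add_measure:
  assumes "sets \<nu> = sets \<mu>" "A \<in> sets \<mu>"
  shows "emeasure (add_measure \<mu> \<nu>) A = emeasure \<mu> A + emeasure \<nu> A"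
  unfolding add_measure_def
proof (rule emeasure_measure_of_sigma)
  show "countably_additive (sets \<mu>) (\<lambda>A. emeasure \<mu> A + emeasure \<nu> A)"
    unfolding countably_additive_def
  proof (intro allI impI)
    fix F :: "nat \<Rightarrow> 'a set" assume F: "range F \<subseteq> sets \<mu>" "disjoint_family F"
    have "(\<Sum>i. emeasure \<mu> (F i) + emeasure \<nu> (F i)) = (\<Sum>i. emeasure \<mu> (F i)) + (\<Sum>i. emeasure \<nu> (F i))"
      by (rule suminf_add[symmetric]) (rule summableI)+
    also have "(\<Sum>i. emeasure \<mu> (F i)) = emeasure \<mu> (\<Union>i. F i)"
      using F by (intro suminf_emeasure)
    also have "(\<Sum>i. emeasure \<nu> (F i)) = emeasure \<nu> (\<Union>i. F i)"
      using F assms(1) by (intro suminf_emeasure) simp_all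
    finally show "(\<Sum>i. emeasure \<mu> (F i) + emeasure \<nu> (F i)) = emeasure \<mu> (\<Union>i. F i) + emeasure \<nu> (\<Union>i. F i)" .
  qed
qed (use assms in \<open>auto simp: positive_def sets.sigma_algebra_axioms\<close>)

text \<open>The parameter \<open>dim\<close> serves to fix the type \<open>'n\<close>, on which \<open>N\<close> depends.\<close>

locale wolff_exponents =
  fixes \<alpha> p q :: real and dim :: "'n::finite itself"
  assumes p: "1 < p" and q: "0 < q" "q < p - 1" and \<alpha>: "0 < \<alpha>" "\<alpha> < real CARD('n) / p"
begin

definition "N = real CARD('n) - \<alpha> * p"
definition "s = 1 / (p - 1)"
definition "\<theta> = q / (p - 1)"
definition "\<gamma> = q * (p - 1) / (p - 1 - q)"

lemma N: "0 < N" "N < real DIM(real^'n)"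
  using p \<alpha> by (auto simp: N_def field_simps)

lemma s: "0 < s" using p by (simp add: s_def)

lemma \<theta>: "0 < \<theta>" "\<theta> < 1" "s * q = \<theta>" "q * s = \<theta>" using p q by (auto simp: \<theta>_def s_def)

lemma \<gamma>: "0 < \<gamma>" "\<gamma> * (1 - \<theta>) = q" "\<gamma> = q / (1 - \<theta>)"
proof -
  have 1: "1 - \<theta> = (p - 1 - q) / (p - 1)" using p by (simp add: \<theta>_def field_simps)
  show "0 < \<gamma>" "\<gamma> * (1 - \<theta>) = q" using p q unfolding 1 by (auto simp: \<gamma>_def)
  then show "\<gamma> = q / (1 - \<theta>)" using \<theta>(1,2) by (simp add: field_simps)
qed

abbreviation W :: "(real^'n) measure \<Rightarrow> real^'n \<Rightarrow> ennreal" where "W \<equiv> wolff \<alpha> p"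
abbreviation \<kappa> :: "(real^'n) measure \<Rightarrow> (real^'n) set \<Rightarrow> ennreal" where "\<kappa> \<equiv> kappa \<alpha> p q"
text \<open>For a Borel function \<open>v\<close> this is \<open>v\<^sup>q d\<sigma>\<close> without the completion of \<open>\<sigma>\<close>.\<close>

abbreviation power_density :: "(real^'n) measure \<Rightarrow> (real^'n \<Rightarrow> ennreal) \<Rightarrow> (real^'n) measure" where
  "power_density \<sigma> v \<equiv> density \<sigma> (\<lambda>x. v x epowr q)"

abbreviation scaled_restriction :: "(real^'n) measure \<Rightarrow> real \<Rightarrow> real \<Rightarrow> (real^'n) measure" where
  "scaled_restriction \<sigma> e R \<equiv> density \<sigma> (\<lambda>y. ennreal e * indicator (ball 0 R) y)"

abbreviation mass :: "(real^'n) measure \<Rightarrow> real^'n \<Rightarrow> real \<Rightarrow> ennreal" where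
  "mass \<nu> x \<rho> \<equiv> emeasure \<nu> (ball x \<rho>)"

lemma W_eq:
  assumes "sets \<nu> = sets borel"
  shows "W \<nu> x = gauge_potential N s (mass \<nu>) x"
proof -
  have "(\<lambda>\<rho>. gauge_quot N s (mass \<nu>) x \<rho>) \<in> borel_measurable borel"
    by (rule gauge_quot_measurable[OF ball_gauge_emeasure[OF assms]]) auto
  from nn_integral_mult_haar[OF this] show ?thesis
    by (simp add: wolff_def gauge_potential_def gauge_quot_def N_def s_def)
qed

lemma W_measurable:
  assumes "sets \<nu> = sets borel"
  shows "W \<nu> \<in> borel_measurable borel"
proof -
  have "W \<nu> = gauge_potential N s (mass \<nu>)" by (rule ext) (rule W_eq[OF assms])
  then show ?thesis using gauge_potential_measurable[OF ball_gauge_emeasure[OF assms], of N s] by simp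
qed

lemma W_mono:
  assumes "\<And>\<rho>. mass \<nu> x \<rho> \<le> mass \<mu> x \<rho>"
  shows "W \<nu> x \<le> W \<mu> x"
  unfolding wolff_def
proof (rule nn_integral_mono)
  fix \<rho> :: real
  let ?D = "ennreal (\<rho> powr (real CARD('n) - \<alpha> * p))"
  have "(mass \<nu> x \<rho> / ?D) epowr (1 / (p - 1)) \<le> (mass \<mu> x \<rho> / ?D) epowr (1 / (p - 1))"
    using p assms[of \<rho>] by (intro epowr_mono divide_right_mono_ennreal) auto
  then show "(mass \<nu> x \<rho> / ?D) epowr (1 / (p - 1)) / ennreal \<rho> * indicator {0<..} \<rho>
      \<le> (mass \<mu> x \<rho> / ?D) epowr (1 / (p - 1)) / ennreal \<rho> * indicator {0<..} \<rho>"
    by (rule mult_right_mono[OF divide_right_mono_ennreal]) simp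
qed

lemma W_scale:
  assumes [simp]: "sets \<nu> = sets borel" and c: "0 \<le> c"
  shows "W (scale_measure (ennreal c) \<nu>) x = ennreal (c powr s) * W \<nu> x"
proof -
  note [measurable (raw)] = gauge_quot_measurable[OF ball_gauge_emeasure[OF assms(1)]]
  have "gauge_quot N s (mass (scale_measure (ennreal c) \<nu>)) x = (\<lambda>\<rho>. ennreal (c powr s) * gauge_quot N s (mass \<nu>) x \<rho>)"
    using c s by (intro ext) (simp add: gauge_quot_def epowr_ennreal_mult ennreal_times_divide[symmetric])
  then have "gauge_potential N s (mass (scale_measure (ennreal c) \<nu>)) x
      = (\<integral>\<^sup>+\<rho>. ennreal (c powr s) * gauge_quot N s (mass \<nu>) x \<rho> \<partial>mult_haar)"
    unfolding gauge_potential_def by (simp only:)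
  also have "\<dots> = ennreal (c powr s) * gauge_potential N s (mass \<nu>) x"
    unfolding gauge_potential_def by (rule nn_integral_cmult) measurable
  finally show ?thesis by (simp add: W_eq)
qed

text \<open>The constant of \<open>gauge_maximal_le_potential\<close>.\<close>

definition "c_low = 2 powr (N * s) / ln 2"

lemma c_low: "c_low > 0" by (simp add: c_low_def)

lemma W_lower:
  assumes "sets \<nu> = sets borel" "0 < \<rho>"
  shows "ennreal (\<rho> powr (- (N * s))) * mass \<nu> x \<rho> epowr s \<le> ennreal c_low * W \<nu> x"
  using gauge_quot_le_potential[OF ball_gauge_emeasure[OF assms(1)] assms(2) s N(1), of x] assms s
  by (simp add: gauge_quot_eq W_eq c_low_def)

lemma exists_ball_mass:
  assumes \<nu>: "sets \<nu> = sets borel" and "emeasure \<nu> UNIV \<noteq> 0"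
  shows "\<exists>R>0. mass \<nu> x R \<noteq> 0"
proof -
  have "(\<Union>k. ball x (real k)) = UNIV"
    by (auto intro: reals_Archimedean2)
  then have "emeasure \<nu> UNIV = (SUP k. emeasure \<nu> (ball x (real k)))"
    using \<nu> by (subst SUP_emeasure_incseq) (auto simp: incseq_def)
  moreover have "(SUP k. emeasure \<nu> (ball x (real k))) \<le> 0" if "\<forall>k. emeasure \<nu> (ball x (real k)) = 0"
    using that by (intro SUP_least) simp
  ultimately have "\<not> (\<forall>k. emeasure \<nu> (ball x (real k)) = 0)"
    using assms(2) by (metis le_zero_eq)
  then obtain k where k: "emeasure \<nu> (ball x (real k)) \<noteq> 0" by blast
  then have "0 < real k" by (cases k) (auto simp: ball_empty)
  with k show ?thesis by blast
qed

lemma W_pos: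
  assumes \<nu>: "sets \<nu> = sets borel" and "emeasure \<nu> UNIV \<noteq> 0"
  shows "0 < W \<nu> x"
proof -
  obtain R where R: "0 < R" "mass \<nu> x R \<noteq> 0" using exists_ball_mass[OF assms] by blast
  then have "ennreal (R powr (- (N * s))) * mass \<nu> x R epowr s \<noteq> 0" by auto
  moreover have "ennreal (R powr (- (N * s))) * mass \<nu> x R epowr s \<le> ennreal c_low * W \<nu> x"
    by (rule W_lower[OF \<nu> R(1)])
  ultimately have "W \<nu> x \<noteq> 0" by (intro notI) simp
  then show ?thesis by (simp add: zero_less_iff_neq_zero)
qed

lemma radon_sets: "radon_measure \<nu> \<Longrightarrow> sets \<nu> = sets borel"
  by (simp add: radon_measure_def)

lemma radon_space: "radon_measure \<nu> \<Longrightarrow> space \<nu> = UNIV"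
  using sets_eq_imp_space_eq[of \<nu> borel] by (simp add: radon_measure_def)

lemma radon_ball: "radon_measure (\<nu> :: (real^'n) measure) \<Longrightarrow> mass \<nu> x \<rho> < top"
  by (rule order_le_less_trans[of _ "emeasure \<nu> (cball x \<rho>)"])
     (auto simp: radon_measure_def intro!: emeasure_mono)

lemma radonI_finite:
  assumes "sets (\<nu> :: (real^'n) measure) = sets borel" "emeasure \<nu> UNIV < top"
  shows "radon_measure \<nu>"
  unfolding radon_measure_def using assms emeasure_mono[of _ UNIV \<nu>]
  by (auto intro: order_le_less_trans[of _ "emeasure \<nu> UNIV"])

lemma W_zero:
  assumes "sets \<nu> = sets borel" "emeasure \<nu> UNIV = 0"
  shows "W \<nu> x = 0"
proof -
  have "mass \<nu> x \<rho> = 0" for \<rho>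
    using assms emeasure_mono[of "ball x \<rho>" UNIV \<nu>] by auto
  then show ?thesis by (simp add: wolff_def)
qed

lemma kappa_mono: "A \<subseteq> B \<Longrightarrow> \<kappa> \<sigma> A \<le> \<kappa> \<sigma> B"
  unfolding kappa_def
proof (rule Inf_superset_mono, rule Collect_mono, intro impI allI)
  fix c and \<nu> :: "(real^'n) measure"
  assume AB: "A \<subseteq> B" and *: "\<forall>\<nu>. radon_measure \<nu> \<longrightarrow> emeasure \<nu> UNIV < \<infinity> \<longrightarrow>
     (\<integral>\<^sup>+x\<in>B. W \<nu> x epowr q \<partial>\<sigma>) epowr (1 / q) \<le> c * emeasure \<nu> UNIV epowr (1 / (p - 1))"
    and \<nu>: "radon_measure \<nu>" "emeasure \<nu> UNIV < \<infinity>"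
  have "(\<integral>\<^sup>+x\<in>A. W \<nu> x epowr q \<partial>\<sigma>) \<le> (\<integral>\<^sup>+x\<in>B. W \<nu> x epowr q \<partial>\<sigma>)"
    using AB by (intro nn_integral_mono) (auto simp: indicator_def)
  then have "(\<integral>\<^sup>+x\<in>A. W \<nu> x epowr q \<partial>\<sigma>) epowr (1 / q) \<le> (\<integral>\<^sup>+x\<in>B. W \<nu> x epowr q \<partial>\<sigma>) epowr (1 / q)"
    using q by (intro epowr_mono) auto
  also have "\<dots> \<le> c * emeasure \<nu> UNIV epowr (1 / (p - 1))" using * \<nu> by blast
  finally show "(\<integral>\<^sup>+x\<in>A. W \<nu> x epowr q \<partial>\<sigma>) epowr (1 / q) \<le> c * emeasure \<nu> UNIV epowr (1 / (p - 1))" .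
qed

lemma kappa_bound:
  assumes \<nu>: "radon_measure \<nu>" "emeasure \<nu> UNIV < top"
  shows "(\<integral>\<^sup>+x\<in>B. W \<nu> x epowr q \<partial>\<sigma>) \<le> \<kappa> \<sigma> B epowr q * emeasure \<nu> UNIV epowr \<theta>"
proof (cases "emeasure \<nu> UNIV = 0")
  case True
  then show ?thesis using \<nu> by (simp add: W_zero radon_sets)
next
  case False
  obtain m where m: "emeasure \<nu> UNIV = ennreal m" "0 < m"
    using \<nu>(2) False by (metis ennreal_cases ennreal_eq_0_iff less_irrefl not_le order_le_less)
  let ?I = "\<integral>\<^sup>+x\<in>B. W \<nu> x epowr q \<partial>\<sigma>"
  have "?I epowr (1 / q) * ennreal (m powr (- s)) \<le> \<kappa> \<sigma> B"
    unfolding kappa_def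
  proof (rule Inf_greatest, clarify)
    fix c assume "\<forall>\<nu>. radon_measure \<nu> \<longrightarrow> emeasure \<nu> UNIV < \<infinity> \<longrightarrow>
     (\<integral>\<^sup>+x\<in>B. W \<nu> x epowr q \<partial>\<sigma>) epowr (1 / q) \<le> c * emeasure \<nu> UNIV epowr (1 / (p - 1))"
    then have "?I epowr (1 / q) \<le> c * emeasure \<nu> UNIV epowr (1 / (p - 1))" using \<nu> by simp
    then have "?I epowr (1 / q) * ennreal (m powr (- s)) \<le> c * ennreal (m powr s) * ennreal (m powr (- s))"
      using m by (intro mult_right_mono) (auto simp: s_def)
    also have "\<dots> = c"
      using m by (simp add: mult.assoc ennreal_mult[symmetric] powr_add[symmetric])
    finally show "?I epowr (1 / q) * ennreal (m powr (- s)) \<le> c" .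
  qed
  then have "?I epowr (1 / q) * ennreal (m powr (- s)) * ennreal (m powr s) \<le> \<kappa> \<sigma> B * ennreal (m powr s)"
    by (rule mult_right_mono) simp
  then have "?I epowr (1 / q) \<le> \<kappa> \<sigma> B * ennreal (m powr s)"
    using m by (simp add: mult.assoc ennreal_mult[symmetric] powr_add[symmetric])
  then have "(?I epowr (1 / q)) epowr q \<le> (\<kappa> \<sigma> B * ennreal (m powr s)) epowr q"
    using q by (intro epowr_mono) auto
  then show ?thesis using q m by (simp add: epowr_mult powr_powr \<theta>)
qed

lemma kappa_witness:
  assumes "c < \<kappa> \<sigma> B"
  obtains \<nu> where "radon_measure \<nu>" "emeasure \<nu> UNIV < top"
    "c epowr q * emeasure \<nu> UNIV epowr \<theta> < (\<integral>\<^sup>+x\<in>B. W \<nu> x epowr q \<partial>\<sigma>)"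
proof -
  have "\<not> (\<forall>\<nu>. radon_measure \<nu> \<longrightarrow> emeasure \<nu> UNIV < \<infinity> \<longrightarrow>
     (\<integral>\<^sup>+x\<in>B. W \<nu> x epowr q \<partial>\<sigma>) epowr (1 / q) \<le> c * emeasure \<nu> UNIV epowr (1 / (p - 1)))"
  proof
    assume "\<forall>\<nu>. radon_measure \<nu> \<longrightarrow> emeasure \<nu> UNIV < \<infinity> \<longrightarrow>
     (\<integral>\<^sup>+x\<in>B. W \<nu> x epowr q \<partial>\<sigma>) epowr (1 / q) \<le> c * emeasure \<nu> UNIV epowr (1 / (p - 1))"
    then have "\<kappa> \<sigma> B \<le> c" unfolding kappa_def by (intro Inf_lower) simp
    with assms show False by simp
  qed
  then obtain \<nu> where \<nu>: "radon_measure \<nu>" "emeasure \<nu> UNIV < top"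
    "c * emeasure \<nu> UNIV epowr s < (\<integral>\<^sup>+x\<in>B. W \<nu> x epowr q \<partial>\<sigma>) epowr (1 / q)"
    by (auto simp: not_le s_def)
  have "(c * emeasure \<nu> UNIV epowr s) epowr q < ((\<integral>\<^sup>+x\<in>B. W \<nu> x epowr q \<partial>\<sigma>) epowr (1 / q)) epowr q"
    using \<nu>(3) q(1) by (simp only: epowr_less_cancel)
  then have "c epowr q * emeasure \<nu> UNIV epowr \<theta> < (\<integral>\<^sup>+x\<in>B. W \<nu> x epowr q \<partial>\<sigma>)"
    using q by (simp add: epowr_mult \<theta>)
  with \<nu> that show ?thesis by blast
qed

text \<open>Testing measures may be rescaled, since the potential is homogeneous of degree \<open>s\<close>. The
  normalization of the mass to \<open>c\<close> to the power \<open>\<gamma>\<close> is the one for which mass and tested integral have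
  the same lower bound, so that both simply add up when test measures are added.\<close>

lemma kappa_witness_normalized:
  assumes \<sigma>: "sets \<sigma> = sets borel" and B: "B \<in> sets borel" and c: "0 < c" "ennreal c < \<kappa> \<sigma> B"
  obtains \<nu> where "sets \<nu> = sets borel" "emeasure \<nu> UNIV = ennreal (c powr \<gamma>)"
    "ennreal (c powr \<gamma>) \<le> (\<integral>\<^sup>+x\<in>B. W \<nu> x epowr q \<partial>\<sigma>)"
proof -
  obtain \<nu> where \<nu>: "radon_measure \<nu>" "emeasure \<nu> UNIV < top"
    "ennreal c epowr q * emeasure \<nu> UNIV epowr \<theta> < (\<integral>\<^sup>+x\<in>B. W \<nu> x epowr q \<partial>\<sigma>)"
    using kappa_witness[OF c(2)] by blast
  note [measurable] = B W_measurable[OF radon_sets[OF \<nu>(1)]]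
  note [measurable_cong] = \<sigma>
  have "emeasure \<nu> UNIV \<noteq> 0"
    using \<nu> W_zero[OF radon_sets[OF \<nu>(1)]] by (intro notI) simp
  then obtain m where m: "emeasure \<nu> UNIV = ennreal m" "0 < m"
    using \<nu>(2) by (metis ennreal_cases ennreal_eq_0_iff less_irrefl not_le order_le_less)
  \<comment> \<open>the factor that brings the mass to the required value\<close>
  define k where "k = c powr \<gamma> / m"
  have k: "k > 0" using c m by (simp add: k_def)
  let ?\<nu> = "scale_measure (ennreal k) \<nu>"
  have "k powr \<theta> * (c powr q * m powr \<theta>) = c powr (\<gamma> * \<theta> + q)"
    using c m by (simp add: k_def powr_divide powr_powr powr_add)
  also have "\<gamma> * \<theta> + q = \<gamma>" using \<gamma>(2) by (simp add: algebra_simps)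
  finally have eq: "k powr \<theta> * (c powr q * m powr \<theta>) = c powr \<gamma>" .
  show ?thesis
  proof (rule that[of ?\<nu>])
    show "sets ?\<nu> = sets borel" using \<nu> by (simp add: radon_sets)
    show "emeasure ?\<nu> UNIV = ennreal (c powr \<gamma>)"
      using c m k by (simp add: ennreal_mult[symmetric] k_def)
    have "ennreal (c powr \<gamma>) = ennreal (k powr \<theta>) * (ennreal c epowr q * emeasure \<nu> UNIV epowr \<theta>)"
      using c m by (simp add: ennreal_mult[symmetric] eq)
    also have "\<dots> \<le> ennreal (k powr \<theta>) * (\<integral>\<^sup>+x\<in>B. W \<nu> x epowr q \<partial>\<sigma>)"
      using \<nu>(3) by (intro mult_left_mono) auto
    also have "\<dots> = (\<integral>\<^sup>+x. ennreal (k powr \<theta>) * (W \<nu> x epowr q * indicator B x) \<partial>\<sigma>)"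
      using B by (intro nn_integral_cmult[symmetric]) measurable
    also have "\<dots> = (\<integral>\<^sup>+x\<in>B. W ?\<nu> x epowr q \<partial>\<sigma>)"
      using k q by (simp add: W_scale radon_sets[OF \<nu>(1)] epowr_ennreal_mult powr_powr \<theta> mult.assoc)
    finally show "ennreal (c powr \<gamma>) \<le> (\<integral>\<^sup>+x\<in>B. W ?\<nu> x epowr q \<partial>\<sigma>)" .
  qed
qed

text \<open>Add nearly optimal normalized test measures for \<open>A\<close> and for \<open>B\<close>. The sum has some mass \<open>m\<close>, and its
  potential, integrated over the union, gives at least \<open>m\<close>. Hence \<open>m \<le> \<kappa>\<^sup>q m\<^sup>\<theta>\<close> for the union, that
  is, \<open>m\<close> is at most \<open>\<kappa>\<close> to the power \<open>q/(1-\<theta>) = \<gamma>\<close>.\<close>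

lemma kappa_superadditive2:
  assumes \<sigma>: "sets \<sigma> = sets borel" and AB: "A \<in> sets borel" "B \<in> sets borel" "A \<inter> B = {}"
  shows "\<kappa> \<sigma> A epowr \<gamma> + \<kappa> \<sigma> B epowr \<gamma> \<le> \<kappa> \<sigma> (A \<union> B) epowr \<gamma>"
proof (cases "\<kappa> \<sigma> (A \<union> B) = top \<or> \<kappa> \<sigma> A = 0 \<or> \<kappa> \<sigma> B = 0")
  case True
  then show ?thesis using \<gamma>(1) kappa_mono[of A "A \<union> B" \<sigma>] kappa_mono[of B "A \<union> B" \<sigma>] by auto
next
  case False
  note [measurable_cong] = \<sigma>
  note [measurable] = AB(1,2)
  obtain K where K: "\<kappa> \<sigma> (A \<union> B) = ennreal K" "0 \<le> K" using False by (metis ennreal_cases)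
  have "\<kappa> \<sigma> A < top" "\<kappa> \<sigma> B < top"
    using K kappa_mono[of A "A \<union> B" \<sigma>] kappa_mono[of B "A \<union> B" \<sigma>] by (auto intro: order_le_less_trans)
  then obtain a b where a: "\<kappa> \<sigma> A = ennreal a" "0 < a" and b: "\<kappa> \<sigma> B = ennreal b" "0 < b"
    using False by (metis ennreal_cases ennreal_eq_0_iff less_irrefl not_le order_le_less)
  have "a powr \<gamma> + b powr \<gamma> \<le> K powr \<gamma>"
  proof (rule field_le_mult_one_interval)
    fix z :: real assume z: "0 < z" "z < 1"
    define l where "l = z powr (1 / \<gamma>)"
    have l: "0 < l" "l < 1" "l powr \<gamma> = z" using z \<gamma>(1) powr_less_mono2[of "1 / \<gamma>" z 1] by (auto simp: l_def powr_powr)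
    have la: "0 < l * a" "ennreal (l * a) < \<kappa> \<sigma> A" and lb: "0 < l * b" "ennreal (l * b) < \<kappa> \<sigma> B"
      using a b l by (auto simp: ennreal_less_iff)
    obtain \<mu> where \<mu>: "sets \<mu> = sets borel" "emeasure \<mu> UNIV = ennreal ((l * a) powr \<gamma>)"
      "ennreal ((l * a) powr \<gamma>) \<le> (\<integral>\<^sup>+x\<in>A. W \<mu> x epowr q \<partial>\<sigma>)"
      using kappa_witness_normalized[OF \<sigma> AB(1) la] by blast
    obtain \<nu> where \<nu>: "sets \<nu> = sets borel" "emeasure \<nu> UNIV = ennreal ((l * b) powr \<gamma>)"
      "ennreal ((l * b) powr \<gamma>) \<le> (\<integral>\<^sup>+x\<in>B. W \<nu> x epowr q \<partial>\<sigma>)"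
      using kappa_witness_normalized[OF \<sigma> AB(2) lb] by blast
    let ?\<omega> = "add_measure \<mu> \<nu>"
    define m where "m = (l * a) powr \<gamma> + (l * b) powr \<gamma>"
    have m: "m > 0" using a b l by (auto simp: m_def intro!: add_pos_pos)
    have em: "emeasure ?\<omega> X = emeasure \<mu> X + emeasure \<nu> X" if "X \<in> sets borel" for X
      using that \<mu>(1) \<nu>(1) by (intro emeasure_add_measure) auto
    have \<omega>: "sets ?\<omega> = sets borel" "emeasure ?\<omega> UNIV = ennreal m"
      using \<mu> \<nu> em[of UNIV] by (auto simp: m_def)
    note [measurable] = W_measurable[OF \<mu>(1)] W_measurable[OF \<nu>(1)] W_measurable[OF \<omega>(1)]
    have W: "W \<mu> x \<le> W ?\<omega> x" "W \<nu> x \<le> W ?\<omega> x" for x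
      by (auto intro!: W_mono simp: em)
    have "ennreal m \<le> (\<integral>\<^sup>+x\<in>A. W \<mu> x epowr q \<partial>\<sigma>) + (\<integral>\<^sup>+x\<in>B. W \<nu> x epowr q \<partial>\<sigma>)"
      using \<mu>(3) \<nu>(3) by (simp add: m_def add_mono)
    also have "\<dots> \<le> (\<integral>\<^sup>+x\<in>A. W ?\<omega> x epowr q \<partial>\<sigma>) + (\<integral>\<^sup>+x\<in>B. W ?\<omega> x epowr q \<partial>\<sigma>)"
      using q by (intro add_mono nn_integral_mono mult_right_mono epowr_mono W) auto
    also have "\<dots> = (\<integral>\<^sup>+x. W ?\<omega> x epowr q * indicator A x + W ?\<omega> x epowr q * indicator B x \<partial>\<sigma>)"
      using AB by (intro nn_integral_add[symmetric]) measurable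
    also have "\<dots> = (\<integral>\<^sup>+x\<in>A \<union> B. W ?\<omega> x epowr q \<partial>\<sigma>)"
      using AB(3) by (intro nn_integral_cong) (auto simp: indicator_def)
    also have "\<dots> \<le> \<kappa> \<sigma> (A \<union> B) epowr q * emeasure ?\<omega> UNIV epowr \<theta>"
      using \<omega> by (intro kappa_bound radonI_finite) auto
    also have "\<dots> = ennreal (K powr q * m powr \<theta>)"
      using K \<omega> m by (simp add: ennreal_mult)
    finally have "m \<le> K powr q * m powr \<theta>" by (subst (asm) ennreal_le_iff) auto
    then have "m * m powr (- \<theta>) \<le> K powr q * m powr \<theta> * m powr (- \<theta>)"
      by (rule mult_right_mono) simp
    moreover have "m * m powr (- \<theta>) = m powr (1 - \<theta>)"
      using m by (simp add: powr_diff powr_minus divide_inverse)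
    moreover have "m powr \<theta> * m powr (- \<theta>) = 1"
      using m by (simp add: powr_add[symmetric])
    ultimately have "m powr (1 - \<theta>) \<le> K powr q"
      by (simp add: mult.assoc)
    then have "(m powr (1 - \<theta>)) powr (1 / (1 - \<theta>)) \<le> (K powr q) powr (1 / (1 - \<theta>))"
      using \<theta>(1,2) by (intro powr_mono2) auto
    then have "m \<le> K powr \<gamma>" using m \<theta>(1,2) by (simp add: powr_powr \<gamma>(3))
    then show "z * (a powr \<gamma> + b powr \<gamma>) \<le> K powr \<gamma>"
      using l a b by (simp add: m_def powr_mult distrib_left)
  qed
  then show ?thesis using a b K by (simp add: ennreal_plus[symmetric] del: ennreal_plus)
qed

lemma kappa_empty: "\<kappa> \<sigma> {} = 0"
proof -
  have "\<kappa> \<sigma> {} \<le> 0" unfolding kappa_def using q by (intro Inf_lower) simp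
  then show ?thesis by simp
qed

lemma kappa_superadditive:
  assumes \<sigma>: "sets \<sigma> = sets borel" and "finite I" "\<And>i. i \<in> I \<Longrightarrow> F i \<in> sets borel" "disjoint_family_on F I"
  shows "(\<Sum>i\<in>I. \<kappa> \<sigma> (F i) epowr \<gamma>) \<le> \<kappa> \<sigma> (\<Union>i\<in>I. F i) epowr \<gamma>"
  using assms(2-)
proof (induction I)
  case (insert i I)
  have "(\<Sum>j\<in>insert i I. \<kappa> \<sigma> (F j) epowr \<gamma>) \<le> \<kappa> \<sigma> (F i) epowr \<gamma> + \<kappa> \<sigma> (\<Union>i\<in>I. F i) epowr \<gamma>"
    using insert by (auto simp: disjoint_family_on_def intro!: add_left_mono)
  also have "\<dots> \<le> \<kappa> \<sigma> (F i \<union> (\<Union>i\<in>I. F i)) epowr \<gamma>"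
    using insert by (intro kappa_superadditive2 \<sigma>) (auto simp: disjoint_family_on_def)
  finally show ?case by simp
qed (simp add: kappa_empty)

abbreviation "kgauge \<sigma> x \<rho> \<equiv> \<kappa> \<sigma> (ball x \<rho>) epowr \<gamma>"

text \<open>Continuity from inside holds because a test measure that exceeds a constant on the ball does so, by
  monotone convergence, on a slightly smaller ball.\<close>

lemma ball_gauge_kappa:
  assumes \<sigma>: "sets \<sigma> = sets borel"
  shows "ball_gauge (kgauge \<sigma>)"
  unfolding ball_gauge_def
proof (intro conjI allI impI)
  fix x y :: "real^'n" and \<rho> \<tau> :: real
  show "\<rho> \<le> 0 \<Longrightarrow> kgauge \<sigma> x \<rho> = 0" by (simp add: ball_empty kappa_empty)
  show "dist x y + \<rho> \<le> \<tau> \<Longrightarrow> kgauge \<sigma> x \<rho> \<le> kgauge \<sigma> y \<tau>"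
    using \<gamma>(1) by (intro epowr_mono kappa_mono ball_subset_ball_dist) auto
next
  fix I and \<rho> \<tau> :: real and y :: "real^'n"
  assume I: "finite I" "\<forall>x\<in>I. dist x y + \<rho> \<le> \<tau>" "pairwise (\<lambda>x z. 2 * \<rho> \<le> dist x z) I"
  have "(\<Sum>x\<in>I. kgauge \<sigma> x \<rho>) \<le> \<kappa> \<sigma> (\<Union>x\<in>I. ball x \<rho>) epowr \<gamma>"
    using I by (intro kappa_superadditive \<sigma> disjoint_family_on_far_balls) auto
  also have "\<dots> \<le> kgauge \<sigma> y \<tau>"
    using I \<gamma>(1) by (intro epowr_mono kappa_mono UN_least ball_subset_ball_dist) auto
  finally show "(\<Sum>x\<in>I. kgauge \<sigma> x \<rho>) \<le> kgauge \<sigma> y \<tau>" .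
next
  fix x :: "real^'n" and \<rho> c assume c: "c < kgauge \<sigma> x \<rho>"
  then have "c epowr (1 / \<gamma>) < kgauge \<sigma> x \<rho> epowr (1 / \<gamma>)"
    using \<gamma>(1) by (intro epowr_less_cancel[THEN iffD2]) auto
  also have "kgauge \<sigma> x \<rho> epowr (1 / \<gamma>) = \<kappa> \<sigma> (ball x \<rho>)" using \<gamma>(1) by simp
  finally have "c epowr (1 / \<gamma>) < \<kappa> \<sigma> (ball x \<rho>)" .
  then obtain d where d: "c epowr (1 / \<gamma>) < d" "d < \<kappa> \<sigma> (ball x \<rho>)" using dense by blast
  obtain \<nu> where \<nu>: "radon_measure \<nu>" "emeasure \<nu> UNIV < top"
    "d epowr q * emeasure \<nu> UNIV epowr \<theta> < (\<integral>\<^sup>+x\<in>ball x \<rho>. W \<nu> x epowr q \<partial>\<sigma>)"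
    using kappa_witness[OF d(2)] by blast
  note [measurable] = W_measurable[OF radon_sets[OF \<nu>(1)]]
  note [measurable_cong] = \<sigma>
  let ?B = "\<lambda>k. ball x (\<rho> - 1 / real (Suc k))"
  have "(\<integral>\<^sup>+x\<in>ball x \<rho>. W \<nu> x epowr q \<partial>\<sigma>) = emeasure (density \<sigma> (\<lambda>x. W \<nu> x epowr q)) (ball x \<rho>)"
    by (rule emeasure_density[symmetric]) (auto simp: \<sigma>)
  also have "\<dots> = (SUP k. emeasure (density \<sigma> (\<lambda>x. W \<nu> x epowr q)) (?B k))"
    by (subst ball_eq_UN_smaller_balls, rule SUP_emeasure_incseq[symmetric, OF _ incseq_smaller_balls])
       (auto simp: \<sigma>)
  finally obtain k where "d epowr q * emeasure \<nu> UNIV epowr \<theta> < emeasure (density \<sigma> (\<lambda>x. W \<nu> x epowr q)) (?B k)"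
    using \<nu>(3) by (auto simp: less_SUP_iff)
  also have "\<dots> = (\<integral>\<^sup>+x\<in>?B k. W \<nu> x epowr q \<partial>\<sigma>)"
    by (rule emeasure_density) (auto simp: \<sigma>)
  also have "\<dots> \<le> \<kappa> \<sigma> (?B k) epowr q * emeasure \<nu> UNIV epowr \<theta>"
    by (rule kappa_bound[OF \<nu>(1,2)])
  finally have "\<not> \<kappa> \<sigma> (?B k) epowr q \<le> d epowr q" by (metis mult_right_mono not_le zero_le)
  then have "d < \<kappa> \<sigma> (?B k)" using q by simp
  then have "c epowr (1 / \<gamma>) < \<kappa> \<sigma> (?B k)" using d by simp
  then have "(c epowr (1 / \<gamma>)) epowr \<gamma> < kgauge \<sigma> x (\<rho> - 1 / real (Suc k))"
    using \<gamma>(1) by (intro epowr_less_cancel[THEN iffD2]) auto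
  then show "\<exists>\<rho>'<\<rho>. c < kgauge \<sigma> x \<rho>'"
    using \<gamma>(1) by (intro exI[of _ "\<rho> - 1 / real (Suc k)"]) auto
qed

lemma kappa_quot_eq: "kappa_quot \<alpha> p q \<sigma> x \<rho> epowr t = gauge_quot N t (kgauge \<sigma>) x \<rho>"
  by (simp add: kappa_quot_def gauge_quot_def N_def \<gamma>_def)

lemma intrinsic_potential_eq:
  assumes "sets \<sigma> = sets borel"
  shows "intrinsic_potential \<alpha> p q \<sigma> x = gauge_potential N s (kgauge \<sigma>) x"
proof -
  have "(\<lambda>\<rho>. gauge_quot N s (kgauge \<sigma>) x \<rho>) \<in> borel_measurable borel"
    by (rule gauge_quot_measurable[OF ball_gauge_kappa[OF assms]]) auto
  from nn_integral_mult_haar[OF this] show ?thesis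
    by (simp add: intrinsic_potential_def gauge_potential_def kappa_quot_eq s_def)
qed

text \<open>Test with the Dirac mass at the centre, whose potential at distance less than \<open>\<rho>\<close> is at least a
  multiple of \<open>\<rho>\<^bsup>-Ns\<^esup>\<close>.\<close>

lemma emeasure_ball_le_kappa:
  assumes \<sigma>: "sets \<sigma> = sets borel" and \<rho>: "0 < \<rho>"
  shows "mass \<sigma> x \<rho> \<le> ennreal ((c_low * 2 powr (N * s)) powr q * \<rho> powr (N * \<theta>)) * \<kappa> \<sigma> (ball x \<rho>) epowr q"
proof -
  note [measurable_cong] = \<sigma>
  let ?\<delta> = "distr (count_space {()}) borel (\<lambda>_. x)"
  have \<delta>: "sets ?\<delta> = sets borel" by simp
  have \<delta>1: "emeasure ?\<delta> A = 1" if "x \<in> A" "A \<in> sets borel" for A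
    using that by (subst emeasure_distr) (auto simp: vimage_def)
  define C where "C = c_low * 2 powr (N * s)"
  have C: "C > 0" using c_low by (simp add: C_def)
  have low: "1 \<le> ennreal ((C * \<rho> powr (N * s)) powr q) * W ?\<delta> y epowr q" if "y \<in> ball x \<rho>" for y
  proof -
    have "x \<in> ball y (2 * \<rho>)" using that \<rho> by (simp add: dist_commute)
    then have "ennreal ((2 * \<rho>) powr (- (N * s))) \<le> ennreal c_low * W ?\<delta> y"
      using W_lower[OF \<delta>, of "2 * \<rho>" y] \<rho> by (simp add: \<delta>1)
    then have "ennreal ((2 * \<rho>) powr (N * s)) * ennreal ((2 * \<rho>) powr (- (N * s))) \<le> ennreal ((2 * \<rho>) powr (N * s)) * (ennreal c_low * W ?\<delta> y)"
      by (rule mult_left_mono) simp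
    also have "ennreal ((2 * \<rho>) powr (N * s)) * (ennreal c_low * W ?\<delta> y) = ennreal (C * \<rho> powr (N * s)) * W ?\<delta> y"
      using \<rho> c_low by (subst ennreal_mult_left) (auto simp: powr_mult C_def mult_ac)
    also have "ennreal ((2 * \<rho>) powr (N * s)) * ennreal ((2 * \<rho>) powr (- (N * s))) = 1"
      using \<rho> by (simp add: ennreal_mult[symmetric] powr_add[symmetric])
    finally have "1 \<le> ennreal (C * \<rho> powr (N * s)) * W ?\<delta> y" .
    then have "1 epowr q \<le> (ennreal (C * \<rho> powr (N * s)) * W ?\<delta> y) epowr q"
      using q by (intro epowr_mono) auto
    then show ?thesis using q C by (simp add: epowr_ennreal_mult)
  qed
  have [measurable]: "ball x \<rho> \<in> sets borel" by simp
  note [measurable] = W_measurable[OF \<delta>]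
  have "mass \<sigma> x \<rho> = (\<integral>\<^sup>+y. indicator (ball x \<rho>) y \<partial>\<sigma>)" by (simp add: \<sigma>)
  also have "\<dots> \<le> (\<integral>\<^sup>+y. ennreal ((C * \<rho> powr (N * s)) powr q) * (W ?\<delta> y epowr q * indicator (ball x \<rho>) y) \<partial>\<sigma>)"
    using low by (intro nn_integral_mono) (auto simp: indicator_def)
  also have "\<dots> = ennreal ((C * \<rho> powr (N * s)) powr q) * (\<integral>\<^sup>+y\<in>ball x \<rho>. W ?\<delta> y epowr q \<partial>\<sigma>)"
    by (rule nn_integral_cmult) measurable
  also have "\<dots> \<le> ennreal ((C * \<rho> powr (N * s)) powr q) * (\<kappa> \<sigma> (ball x \<rho>) epowr q * emeasure ?\<delta> UNIV epowr \<theta>)"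
    by (intro mult_left_mono kappa_bound radonI_finite \<delta>) (auto simp: \<delta>1)
  also have "(C * \<rho> powr (N * s)) powr q = C powr q * \<rho> powr (N * \<theta>)"
    using C \<theta>(3) by (simp add: powr_mult powr_powr mult.assoc)
  finally show ?thesis by (simp add: \<delta>1 C_def)
qed

end

section \<open>Supersolutions dominate \<open>\<kappa>\<close>\<close>

text \<open>Vitali's lemma selects disjoint balls whose fivefold enlargements cover \<open>S\<close>. Enlarging the ball on
  the side of \<open>\<mu>\<close> is what makes the simple covering lemma suffice for arbitrary, not necessarily
  doubling, measures.\<close>

lemma vitali_comparison:
  fixes \<mu> \<nu> :: "'a::euclidean_space measure"
  assumes sets: "sets \<mu> = sets borel" "sets \<nu> = sets borel"
    and S: "S \<in> sets borel" "bounded S"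
    and ball: "\<And>x. x \<in> S \<Longrightarrow> \<exists>\<rho>>0. c * emeasure \<mu> (ball x (5 * \<rho>)) \<le> emeasure \<nu> (ball x \<rho>)"
  shows "c * emeasure \<mu> S \<le> emeasure \<nu> UNIV"
proof -
  have space: "space \<nu> = UNIV" using sets sets_eq_imp_space_eq[of \<nu> borel] by simp
  obtain \<rho> where \<rho>: "\<And>x. x \<in> S \<Longrightarrow> 0 < \<rho> x"
    "\<And>x. x \<in> S \<Longrightarrow> c * emeasure \<mu> (ball x (5 * \<rho> x)) \<le> emeasure \<nu> (ball x (\<rho> x))"
    using ball by metis
  show ?thesis
  proof (cases "S = {} \<or> (\<exists>x\<in>S. S \<subseteq> ball x (5 * \<rho> x))")
    case True
    then show ?thesis
    proof
      assume "\<exists>x\<in>S. S \<subseteq> ball x (5 * \<rho> x)"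
      then obtain x where x: "x \<in> S" "S \<subseteq> ball x (5 * \<rho> x)" by blast
      then have "c * emeasure \<mu> S \<le> c * emeasure \<mu> (ball x (5 * \<rho> x))"
        using sets by (intro mult_left_mono emeasure_mono) auto
      also have "\<dots> \<le> emeasure \<nu> (ball x (\<rho> x))" by (rule \<rho>(2)[OF x(1)])
      also have "\<dots> \<le> emeasure \<nu> UNIV" using sets by (intro emeasure_mono) auto
      finally show ?thesis .
    qed simp
  next
    case False
    obtain R where R: "\<And>x. x \<in> S \<Longrightarrow> norm x \<le> R" using S(2) by (auto simp: bounded_iff)
    \<comment> \<open>if no single enlarged ball covers, the radii are bounded, as the covering lemma requires\<close>
    have \<rho>R: "\<rho> x \<le> R" if x: "x \<in> S" for x
    proof -
      obtain y where "y \<in> S" "y \<notin> ball x (5 * \<rho> x)" using False x by blast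
      then have "5 * \<rho> x \<le> dist x y" by simp
      also have "\<dots> \<le> norm x + norm y" by (simp add: dist_norm norm_triangle_ineq4)
      also have "\<dots> \<le> 2 * R" using R[OF x] R[OF \<open>y \<in> S\<close>] by simp
      finally show ?thesis using \<rho>(1)[OF x] by simp
    qed
    have cover: "S \<subseteq> (\<Union>x\<in>S. ball x (\<rho> x))" using \<rho>(1) by auto
    obtain C where C: "countable C" "C \<subseteq> S" "pairwise (\<lambda>i j. disjnt (ball i (\<rho> i)) (ball j (\<rho> j))) C"
      "S \<subseteq> (\<Union>i\<in>C. ball i (5 * \<rho> i))"
      by (rule Vitali_covering_lemma_balls[OF cover, of R]) (blast intro: \<rho>(1) \<rho>R that)+
    have "C \<noteq> {}" using C(4) False by auto
    define f where "f = from_nat_into C"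
    have range: "range f = C" using C(1) \<open>C \<noteq> {}\<close> by (simp add: f_def range_from_nat_into)
    define U where "U k = (\<Union>x\<in>f ` {..k::nat}. ball x (5 * \<rho> x))" for k
    have U: "c * emeasure \<mu> (U k) \<le> emeasure \<nu> UNIV" for k
    proof -
      let ?D = "f ` {..k}"
      have D: "finite ?D" "?D \<subseteq> C" using range by auto
      have "c * emeasure \<mu> (U k) \<le> c * (\<Sum>x\<in>?D. emeasure \<mu> (ball x (5 * \<rho> x)))"
        unfolding U_def using D sets by (intro mult_left_mono emeasure_subadditive_finite) auto
      also have "\<dots> = (\<Sum>x\<in>?D. c * emeasure \<mu> (ball x (5 * \<rho> x)))" by (rule sum_distrib_left)
      also have "\<dots> \<le> (\<Sum>x\<in>?D. emeasure \<nu> (ball x (\<rho> x)))"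
        using D C(2) by (intro sum_mono \<rho>(2)) auto
      also have "\<dots> = emeasure \<nu> (\<Union>x\<in>?D. ball x (\<rho> x))"
      proof (rule sum_emeasure)
        show "disjoint_family_on (\<lambda>x. ball x (\<rho> x)) ?D"
          using C(3) D(2) unfolding disjoint_family_on_def pairwise_def disjnt_def by blast
      qed (use D sets in auto)
      also have "\<dots> \<le> emeasure \<nu> UNIV"
        using sets by (intro emeasure_mono) auto
      finally show ?thesis .
    qed
    have "S \<subseteq> (\<Union>k. U k)" using C(4) range by (auto simp: U_def)
    then have "emeasure \<mu> S \<le> emeasure \<mu> (\<Union>k. U k)"
      using sets by (intro emeasure_mono) (auto simp: U_def)
    also have "\<dots> = (SUP k. emeasure \<mu> (U k))"
    proof (rule SUP_emeasure_incseq[symmetric])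
      show "incseq U" unfolding incseq_def U_def by (intro allI impI UN_mono) auto
    qed (auto simp: U_def sets intro!: borel_open open_UN)
    finally have "c * emeasure \<mu> S \<le> (SUP k. c * emeasure \<mu> (U k))"
      by (simp add: SUP_mult_left_ennreal[symmetric] mult_left_mono)
    also have "\<dots> \<le> emeasure \<nu> UNIV" using U by (intro SUP_least) auto
    finally show ?thesis .
  qed
qed

context wolff_exponents
begin

text \<open>The factor \<open>5\<close> in the radius costs only a constant, by the invariance of \<open>d\<rho>/\<rho>\<close> under dilation.\<close>

lemma W_comparison:
  assumes sets: "sets \<mu> = sets borel" "sets \<nu> = sets borel" and l: "0 < l"
    and le: "\<And>\<rho>. 0 < \<rho> \<Longrightarrow> mass \<nu> x \<rho> \<le> ennreal (l / 5 powr N) * mass \<mu> x (5 * \<rho>)"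
  shows "W \<nu> x \<le> ennreal (l powr s) * W \<mu> x"
proof -
  note [measurable (raw)] = gauge_quot_measurable[OF ball_gauge_emeasure[OF sets(1)]]
  have "W \<nu> x \<le> (\<integral>\<^sup>+\<rho>. ennreal (l powr s) * gauge_quot N s (mass \<mu>) x (5 * \<rho>) \<partial>mult_haar)"
    unfolding W_eq[OF sets(2)] gauge_potential_def
  proof (rule nn_integral_mono_AE)
    show "AE \<rho> in mult_haar. gauge_quot N s (mass \<nu>) x \<rho> \<le> ennreal (l powr s) * gauge_quot N s (mass \<mu>) x (5 * \<rho>)"
      using AE_mult_haar_pos
    proof eventually_elim
      case (elim \<rho>)
      have "mass \<nu> x \<rho> epowr s \<le> (ennreal (l / 5 powr N) * mass \<mu> x (5 * \<rho>)) epowr s"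
        using le[OF elim] s by (intro epowr_mono) auto
      also have "\<dots> = ennreal ((l / 5 powr N) powr s) * mass \<mu> x (5 * \<rho>) epowr s"
        using l s by (intro epowr_ennreal_mult) auto
      finally have "gauge_quot N s (mass \<nu>) x \<rho>
          \<le> ennreal (\<rho> powr (- (N * s))) * (ennreal ((l / 5 powr N) powr s) * mass \<mu> x (5 * \<rho>) epowr s)"
        using elim s by (simp add: gauge_quot_eq mult_left_mono)
      also have "\<dots> = ennreal (\<rho> powr (- (N * s)) * (l / 5 powr N) powr s) * mass \<mu> x (5 * \<rho>) epowr s"
        by (rule ennreal_mult_left) auto
      also have "\<rho> powr (- (N * s)) * (l / 5 powr N) powr s = l powr s * (5 * \<rho>) powr (- (N * s))"
        using l elim by (simp add: powr_mult powr_divide powr_powr powr_minus_divide)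
      also have "ennreal \<dots> * mass \<mu> x (5 * \<rho>) epowr s = ennreal (l powr s) * gauge_quot N s (mass \<mu>) x (5 * \<rho>)"
        using elim s by (simp add: gauge_quot_eq ennreal_mult mult.assoc)
      finally show ?case .
    qed
  qed
  also have "\<dots> = ennreal (l powr s) * (\<integral>\<^sup>+\<rho>. gauge_quot N s (mass \<mu>) x (5 * \<rho>) \<partial>mult_haar)"
    by (rule nn_integral_cmult) measurable
  also have "(\<integral>\<^sup>+\<rho>. gauge_quot N s (mass \<mu>) x (5 * \<rho>) \<partial>mult_haar) = W \<mu> x"
    unfolding W_eq[OF sets(1)] gauge_potential_def by (rule nn_integral_mult_haar_scale) auto
  finally show ?thesis .
qed

text \<open>At a point where the ratio is large, \<open>W_comparison\<close> provides a radius at which \<open>\<nu>\<close> beats \<open>\<mu>\<close> of the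
  enlarged ball, as required by \<open>vitali_comparison\<close>.\<close>

lemma W_ratio_weak_type:
  assumes sets: "sets \<mu> = sets borel" "sets \<nu> = sets borel" and l: "0 < l"
    and B: "B \<in> sets borel" "bounded B"
  shows "ennreal l * emeasure \<mu> {x\<in>B. ennreal l < (W \<nu> x / W \<mu> x) epowr (p - 1)} \<le> ennreal (5 powr N) * emeasure \<nu> UNIV"
proof -
  note [measurable] = W_measurable[OF sets(1)] W_measurable[OF sets(2)] B(1)
  let ?S = "{x\<in>B. ennreal l < (W \<nu> x / W \<mu> x) epowr (p - 1)}"
  have "ennreal (l / 5 powr N) * emeasure \<mu> ?S \<le> emeasure \<nu> UNIV"
  proof (rule vitali_comparison[OF sets])
    show "?S \<in> sets borel" by measurable
    show "bounded ?S" using B(2) by (rule bounded_subset) auto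
    fix x assume x: "x \<in> ?S"
    show "\<exists>\<rho>>0. ennreal (l / 5 powr N) * mass \<mu> x (5 * \<rho>) \<le> mass \<nu> x \<rho>"
    proof (rule ccontr)
      assume "\<not> ?thesis"
      then have "W \<nu> x \<le> ennreal (l powr s) * W \<mu> x"
        using l by (intro W_comparison sets) (auto simp: not_le less_imp_le)
      then have "W \<nu> x / W \<mu> x \<le> ennreal (l powr s)" by (rule ennreal_divide_le)
      then have "(W \<nu> x / W \<mu> x) epowr (p - 1) \<le> ennreal (l powr s) epowr (p - 1)"
        using p by (intro epowr_mono) auto
      also have "\<dots> = ennreal l" using l p by (simp add: powr_powr s_def)
      finally show False using x by auto
    qed
  qed
  then have "ennreal (5 powr N) * (ennreal (l / 5 powr N) * emeasure \<mu> ?S) \<le> ennreal (5 powr N) * emeasure \<nu> UNIV"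
    by (rule mult_left_mono) simp
  then show ?thesis using l by (simp add: ennreal_mult_left)
qed

text \<open>With \<open>\<mu> = v\<^sup>q \<sigma>\<close> restricted to the ball and \<open>\<nu>\<close> a test measure, the integral of \<open>(W\<nu>)\<^sup>q\<close> over the ball
  is at most the integral of \<open>(W\<nu>/W\<mu>)\<^sup>q\<close> against \<open>\<mu>\<close>, because \<open>v \<ge> W\<mu>\<close>. The weak-type bound and
  Kolmogorov's inequality with exponent \<open>\<theta> = q/(p-1)\<close> estimate the latter by a multiple of
  \<open>\<mu>(B)\<^bsup>1-\<theta>\<^esup> \<nu>(\<real>\<^sup>n)\<^sup>\<theta>\<close>.\<close>

lemma kappa_le_supersolution:
  "\<exists>C>0. \<forall>\<sigma> v x \<rho>. radon_measure (\<sigma> :: (real^'n) measure) \<longrightarrow> v \<in> borel_measurable borel \<longrightarrow>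
     radon_measure (power_density \<sigma> v) \<longrightarrow> emeasure (power_density \<sigma> v) UNIV \<noteq> 0 \<longrightarrow>
     (AE x in \<sigma>. W (power_density \<sigma> v) x \<le> v x) \<longrightarrow>
     kgauge \<sigma> x \<rho> \<le> ennreal C * mass (power_density \<sigma> v) x \<rho>"
proof -
  obtain C where C: "C > 0" and K: "\<forall>M :: (real^'n) measure. \<forall>g\<in>borel_measurable M. \<forall>A. emeasure M (space M) < top \<longrightarrow>
     (\<forall>l>0. ennreal l * emeasure M {x\<in>space M. ennreal l < g x} \<le> A) \<longrightarrow>
     (\<integral>\<^sup>+x. g x epowr \<theta> \<partial>M) \<le> ennreal C * (emeasure M (space M) epowr (1 - \<theta>) * A epowr \<theta>)"
    using weak_type_imp_power_bound[OF \<theta>(1,2), where 'a="real^'n"] by (elim exE conjE) (rule that)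
  define C1 where "C1 = C * 5 powr (N * \<theta>)"
  have C1: "C1 > 0" using C by (simp add: C1_def)
  show ?thesis
  proof (intro exI[of _ "C1 powr (\<gamma> / q)"] conjI allI impI)
    show "C1 powr (\<gamma> / q) > 0" using C1 by simp
    fix \<sigma> :: "(real^'n) measure" and v :: "real^'n \<Rightarrow> ennreal" and x0 :: "real^'n" and \<rho> :: real
    assume \<sigma>: "radon_measure \<sigma>" and v [measurable]: "v \<in> borel_measurable borel"
    define \<mu> where "\<mu> = power_density \<sigma> v"
    assume "radon_measure (power_density \<sigma> v)" "emeasure (power_density \<sigma> v) UNIV \<noteq> 0"
      "AE x in \<sigma>. W (power_density \<sigma> v) x \<le> v x"
    then have \<mu>: "radon_measure \<mu>" "emeasure \<mu> UNIV \<noteq> 0" "AE x in \<sigma>. W \<mu> x \<le> v x" by (auto simp: \<mu>_def)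
    note [measurable_cong] = radon_sets[OF \<sigma>]
    note \<mu>sets = radon_sets[OF \<mu>(1)]
    have space: "space \<sigma> = UNIV" using \<sigma> by (rule radon_space)
    define B where "B = ball x0 \<rho>"
    have B [measurable]: "B \<in> sets borel" and bB: "bounded B" by (auto simp: B_def)
    have vq [measurable]: "(\<lambda>x. v x epowr q) \<in> borel_measurable \<sigma>" by measurable
    have muB: "emeasure \<mu> B = (\<integral>\<^sup>+x. v x epowr q * indicator B x \<partial>\<sigma>)"
      unfolding \<mu>_def by (rule emeasure_density) (auto simp: radon_sets[OF \<sigma>])
    have fin: "emeasure \<mu> B < top" using radon_ball[OF \<mu>(1)] by (simp add: B_def)
    have "\<kappa> \<sigma> B epowr \<gamma> \<le> ennreal (C1 powr (\<gamma> / q)) * emeasure \<mu> B"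
    proof (cases "emeasure \<mu> B = 0")
      case True
      then have "AE x in \<sigma>. v x epowr q * indicator B x = 0"
        unfolding muB by (subst (asm) nn_integral_0_iff_AE) auto
      with \<mu>(3) have "AE x in \<sigma>. indicator B x = (0::ennreal)"
      proof eventually_elim
        case (elim x)
        have "v x \<noteq> 0" using W_pos[OF \<mu>sets \<mu>(2), of x] elim(1) by auto
        then show ?case using elim by auto
      qed
      then have "(\<integral>\<^sup>+x\<in>B. W \<nu> x epowr q \<partial>\<sigma>) = (\<integral>\<^sup>+x. 0 \<partial>\<sigma>)" for \<nu>
        by (intro nn_integral_cong_AE) auto
      then have "\<kappa> \<sigma> B \<le> 0" unfolding kappa_def using q by (intro Inf_lower) simp
      then show ?thesis by simp
    next
      case False
      obtain m where m: "emeasure \<mu> B = ennreal m" "0 < m"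
        using False fin by (metis ennreal_cases ennreal_eq_0_iff less_irrefl not_le order_le_less)
      \<comment> \<open>restricting to the ball makes its mass, not the total mass of \<open>\<mu>\<close>, appear in the bound\<close>
      define \<beta> where "\<beta> = density \<sigma> (\<lambda>x. v x epowr q * indicator B x)"
      have \<beta>sets: "sets \<beta> = sets borel" by (simp add: \<beta>_def radon_sets[OF \<sigma>])
      have \<beta>space: "space \<beta> = UNIV" by (simp add: \<beta>_def space)
      have \<beta>em: "emeasure \<beta> A = emeasure \<mu> (A \<inter> B)" if [measurable]: "A \<in> sets borel" for A
        unfolding \<beta>_def \<mu>_def
        by (subst (1 2) emeasure_density)
           (auto simp: radon_sets[OF \<sigma>] indicator_def intro!: nn_integral_cong)
      have \<beta>m: "emeasure \<beta> UNIV = ennreal m" using \<beta>em[of UNIV] m by simp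
      have W\<beta>\<mu>: "W \<beta> x \<le> W \<mu> x" for x
      proof (rule W_mono)
        fix r
        have "mass \<beta> x r = emeasure \<mu> (ball x r \<inter> B)" by (rule \<beta>em) simp
        also have "\<dots> \<le> mass \<mu> x r" by (rule emeasure_mono) (simp_all add: \<mu>sets)
        finally show "mass \<beta> x r \<le> mass \<mu> x r" .
      qed
      have W\<beta>: "0 < W \<beta> x" for x using m \<beta>m by (intro W_pos \<beta>sets) auto
      note [measurable] = W_measurable[OF \<beta>sets]
      have "AE x in \<sigma>. v x epowr q * indicator B x \<noteq> \<infinity>"
        by (rule nn_integral_PInf_AE) (use muB fin in auto)
      then have vfin: "AE x in \<sigma>. x \<in> B \<longrightarrow> v x < top"
        by eventually_elim (auto simp: top.not_eq_extremum)
      have test: "(\<integral>\<^sup>+x\<in>B. W \<nu> x epowr q \<partial>\<sigma>) epowr (1 / q) \<le> ennreal ((C1 * m powr (1 - \<theta>)) powr (1 / q)) * emeasure \<nu> UNIV epowr (1 / (p - 1))"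
        if \<nu>: "radon_measure \<nu>" "emeasure \<nu> UNIV < \<infinity>" for \<nu>
      proof -
        note \<nu>sets = radon_sets[OF \<nu>(1)]
        note [measurable] = W_measurable[OF \<nu>sets]
        define g where "g x = (W \<nu> x / W \<beta> x) epowr (p - 1)" for x
        have [measurable]: "g \<in> borel_measurable borel" unfolding g_def[abs_def] by measurable
        have "(\<integral>\<^sup>+x\<in>B. W \<nu> x epowr q \<partial>\<sigma>) \<le> (\<integral>\<^sup>+x. v x epowr q * indicator B x * g x epowr \<theta> \<partial>\<sigma>)"
        proof (rule nn_integral_mono_AE)
          show "AE x in \<sigma>. W \<nu> x epowr q * indicator B x \<le> v x epowr q * indicator B x * g x epowr \<theta>"
            using \<mu>(3) vfin
          proof eventually_elim
            case (elim x)
            show ?case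
            proof (cases "x \<in> B")
              case True
              have W: "W \<beta> x \<le> v x" using W\<beta>\<mu>[of x] elim(1) by simp
              from elim(2) True have "v x < top" by blast
              with W have "W \<beta> x < top" by (rule order_le_less_trans)
              then have "W \<nu> x = W \<nu> x / W \<beta> x * W \<beta> x"
                by (rule ennreal_divide_mult_cancel[OF W\<beta>, symmetric])
              also have "\<dots> \<le> W \<nu> x / W \<beta> x * v x" using W by (rule mult_left_mono) simp
              finally have "W \<nu> x epowr q \<le> (W \<nu> x / W \<beta> x * v x) epowr q"
                using q by (intro epowr_mono) auto
              also have "\<dots> = v x epowr q * g x epowr \<theta>"
                using q p by (simp add: epowr_mult g_def \<theta>_def mult.commute)
              finally show ?thesis using True by simp
            qed simp
          qed
        qed
        also have "\<dots> = (\<integral>\<^sup>+x. g x epowr \<theta> \<partial>\<beta>)"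
          unfolding \<beta>_def by (rule nn_integral_density[symmetric]) measurable
        also have "\<dots> \<le> ennreal C * (emeasure \<beta> (space \<beta>) epowr (1 - \<theta>) * (ennreal (5 powr N) * emeasure \<nu> UNIV) epowr \<theta>)"
        proof (rule K[rule_format])
          show "g \<in> borel_measurable \<beta>" using \<beta>sets by (simp cong: measurable_cong_sets)
          show "emeasure \<beta> (space \<beta>) < top" by (simp add: \<beta>space \<beta>m)
          fix l :: real assume l: "0 < l"
          have "emeasure \<beta> {x\<in>space \<beta>. ennreal l < g x} = emeasure \<beta> {x\<in>B. ennreal l < g x}"
            unfolding \<beta>space by (subst (1 2) \<beta>em) (auto intro!: arg_cong[of _ _ "emeasure \<mu>"])
          then show "ennreal l * emeasure \<beta> {x\<in>space \<beta>. ennreal l < g x} \<le> ennreal (5 powr N) * emeasure \<nu> UNIV"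
            using W_ratio_weak_type[OF \<beta>sets \<nu>sets l B bB] by (simp add: g_def)
        qed
        also have "\<dots> = ennreal (C1 * m powr (1 - \<theta>)) * emeasure \<nu> UNIV epowr \<theta>"
        proof -
          have "ennreal C * (ennreal m epowr (1 - \<theta>) * (ennreal (5 powr N) * emeasure \<nu> UNIV) epowr \<theta>)
            = ennreal C * (ennreal (m powr (1 - \<theta>)) * (ennreal (5 powr (N * \<theta>)) * emeasure \<nu> UNIV epowr \<theta>))"
            using m \<theta>(1) by (simp add: epowr_ennreal_mult powr_powr)
          also have "\<dots> = ennreal (C * (m powr (1 - \<theta>) * 5 powr (N * \<theta>))) * emeasure \<nu> UNIV epowr \<theta>"
            using C by (simp add: ennreal_mult_left)
          also have "C * (m powr (1 - \<theta>) * 5 powr (N * \<theta>)) = C1 * m powr (1 - \<theta>)" by (simp add: C1_def)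
          finally show ?thesis by (simp only: \<beta>space \<beta>m)
        qed
        finally have "(\<integral>\<^sup>+x\<in>B. W \<nu> x epowr q \<partial>\<sigma>) epowr (1 / q) \<le> (ennreal (C1 * m powr (1 - \<theta>)) * emeasure \<nu> UNIV epowr \<theta>) epowr (1 / q)"
          using q by (intro epowr_mono) auto
        also have "\<dots> = ennreal ((C1 * m powr (1 - \<theta>)) powr (1 / q)) * emeasure \<nu> UNIV epowr (1 / (p - 1))"
          using C1 q by (simp add: epowr_ennreal_mult \<theta>_def)
        finally show ?thesis .
      qed
      then have "\<kappa> \<sigma> B \<le> ennreal ((C1 * m powr (1 - \<theta>)) powr (1 / q))"
        unfolding kappa_def by (intro Inf_lower) simp
      then have "\<kappa> \<sigma> B epowr \<gamma> \<le> ennreal ((C1 * m powr (1 - \<theta>)) powr (1 / q)) epowr \<gamma>"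
        using \<gamma>(1) by (intro epowr_mono) auto
      also have "\<dots> = ennreal (C1 powr (\<gamma> / q) * m)"
      proof -
        have "(1 - \<theta>) * (\<gamma> / q) = 1" using \<gamma>(2) q by (simp add: field_simps)
        then have "(C1 * m powr (1 - \<theta>)) powr (\<gamma> / q) = C1 powr (\<gamma> / q) * m"
          using C1 m by (simp add: powr_mult powr_powr)
        then show ?thesis using C1 m by (simp add: powr_powr)
      qed
      finally show ?thesis using m by (simp add: ennreal_mult)
    qed
    then show "kgauge \<sigma> x0 \<rho> \<le> ennreal (C1 powr (\<gamma> / q)) * mass (power_density \<sigma> v) x0 \<rho>"
      by (simp add: B_def \<mu>_def)
  qed
qed

section \<open>Sets of capacity zero are Lebesgue null\<close>

lemma \<alpha>_less: "\<alpha> * p < real CARD('n)" "\<alpha> < real CARD('n)"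
proof -
  show 1: "\<alpha> * p < real CARD('n)" using N by (simp add: N_def)
  have "\<alpha> * 1 < \<alpha> * p" using \<alpha> p by (intro mult_strict_left_mono) auto
  with 1 show "\<alpha> < real CARD('n)" by simp
qed

text \<open>A form of Hoelder's inequality, obtained by splitting \<open>f\<close> at a height \<open>l\<close> for which both parts
  are bounded by the same power of \<open>e\<close> and \<open>t\<close>.\<close>

lemma ball_integral_le:
  fixes f :: "real^'n \<Rightarrow> ennreal"
  assumes [measurable]: "f \<in> borel_measurable borel"
    and f: "(\<integral>\<^sup>+x. f x epowr p \<partial>lborel) \<le> ennreal e" and pos: "0 < e" "0 < t"
  shows "(\<integral>\<^sup>+y\<in>cball x t. f y \<partial>lborel)
    \<le> ennreal ((unit_ball_vol CARD('n) + 1) * e powr (1 / p) * t powr (real CARD('n) - real CARD('n) / p))"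
proof -
  let ?n = "real CARD('n)" and ?w = "unit_ball_vol CARD('n)"
  define l where "l = (e * t powr (- ?n)) powr (1 / p)"
  have l: "l > 0" using pos by (simp add: l_def)
  have le: "f y \<le> ennreal l + ennreal (l powr (1 - p)) * f y epowr p" for y
  proof (cases "f y")
    case (real b)
    show ?thesis
    proof (cases "b \<le> l")
      case True
      then have "f y \<le> ennreal l" using real by (simp add: ennreal_leI)
      then show ?thesis by (rule order_trans) simp
    next
      case False
      then have "b powr (1 - p) \<le> l powr (1 - p)" using l p by (intro powr_mono2') auto
      then have "b powr (1 - p) * b powr p \<le> l powr (1 - p) * b powr p" by (rule mult_right_mono) simp
      moreover have "b powr (1 - p) * b powr p = b" using False l by (simp add: powr_add[symmetric])
      ultimately have "f y \<le> ennreal (l powr (1 - p) * b powr p)" using real by (simp add: ennreal_leI)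
      also have "\<dots> = ennreal (l powr (1 - p)) * f y epowr p" using real by (simp add: ennreal_mult)
      finally show ?thesis by (rule order_trans) simp
    qed
  next
    case top
    then show ?thesis using l by (simp add: ennreal_mult_top)
  qed
  have [measurable]: "cball x t \<in> sets borel" by simp
  have "(\<integral>\<^sup>+y\<in>cball x t. f y \<partial>lborel) \<le> (\<integral>\<^sup>+y. ennreal l * indicator (cball x t) y + ennreal (l powr (1 - p)) * f y epowr p \<partial>lborel)"
    using le by (intro nn_integral_mono) (auto simp: indicator_def)
  also have "\<dots> = ennreal l * ennreal (?w * t ^ CARD('n)) + ennreal (l powr (1 - p)) * (\<integral>\<^sup>+x. f x epowr p \<partial>lborel)"
    using pos by (subst nn_integral_add) (auto simp: nn_integral_cmult nn_integral_cmult_indicator emeasure_cball)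
  also have "\<dots> \<le> ennreal l * ennreal (?w * t ^ CARD('n)) + ennreal (l powr (1 - p)) * ennreal e"
    by (intro add_left_mono mult_left_mono f) simp
  also have "\<dots> = ennreal (?w * (l * t powr ?n) + l powr (1 - p) * e)"
    using l pos by (simp add: ennreal_mult[symmetric] ennreal_plus[symmetric] powr_realpow mult_ac del: ennreal_plus)
  also have "l * t powr ?n = e powr (1 / p) * t powr (?n - ?n / p)"
  proof -
    have "l = e powr (1 / p) * t powr (- ?n * (1 / p))" using pos by (simp add: l_def powr_mult powr_powr)
    then show ?thesis by (simp add: powr_add[symmetric] mult.assoc)
  qed
  also have "l powr (1 - p) * e = e powr (1 / p) * t powr (?n - ?n / p)"
  proof -
    have "l powr (1 - p) = e powr ((1 - p) / p) * t powr (- ?n * ((1 - p) / p))"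
      using pos by (simp add: l_def powr_mult powr_powr)
    also have "- ?n * ((1 - p) / p) = ?n - ?n / p" using p by (simp add: field_simps)
    also have "(1 - p) / p = 1 / p - 1" using p by (simp add: field_simps)
    finally show ?thesis using pos by (simp add: powr_diff)
  qed
  finally show ?thesis by (simp add: distrib_right mult.assoc add.commute)
qed

text \<open>The kernel \<open>\<bar>z\<bar>\<^bsup>\<alpha>-n\<^esup>\<close> is a superposition of normalized indicators of balls.\<close>

lemma riesz_potential_le:
  fixes f :: "real^'n \<Rightarrow> ennreal"
  assumes [measurable]: "f \<in> borel_measurable borel"
  shows "riesz_potential \<alpha> f x \<le> ennreal (real CARD('n) - \<alpha>) *
    (\<integral>\<^sup>+t. ennreal (t powr (\<alpha> - real CARD('n))) * (\<integral>\<^sup>+y\<in>cball x t. f y \<partial>lborel) \<partial>mult_haar)"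
proof -
  let ?n = "real CARD('n)"
  interpret h: sigma_finite_measure mult_haar by simp
  interpret xh: pair_sigma_finite mult_haar "lborel :: (real^'n) measure" ..
  have b: "?n - \<alpha> > 0" using \<alpha>_less by simp
  have kern: "ennreal (norm (x - y) powr (\<alpha> - ?n)) \<le> ennreal (?n - \<alpha>) * (\<integral>\<^sup>+t. ennreal (t powr (\<alpha> - ?n)) * (if dist x y \<le> t then 1 else 0) \<partial>mult_haar)" for y
  proof (cases "x = y")
    case False
    then have "(\<integral>\<^sup>+t\<in>{dist x y..}. ennreal (t powr (-(?n - \<alpha>))) \<partial>mult_haar) = ennreal (dist x y powr (-(?n - \<alpha>)) / (?n - \<alpha>))"
      using b by (intro nn_integral_powr_above) auto
    also have "(\<integral>\<^sup>+t\<in>{dist x y..}. ennreal (t powr (-(?n - \<alpha>))) \<partial>mult_haar)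
       = (\<integral>\<^sup>+t. ennreal (t powr (\<alpha> - ?n)) * (if dist x y \<le> t then 1 else 0) \<partial>mult_haar)"
      by (intro nn_integral_cong) (auto simp: indicator_def)
    finally show ?thesis using b by (simp add: ennreal_mult[symmetric] dist_norm)
  qed simp
  have "riesz_potential \<alpha> f x = (\<integral>\<^sup>+y. ennreal (norm (x - y) powr (\<alpha> - ?n)) * f y \<partial>lborel)"
    by (simp add: riesz_potential_def nn_integral_completion)
  also have "\<dots> \<le> (\<integral>\<^sup>+y. (ennreal (?n - \<alpha>) * (\<integral>\<^sup>+t. ennreal (t powr (\<alpha> - ?n)) * (if dist x y \<le> t then 1 else 0) \<partial>mult_haar)) * f y \<partial>lborel)"
    by (intro nn_integral_mono mult_right_mono kern) simp
  also have "\<dots> = (\<integral>\<^sup>+y. ennreal (?n - \<alpha>) * (\<integral>\<^sup>+t. ennreal (t powr (\<alpha> - ?n)) * (if dist x y \<le> t then 1 else 0) * f y \<partial>mult_haar) \<partial>lborel)"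
  proof (rule nn_integral_cong)
    fix y
    have "(\<integral>\<^sup>+t. ennreal (t powr (\<alpha> - ?n)) * (if dist x y \<le> t then 1 else 0) * f y \<partial>mult_haar)
      = (\<integral>\<^sup>+t. ennreal (t powr (\<alpha> - ?n)) * (if dist x y \<le> t then 1 else 0) \<partial>mult_haar) * f y"
      by (rule nn_integral_multc) measurable
    then show "(ennreal (?n - \<alpha>) * (\<integral>\<^sup>+t. ennreal (t powr (\<alpha> - ?n)) * (if dist x y \<le> t then 1 else 0) \<partial>mult_haar)) * f y
      = ennreal (?n - \<alpha>) * (\<integral>\<^sup>+t. ennreal (t powr (\<alpha> - ?n)) * (if dist x y \<le> t then 1 else 0) * f y \<partial>mult_haar)"
      by (simp only: mult.assoc)
  qed
  also have "\<dots> = ennreal (?n - \<alpha>) * (\<integral>\<^sup>+y. (\<integral>\<^sup>+t. ennreal (t powr (\<alpha> - ?n)) * (if dist x y \<le> t then 1 else 0) * f y \<partial>mult_haar) \<partial>lborel)"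
    by (rule nn_integral_cmult) measurable
  also have "(\<integral>\<^sup>+y. (\<integral>\<^sup>+t. ennreal (t powr (\<alpha> - ?n)) * (if dist x y \<le> t then 1 else 0) * f y \<partial>mult_haar) \<partial>lborel)
     = (\<integral>\<^sup>+t. (\<integral>\<^sup>+y. ennreal (t powr (\<alpha> - ?n)) * (if dist x y \<le> t then 1 else 0) * f y \<partial>lborel) \<partial>mult_haar)"
    by (rule xh.Fubini') measurable
  also have "\<dots> = (\<integral>\<^sup>+t. ennreal (t powr (\<alpha> - ?n)) * (\<integral>\<^sup>+y\<in>cball x t. f y \<partial>lborel) \<partial>mult_haar)"
  proof (rule nn_integral_cong)
    fix t
    have [measurable]: "cball x t \<in> sets borel" by simp
    have "(\<integral>\<^sup>+y. ennreal (t powr (\<alpha> - ?n)) * (if dist x y \<le> t then 1 else 0) * f y \<partial>lborel)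
      = (\<integral>\<^sup>+y. ennreal (t powr (\<alpha> - ?n)) * (f y * indicator (cball x t) y) \<partial>lborel)"
      by (intro nn_integral_cong) (auto simp: indicator_def)
    also have "\<dots> = ennreal (t powr (\<alpha> - ?n)) * (\<integral>\<^sup>+y\<in>cball x t. f y \<partial>lborel)"
      by (rule nn_integral_cmult) measurable
    finally show "(\<integral>\<^sup>+y. ennreal (t powr (\<alpha> - ?n)) * (if dist x y \<le> t then 1 else 0) * f y \<partial>lborel)
      = ennreal (t powr (\<alpha> - ?n)) * (\<integral>\<^sup>+y\<in>cball x t. f y \<partial>lborel)" .
  qed
  finally show ?thesis .
qed

text \<open>Large scales contribute to the Riesz potential at most a multiple of \<open>e\<^bsup>1/p\<^esup>\<close> at every point, as
  \<open>\<alpha> p < n\<close>; for small \<open>e\<close> this is below \<open>1/2\<close>. The contribution of the scales below \<open>1\<close> is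
  integrable over the ball, and Chebyshev's inequality applies to it.\<close>

lemma riesz_superlevel_le:
  assumes R: "0 < R"
  shows "\<exists>C>0. \<exists>e0>0. \<forall>f e. f \<in> borel_measurable borel \<longrightarrow> 0 < e \<longrightarrow> e \<le> e0 \<longrightarrow>
    (\<integral>\<^sup>+x. f x epowr p \<partial>lborel) \<le> ennreal e \<longrightarrow>
    (\<exists>D\<in>sets borel. {x\<in>ball (0::real^'n) R. 1 \<le> riesz_potential \<alpha> f x} \<subseteq> D \<and> emeasure lborel D \<le> ennreal (C * e powr (1 / p)))"
proof -
  let ?n = "real CARD('n)" and ?w = "unit_ball_vol CARD('n)"
  define n where "n = real CARD('n)"
  define w where "w = unit_ball_vol n"
  have w: "0 < w" by (simp add: w_def n_def)
  have b: "n - \<alpha> > 0" "n / p - \<alpha> > 0" using \<alpha>_less p by (auto simp: n_def field_simps)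
  define F0 where "F0 = (n - \<alpha>) * (w + 1) / (n / p - \<alpha>)"
  have F0: "F0 > 0" using b w by (simp add: F0_def)
  \<comment> \<open>chosen so that the scales above \<open>1\<close> contribute at most \<open>1/2\<close>\<close>
  define e0 where "e0 = (1 / (2 * F0)) powr p"
  have e0: "e0 > 0" using F0 by (simp add: e0_def)
  define C where "C = 2 * ((n - \<alpha>) * w / \<alpha> * ((w + 1) * (R + 1) powr (n - n / p)))"
  have C: "C > 0" using b w \<alpha> R unfolding C_def by (intro mult_pos_pos divide_pos_pos) auto
  show ?thesis
  proof (rule exI[of _ C], rule conjI[OF C], rule exI[of _ e0], rule conjI[OF e0], intro allI impI)
    fix f :: "real^'n \<Rightarrow> ennreal" and e
    assume f [measurable]: "f \<in> borel_measurable borel" and e: "0 < e" "e \<le> e0"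
      and fe: "(\<integral>\<^sup>+x. f x epowr p \<partial>lborel) \<le> ennreal e"
    interpret h: sigma_finite_measure mult_haar by simp
    interpret xh: pair_sigma_finite mult_haar "lborel :: (real^'n) measure" ..
    define \<phi> where "\<phi> x t = (\<integral>\<^sup>+y. (if dist x y \<le> t then 1 else 0) * f y \<partial>lborel)" for x t
    have \<phi>_eq: "\<phi> x t = (\<integral>\<^sup>+y\<in>cball x t. f y \<partial>lborel)" for x t
      unfolding \<phi>_def by (intro nn_integral_cong) (auto simp: indicator_def)
    have \<phi>_meas: "(\<lambda>(x, t). \<phi> x t) \<in> borel_measurable (borel \<Otimes>\<^sub>M borel)"
      unfolding \<phi>_def by measurable
    have [measurable (raw)]: "(\<lambda>z. \<phi> (g z) (g' z)) \<in> borel_measurable K"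
      if [measurable]: "g \<in> borel_measurable K" "g' \<in> borel_measurable K" for g g' and K :: "'z measure"
      using measurable_compose[OF measurable_Pair[OF that] \<phi>_meas] by simp
    define A where "A = (w + 1) * e powr (1 / p)"
    have A: "A > 0" using w e by (simp add: A_def)
    have \<phi>_le: "\<phi> x t \<le> ennreal (A * t powr (n - n / p))" if "0 < t" for x t
      unfolding \<phi>_eq using ball_integral_le[OF f fe e(1) that, of x] by (simp add: A_def w_def n_def)
    define near where "near x = ennreal (n - \<alpha>) * (\<integral>\<^sup>+t. ennreal (t powr (\<alpha> - n)) * \<phi> x t * indicator {..1} t \<partial>mult_haar)" for x
    have [measurable]: "near \<in> borel_measurable borel" unfolding near_def[abs_def] by measurable
    have far: "ennreal (n - \<alpha>) * (\<integral>\<^sup>+t. ennreal (t powr (\<alpha> - n)) * \<phi> x t * indicator {1..} t \<partial>mult_haar) \<le> ennreal (1/2)" for x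
    proof -
      have "(\<integral>\<^sup>+t. ennreal (t powr (\<alpha> - n)) * \<phi> x t * indicator {1..} t \<partial>mult_haar)
        \<le> (\<integral>\<^sup>+t. ennreal A * (ennreal (t powr (-(n / p - \<alpha>))) * indicator {1..} t) \<partial>mult_haar)"
      proof (rule nn_integral_mono)
        fix t
        show "ennreal (t powr (\<alpha> - n)) * \<phi> x t * indicator {1..} t \<le> ennreal A * (ennreal (t powr (-(n / p - \<alpha>))) * indicator {1..} t)"
        proof (cases "1 \<le> t")
          case True
          then have "ennreal (t powr (\<alpha> - n)) * \<phi> x t \<le> ennreal (t powr (\<alpha> - n)) * ennreal (A * t powr (n - n / p))"
            by (intro mult_left_mono \<phi>_le) auto
          also have "\<dots> = ennreal (A * (t powr (\<alpha> - n) * t powr (n - n / p)))"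
            using A by (simp add: ennreal_mult[symmetric] mult_ac)
          also have "t powr (\<alpha> - n) * t powr (n - n / p) = t powr (-(n / p - \<alpha>))"
            by (simp add: powr_add[symmetric])
          finally show ?thesis using True A by (simp add: ennreal_mult)
        qed simp
      qed
      also have "\<dots> = ennreal A * (\<integral>\<^sup>+t\<in>{1..}. ennreal (t powr (-(n / p - \<alpha>))) \<partial>mult_haar)"
        by (rule nn_integral_cmult) measurable
      also have "(\<integral>\<^sup>+t\<in>{1..}. ennreal (t powr (-(n / p - \<alpha>))) \<partial>mult_haar) = ennreal (1 / (n / p - \<alpha>))"
        using nn_integral_powr_above[of 1 "n / p - \<alpha>"] b by simp
      finally have "ennreal (n - \<alpha>) * (\<integral>\<^sup>+t. ennreal (t powr (\<alpha> - n)) * \<phi> x t * indicator {1..} t \<partial>mult_haar)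
         \<le> ennreal (n - \<alpha>) * (ennreal A * ennreal (1 / (n / p - \<alpha>)))"
        by (rule mult_left_mono) simp
      also have "\<dots> = ennreal ((n - \<alpha>) * (A * (1 / (n / p - \<alpha>))))"
      proof -
        have "0 \<le> n - \<alpha>" "0 \<le> A" "0 \<le> 1 / (n / p - \<alpha>)" using b A by auto
        then show ?thesis by (simp only: ennreal_mult[symmetric] mult_nonneg_nonneg)
      qed
      also have "(n - \<alpha>) * (A * (1 / (n / p - \<alpha>))) = F0 * e powr (1 / p)"
        by (simp add: A_def F0_def)
      also have "ennreal (F0 * e powr (1 / p)) \<le> ennreal (1/2)"
      proof (rule ennreal_leI)
        have "e powr (1 / p) \<le> e0 powr (1 / p)" using e p by (intro powr_mono2) auto
        also have "e0 powr (1 / p) = 1 / (2 * F0)" using F0 p by (simp add: e0_def powr_powr)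
        finally show "F0 * e powr (1 / p) \<le> 1/2" using F0 by (simp add: field_simps)
      qed
      finally show ?thesis .
    qed
    let ?D = "{x\<in>ball (0::real^'n) R. ennreal (1/2) \<le> near x}"
    have sub: "{x\<in>ball (0::real^'n) R. 1 \<le> riesz_potential \<alpha> f x} \<subseteq> ?D"
    proof safe
      fix x assume x: "1 \<le> riesz_potential \<alpha> f x"
      have "(\<integral>\<^sup>+t. ennreal (t powr (\<alpha> - n)) * \<phi> x t \<partial>mult_haar)
        \<le> (\<integral>\<^sup>+t. ennreal (t powr (\<alpha> - n)) * \<phi> x t * indicator {..1} t + ennreal (t powr (\<alpha> - n)) * \<phi> x t * indicator {1..} t \<partial>mult_haar)"
        by (intro nn_integral_mono) (auto simp: indicator_def)
      also have "\<dots> = (\<integral>\<^sup>+t. ennreal (t powr (\<alpha> - n)) * \<phi> x t * indicator {..1} t \<partial>mult_haar) + (\<integral>\<^sup>+t. ennreal (t powr (\<alpha> - n)) * \<phi> x t * indicator {1..} t \<partial>mult_haar)"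
        by (rule nn_integral_add) measurable
      finally have *: "ennreal (n - \<alpha>) * (\<integral>\<^sup>+t. ennreal (t powr (\<alpha> - n)) * \<phi> x t \<partial>mult_haar)
        \<le> ennreal (n - \<alpha>) * ((\<integral>\<^sup>+t. ennreal (t powr (\<alpha> - n)) * \<phi> x t * indicator {..1} t \<partial>mult_haar) + (\<integral>\<^sup>+t. ennreal (t powr (\<alpha> - n)) * \<phi> x t * indicator {1..} t \<partial>mult_haar))"
        by (rule mult_left_mono) simp
      have "1 \<le> ennreal (n - \<alpha>) * (\<integral>\<^sup>+t. ennreal (t powr (\<alpha> - n)) * \<phi> x t \<partial>mult_haar)"
        using x riesz_potential_le[OF f, of x] by (simp add: \<phi>_eq n_def)
      also note *
      also have "ennreal (n - \<alpha>) * ((\<integral>\<^sup>+t. ennreal (t powr (\<alpha> - n)) * \<phi> x t * indicator {..1} t \<partial>mult_haar) + (\<integral>\<^sup>+t. ennreal (t powr (\<alpha> - n)) * \<phi> x t * indicator {1..} t \<partial>mult_haar))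
        \<le> near x + ennreal (1/2)"
        unfolding distrib_left near_def by (intro add_left_mono far)
      finally have "1 \<le> near x + ennreal (1/2)" .
      then show "ennreal (1/2) \<le> near x"
      proof (cases "near x")
        case (real z)
        then have "ennreal 1 \<le> ennreal (z + 1/2)"
          using \<open>1 \<le> near x + ennreal (1/2)\<close> by (subst ennreal_plus) auto
        then have "1/2 \<le> z" using real by (subst (asm) ennreal_le_iff) auto
        then show ?thesis by (simp only: real ennreal_leI)
      qed simp
    qed
    have near_int: "(\<integral>\<^sup>+x\<in>ball 0 R. near x \<partial>lborel) \<le> ennreal (C / 2 * e powr (1 / p))"
    proof -
      have [measurable]: "ball (0::real^'n) R \<in> sets borel" by simp
      have inner: "(\<integral>\<^sup>+x. \<phi> x t * indicator (ball 0 R) x \<partial>lborel) \<le> ennreal (w * t powr n) * \<phi> 0 (R + 1)" if t: "0 < t" "t \<le> 1" for t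
      proof -
        have "(\<integral>\<^sup>+x. \<phi> x t * indicator (ball 0 R) x \<partial>lborel)
          = (\<integral>\<^sup>+x. (\<integral>\<^sup>+y. (if dist x y \<le> t then 1 else 0) * f y * indicator (ball 0 R) x \<partial>lborel) \<partial>lborel)"
          unfolding \<phi>_def by (intro nn_integral_cong nn_integral_multc[symmetric]) measurable
        also have "\<dots> = (\<integral>\<^sup>+y. (\<integral>\<^sup>+x. (if dist x y \<le> t then 1 else 0) * f y * indicator (ball 0 R) x \<partial>lborel) \<partial>lborel)"
          by (rule lborel_pair.Fubini'[symmetric]) measurable
        also have "\<dots> \<le> (\<integral>\<^sup>+y. (\<integral>\<^sup>+x. ((if dist 0 y \<le> R + 1 then 1 else 0) * f y) * indicator (cball y t) x \<partial>lborel) \<partial>lborel)"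
        proof (intro nn_integral_mono)
          fix x y :: "real^'n"
          have "dist 0 y \<le> R + 1" if "dist x y \<le> t" "dist 0 x < R"
            using that t dist_triangle[of 0 y x] by linarith
          then show "(if dist x y \<le> t then 1 else 0) * f y * indicator (ball 0 R) x
            \<le> ((if dist 0 y \<le> R + 1 then 1 else 0) * f y) * indicator (cball y t) x"
            by (auto simp: indicator_def dist_commute)
        qed
        also have "\<dots> = (\<integral>\<^sup>+y. ((if dist 0 y \<le> R + 1 then 1 else 0) * f y) * ennreal (w * t powr n) \<partial>lborel)"
          using t by (intro nn_integral_cong) (simp add: nn_integral_cmult_indicator emeasure_cball w_def n_def powr_realpow)
        also have "\<dots> = \<phi> 0 (R + 1) * ennreal (w * t powr n)"
          unfolding \<phi>_def by (rule nn_integral_multc) measurable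
        finally show ?thesis by (simp add: mult.commute)
      qed
      have "(\<integral>\<^sup>+x\<in>ball 0 R. near x \<partial>lborel) = (\<integral>\<^sup>+x. ennreal (n - \<alpha>) * (\<integral>\<^sup>+t. ennreal (t powr (\<alpha> - n)) * \<phi> x t * indicator {..1} t * indicator (ball 0 R) x \<partial>mult_haar) \<partial>lborel)"
      proof (rule nn_integral_cong)
        fix x :: "real^'n"
        have "(\<integral>\<^sup>+t. ennreal (t powr (\<alpha> - n)) * \<phi> x t * indicator {..1} t * indicator (ball 0 R) x \<partial>mult_haar)
           = (\<integral>\<^sup>+t. ennreal (t powr (\<alpha> - n)) * \<phi> x t * indicator {..1} t \<partial>mult_haar) * indicator (ball 0 R) x"
          by (rule nn_integral_multc) measurable
        then show "near x * indicator (ball 0 R) x = ennreal (n - \<alpha>) * (\<integral>\<^sup>+t. ennreal (t powr (\<alpha> - n)) * \<phi> x t * indicator {..1} t * indicator (ball 0 R) x \<partial>mult_haar)"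
          by (simp only: near_def mult.assoc)
      qed
      also have "\<dots> = ennreal (n - \<alpha>) * (\<integral>\<^sup>+x. (\<integral>\<^sup>+t. ennreal (t powr (\<alpha> - n)) * \<phi> x t * indicator {..1} t * indicator (ball 0 R) x \<partial>mult_haar) \<partial>lborel)"
        by (rule nn_integral_cmult) measurable
      also have "(\<integral>\<^sup>+x. (\<integral>\<^sup>+t. ennreal (t powr (\<alpha> - n)) * \<phi> x t * indicator {..1} t * indicator (ball 0 R) x \<partial>mult_haar) \<partial>lborel)
        = (\<integral>\<^sup>+t. (\<integral>\<^sup>+x. ennreal (t powr (\<alpha> - n)) * \<phi> x t * indicator {..1} t * indicator (ball 0 R) x \<partial>lborel) \<partial>mult_haar)"
        by (rule xh.Fubini') measurable
      also have "\<dots> \<le> (\<integral>\<^sup>+t. ennreal w * \<phi> 0 (R + 1) * (ennreal (t powr \<alpha>) * indicator {..1} t) \<partial>mult_haar)"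
      proof (rule nn_integral_mono_AE)
        show "AE t in mult_haar. (\<integral>\<^sup>+x. ennreal (t powr (\<alpha> - n)) * \<phi> x t * indicator {..1} t * indicator (ball 0 R) x \<partial>lborel)
           \<le> ennreal w * \<phi> 0 (R + 1) * (ennreal (t powr \<alpha>) * indicator {..1} t)"
          using AE_mult_haar_pos
        proof eventually_elim
          case (elim t)
          show ?case
          proof (cases "t \<le> 1")
            case True
            have "(\<integral>\<^sup>+x. ennreal (t powr (\<alpha> - n)) * \<phi> x t * indicator {..1} t * indicator (ball 0 R) x \<partial>lborel)
              = (\<integral>\<^sup>+x. ennreal (t powr (\<alpha> - n)) * (\<phi> x t * indicator (ball 0 R) x) \<partial>lborel)"
              using True by (simp add: mult_ac)
            also have "\<dots> = ennreal (t powr (\<alpha> - n)) * (\<integral>\<^sup>+x. \<phi> x t * indicator (ball 0 R) x \<partial>lborel)"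
              by (rule nn_integral_cmult) measurable
            also have "\<dots> \<le> ennreal (t powr (\<alpha> - n)) * (ennreal (w * t powr n) * \<phi> 0 (R + 1))"
              by (intro mult_left_mono inner elim True) simp
            also have "\<dots> = ennreal (w * (t powr (\<alpha> - n) * t powr n)) * \<phi> 0 (R + 1)"
              using w by (subst ennreal_mult_left) (auto simp: mult_ac)
            also have "t powr (\<alpha> - n) * t powr n = t powr \<alpha>" using elim by (simp add: powr_add[symmetric])
            finally show ?thesis using True w by (simp add: ennreal_mult mult_ac)
          qed simp
        qed
      qed
      also have "\<dots> = ennreal w * \<phi> 0 (R + 1) * ennreal (1 / \<alpha>)"
        using nn_integral_powr_below[of 1 \<alpha>] \<alpha> by (subst nn_integral_cmult) auto
      also have "\<dots> \<le> ennreal w * ennreal (A * (R + 1) powr (n - n / p)) * ennreal (1 / \<alpha>)"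
        using R by (intro mult_right_mono mult_left_mono \<phi>_le) auto
      finally have "(\<integral>\<^sup>+x\<in>ball 0 R. near x \<partial>lborel) \<le> ennreal (n - \<alpha>) * (ennreal w * ennreal (A * (R + 1) powr (n - n / p)) * ennreal (1 / \<alpha>))"
        by (simp add: mult_left_mono)
      also have "\<dots> = ennreal ((n - \<alpha>) * (w * (A * (R + 1) powr (n - n / p)) * (1 / \<alpha>)))"
      proof -
        have "0 \<le> n - \<alpha>" "0 \<le> w" "0 \<le> A * (R + 1) powr (n - n / p)" "0 \<le> 1 / \<alpha>" using b w A \<alpha> by auto
        then show ?thesis by (simp only: ennreal_mult[symmetric] mult_nonneg_nonneg)
      qed
      also have "(n - \<alpha>) * (w * (A * (R + 1) powr (n - n / p)) * (1 / \<alpha>)) = C / 2 * e powr (1 / p)"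
        by (simp add: C_def A_def)
      finally show ?thesis .
    qed
    have "ennreal (1/2) * emeasure lborel ?D = (\<integral>\<^sup>+x. ennreal (1/2) * indicator ?D x \<partial>lborel)"
      by (rule nn_integral_cmult_indicator[symmetric]) measurable
    also have "\<dots> \<le> (\<integral>\<^sup>+x\<in>ball 0 R. near x \<partial>lborel)"
      by (intro nn_integral_mono) (auto simp: indicator_def)
    also note near_int
    finally have "ennreal 2 * (ennreal (1/2) * emeasure lborel ?D) \<le> ennreal 2 * ennreal (C / 2 * e powr (1 / p))"
      by (rule mult_left_mono) simp
    moreover have "ennreal 2 * (ennreal (1/2) * emeasure lborel ?D) = ennreal (2 * (1/2)) * emeasure lborel ?D"
      by (rule ennreal_mult_left) auto
    moreover have "ennreal 2 * ennreal (C / 2 * e powr (1 / p)) = ennreal (2 * (C / 2 * e powr (1 / p)))"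
      by (rule ennreal_mult[symmetric]) (use C in auto)
    ultimately have "emeasure lborel ?D \<le> ennreal (C * e powr (1 / p))"
      by simp
    moreover have "?D \<in> sets borel" by measurable
    ultimately show "\<exists>D\<in>sets borel. {x\<in>ball (0::real^'n) R. 1 \<le> riesz_potential \<alpha> f x} \<subseteq> D \<and> emeasure lborel D \<le> ennreal (C * e powr (1 / p))"
      using sub by blast
  qed
qed

text \<open>A set of capacity zero lies, within each ball, in sets of arbitrarily small measure.\<close>

lemma capacity_zero_imp_AE:
  assumes "capacity \<alpha> p (Z :: (real^'n) set) = 0"
  shows "AE x in lborel. x \<notin> Z"
proof -
  have "\<exists>Y\<in>null_sets lborel. Z \<inter> ball 0 (real (Suc j)) \<subseteq> Y" for j
  proof -
    let ?R = "real (Suc j)"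
    have R: "0 < ?R" by simp
    obtain C e0 where C: "C > 0" and e0: "e0 > 0" and K: "\<forall>f e. f \<in> borel_measurable borel \<longrightarrow> 0 < e \<longrightarrow> e \<le> e0 \<longrightarrow>
      (\<integral>\<^sup>+x. f x epowr p \<partial>lborel) \<le> ennreal e \<longrightarrow>
      (\<exists>D\<in>sets borel. {x\<in>ball (0::real^'n) ?R. 1 \<le> riesz_potential \<alpha> f x} \<subseteq> D \<and> emeasure lborel D \<le> ennreal (C * e powr (1 / p)))"
      using riesz_superlevel_le[OF R] by (elim exE conjE) (rule that)
    have D: "\<exists>D\<in>sets borel. Z \<inter> ball 0 ?R \<subseteq> D \<and> emeasure lborel D \<le> ennreal d" if d: "0 < d" for d
    proof -
      define e where "e = min e0 ((d / C) powr p)"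
      have e: "0 < e" "e \<le> e0" using e0 d C by (auto simp: e_def)
      have "capacity \<alpha> p Z < ennreal e" using assms e by simp
      then obtain f where f: "f \<in> borel_measurable lebesgue" "\<forall>x\<in>Z. 1 \<le> riesz_potential \<alpha> f x"
        "Lnorm p f epowr p < ennreal e"
        unfolding capacity_def by (auto simp: Inf_less_iff)
      obtain g where g: "g \<in> borel_measurable lborel" "AE x in lborel. f x = g x"
        using completion_ex_borel_measurable[OF f(1)] by blast
      have "(\<integral>\<^sup>+x. f x epowr p \<partial>lebesgue) = (\<integral>\<^sup>+x. g x epowr p \<partial>lborel)"
        unfolding nn_integral_completion using g(2) by (intro nn_integral_cong_AE) auto
      then have gi: "(\<integral>\<^sup>+x. g x epowr p \<partial>lborel) \<le> ennreal e"
        using f(3) p by (simp add: Lnorm_def)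
      have gb: "g \<in> borel_measurable borel" using g(1) by simp
      have "riesz_potential \<alpha> f x = riesz_potential \<alpha> g x" for x
        unfolding riesz_potential_def nn_integral_completion using g(2) by (intro nn_integral_cong_AE) auto
      obtain D where D: "D \<in> sets borel" "{x\<in>ball (0::real^'n) ?R. 1 \<le> riesz_potential \<alpha> g x} \<subseteq> D"
        "emeasure lborel D \<le> ennreal (C * e powr (1 / p))"
        using K[rule_format, OF gb e gi] by blast
      have "e powr (1 / p) \<le> ((d / C) powr p) powr (1 / p)"
        using e p by (intro powr_mono2) (auto simp: e_def)
      also have "\<dots> = d / C" using d C p by (simp add: powr_powr)
      finally have "C * e powr (1 / p) \<le> d" using C by (simp add: field_simps)
      then have "emeasure lborel D \<le> ennreal d" using D(3) by (meson ennreal_leI order_trans)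
      moreover have "Z \<inter> ball 0 ?R \<subseteq> D"
        using D(2) f(2) \<open>\<And>x. riesz_potential \<alpha> f x = riesz_potential \<alpha> g x\<close> by auto
      ultimately show ?thesis using D(1) by blast
    qed
    have "\<forall>k::nat. \<exists>D\<in>sets borel. Z \<inter> ball 0 ?R \<subseteq> D \<and> emeasure lborel D \<le> ennreal (1 / real (Suc k))"
      using D by simp
    then obtain D where D: "\<And>k::nat. D k \<in> sets borel" "\<And>k. Z \<inter> ball 0 ?R \<subseteq> D k"
      "\<And>k. emeasure lborel (D k) \<le> ennreal (1 / real (Suc k))"
      by metis
    have "emeasure lborel (\<Inter>k. D k) \<le> 0"
    proof (rule ennreal_le_epsilon)
      fix d :: real assume "0 < d"
      then obtain k where k: "1 / real (Suc k) < d" using nat_approx_posE by blast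
      have "emeasure lborel (\<Inter>k. D k) \<le> emeasure lborel (D k)"
        using D(1) by (intro emeasure_mono) auto
      also have "\<dots> \<le> ennreal (1 / real (Suc k))" by (rule D(3))
      also have "\<dots> \<le> ennreal d" using k by (intro ennreal_leI) simp
      finally show "emeasure lborel (\<Inter>k. D k) \<le> 0 + ennreal d" by simp
    qed
    then have "(\<Inter>k. D k) \<in> null_sets lborel" using D(1) by (auto simp: null_sets_def)
    then show ?thesis using D(2) by blast
  qed
  then obtain Y where Y: "\<And>j::nat. Y j \<in> null_sets lborel" "\<And>j. Z \<inter> ball 0 (real (Suc j)) \<subseteq> Y j" by metis
  have "(\<Union>j. Y j) \<in> null_sets lborel" using Y(1) by (intro null_sets_UN) auto
  then have "AE x in lborel. x \<notin> (\<Union>j. Y j)" by (rule AE_not_in)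
  then show ?thesis
  proof eventually_elim
    case (elim x)
    obtain j :: nat where "norm x < real j" using reals_Archimedean2 by blast
    then have "x \<in> ball 0 (real (Suc j))" by simp
    then show ?case using Y(2)[of j] elim by auto
  qed
qed

end

section \<open>Supersolutions\<close>

lemma emeasure_mult_haar_atLeast:
  assumes "0 < a"
  shows "emeasure mult_haar {a..} = top"
proof (rule ccontr)
  assume "\<not> ?thesis"
  then obtain M where M: "emeasure mult_haar {a..} = ennreal M" "0 \<le> M" by (metis ennreal_cases)
  define b where "b = exp (M + ln a + 1)"
  have "ln b - ln a = M + 1" by (simp add: b_def)
  have "exp (ln a) \<le> b" unfolding b_def exp_le_cancel_iff using M by simp
  then have "a \<le> b" using assms by simp
  then have "ennreal (M + 1) = emeasure mult_haar {a..b}"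
    using nn_integral_mult_haar_Icc[OF assms, of b] \<open>ln b - ln a = M + 1\<close> by simp
  also have "\<dots> \<le> ennreal M" unfolding M(1)[symmetric] by (intro emeasure_mono) auto
  finally show False using M by (subst (asm) ennreal_le_iff) auto
qed

text \<open>Writing the power as an integral over scales \<open>t\<close>, the integral over space becomes at least a
  multiple of the integral of \<open>t\<^bsup>n-b\<^esup> dt/t\<close> near infinity.\<close>

lemma power_decay_not_integrable:
  fixes R b :: real
  assumes b: "0 < b" "b \<le> real DIM('a)" and R: "0 < R"
  shows "(\<integral>\<^sup>+(x::'a::euclidean_space). ennreal ((norm x + R) powr (-b)) \<partial>lborel) = top"
proof -
  let ?n = "real DIM('a)"
  define w where "w = unit_ball_vol ?n"
  have w: "w > 0" by (simp add: w_def)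
  interpret h: sigma_finite_measure mult_haar by simp
  interpret xh: pair_sigma_finite mult_haar "lborel :: 'a measure" ..
  have "ennreal ((norm x + R) powr (-b)) = (\<integral>\<^sup>+t. ennreal b * (ennreal (t powr (-b)) * (if norm x + R \<le> t then 1 else 0)) \<partial>mult_haar)" for x :: 'a
  proof -
    have "(\<integral>\<^sup>+t. ennreal b * (ennreal (t powr (-b)) * (if norm x + R \<le> t then 1 else 0)) \<partial>mult_haar)
      = ennreal b * (\<integral>\<^sup>+t. ennreal (t powr (-b)) * (if norm x + R \<le> t then 1 else 0) \<partial>mult_haar)"
      by (rule nn_integral_cmult) measurable
    also have "(\<integral>\<^sup>+t. ennreal (t powr (-b)) * (if norm x + R \<le> t then 1 else 0) \<partial>mult_haar)
      = (\<integral>\<^sup>+t\<in>{norm x + R..}. ennreal (t powr (-b)) \<partial>mult_haar)"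
      by (intro nn_integral_cong) (auto simp: indicator_def)
    also have "\<dots> = ennreal ((norm x + R) powr (-b) / b)"
      using b R by (intro nn_integral_powr_above) (auto intro: add_nonneg_pos)
    finally show ?thesis using b by (simp add: ennreal_mult[symmetric])
  qed
  then have "(\<integral>\<^sup>+(x::'a). ennreal ((norm x + R) powr (-b)) \<partial>lborel)
    = (\<integral>\<^sup>+(x::'a). (\<integral>\<^sup>+t. ennreal b * (ennreal (t powr (-b)) * (if norm x + R \<le> t then 1 else 0)) \<partial>mult_haar) \<partial>lborel)"
    by simp
  also have "\<dots> = (\<integral>\<^sup>+t. (\<integral>\<^sup>+(x::'a). ennreal b * (ennreal (t powr (-b)) * (if norm x + R \<le> t then 1 else 0)) \<partial>lborel) \<partial>mult_haar)"
    by (rule xh.Fubini') measurable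
  finally have eq: "(\<integral>\<^sup>+(x::'a). ennreal ((norm x + R) powr (-b)) \<partial>lborel)
    = (\<integral>\<^sup>+t. (\<integral>\<^sup>+(x::'a). ennreal b * (ennreal (t powr (-b)) * (if norm x + R \<le> t then 1 else 0)) \<partial>lborel) \<partial>mult_haar)" .
  have "(\<integral>\<^sup>+t. ennreal (b * w * (1/2) ^ DIM('a) * (2 * R) powr (?n - b)) * indicator {2*R..} t \<partial>mult_haar)
    \<le> (\<integral>\<^sup>+t. (\<integral>\<^sup>+(x::'a). ennreal b * (ennreal (t powr (-b)) * (if norm x + R \<le> t then 1 else 0)) \<partial>lborel) \<partial>mult_haar)"
  proof (rule nn_integral_mono)
    fix t :: real
    show "ennreal (b * w * (1/2) ^ DIM('a) * (2 * R) powr (?n - b)) * indicator {2*R..} t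
      \<le> (\<integral>\<^sup>+(x::'a). ennreal b * (ennreal (t powr (-b)) * (if norm x + R \<le> t then 1 else 0)) \<partial>lborel)"
    proof (cases "2 * R \<le> t")
      case True
      have "(2 * R) powr (?n - b) \<le> t powr (?n - b)" using True b R by (intro powr_mono2) auto
      then have "b * w * (1/2) ^ DIM('a) * (2 * R) powr (?n - b) \<le> b * w * (1/2) ^ DIM('a) * t powr (?n - b)"
        using b w by (intro mult_left_mono) auto
      also have "t powr (?n - b) = t powr (-b) * t ^ DIM('a)"
        using True R powr_add[of t "-b" ?n] by (simp add: powr_realpow)
      also have "b * w * (1/2) ^ DIM('a) * (t powr (-b) * t ^ DIM('a)) = b * t powr (-b) * (w * (t / 2) ^ DIM('a))"
        by (simp add: power_divide)
      finally have "ennreal (b * w * (1/2) ^ DIM('a) * (2 * R) powr (?n - b)) \<le> ennreal (b * t powr (-b) * (w * (t / 2) ^ DIM('a)))"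
        by (rule ennreal_leI)
      also have "\<dots> = ennreal (b * t powr (-b)) * emeasure lborel (ball (0::'a) (t / 2))"
        using True R b w by (simp add: emeasure_ball w_def ennreal_mult)
      also have "\<dots> = (\<integral>\<^sup>+x. ennreal (b * t powr (-b)) * indicator (ball (0::'a) (t / 2)) x \<partial>lborel)"
        by (rule nn_integral_cmult_indicator[symmetric]) simp
      also have "\<dots> \<le> (\<integral>\<^sup>+(x::'a). ennreal b * (ennreal (t powr (-b)) * (if norm x + R \<le> t then 1 else 0)) \<partial>lborel)"
        using True b by (intro nn_integral_mono) (auto simp: indicator_def ennreal_mult)
      finally show ?thesis using True by simp
    qed simp
  qed
  moreover have "(\<integral>\<^sup>+t. ennreal (b * w * (1/2) ^ DIM('a) * (2 * R) powr (?n - b)) * indicator {2*R..} t \<partial>mult_haar) = top"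
  proof -
    have "0 < b * w * (1/2) ^ DIM('a) * (2 * R) powr (?n - b)"
      using b w R by (intro mult_pos_pos) auto
    then show ?thesis
      using R by (subst nn_integral_cmult_indicator) (auto simp: emeasure_mult_haar_atLeast ennreal_mult_top)
  qed
  ultimately show ?thesis unfolding eq by (simp add: top_unique)
qed

lemma Lnorm_epowr: "0 < r \<Longrightarrow> Lnorm r f epowr r = (\<integral>\<^sup>+x. f x epowr r \<partial>lborel)"
  by (simp add: Lnorm_def nn_integral_completion)

lemma Lnorm_less_top: "Lnorm r f < top \<longleftrightarrow> (\<integral>\<^sup>+x. f x epowr r \<partial>lborel) < top"
  by (simp add: Lnorm_def nn_integral_completion)

context wolff_exponents
begin

lemma weighted_measure_borel_version:
  assumes \<sigma>: "radon_measure (\<sigma> :: (real^'n) measure)" and u: "in_L_loc q \<sigma> u"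
  obtains v where "v \<in> borel_measurable borel" "AE x in \<sigma>. u x = v x"
    "radon_measure (power_density \<sigma> v)"
    "W (weighted_measure q \<sigma> u) = W (power_density \<sigma> v)"
proof -
  note [measurable_cong] = radon_sets[OF \<sigma>]
  have um: "u \<in> borel_measurable (completion \<sigma>)" using u by (simp add: in_L_loc_def)
  obtain v where v: "v \<in> borel_measurable \<sigma>" "AE x in \<sigma>. u x = v x"
    using completion_ex_borel_measurable[OF um] by blast
  have [measurable]: "v \<in> borel_measurable borel" using v(1) radon_sets[OF \<sigma>] by (simp cong: measurable_cong_sets)
  have vq: "(\<lambda>x. v x epowr q) \<in> borel_measurable \<sigma>" by measurable
  let ?\<mu> = "power_density \<sigma> v"
  have em: "(\<integral>\<^sup>+x\<in>A. u x epowr q \<partial>completion \<sigma>) = emeasure ?\<mu> A" if A: "A \<in> sets borel" for A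
  proof -
    have "emeasure ?\<mu> A = (\<integral>\<^sup>+x\<in>A. v x epowr q \<partial>\<sigma>)"
      using A radon_sets[OF \<sigma>] by (intro emeasure_density vq) auto
    also have "\<dots> = (\<integral>\<^sup>+x\<in>A. u x epowr q \<partial>\<sigma>)"
      using v(2) by (intro nn_integral_cong_AE) auto
    finally show ?thesis by (simp add: nn_integral_completion)
  qed
  have wm: "emeasure (weighted_measure q \<sigma> u) A = emeasure ?\<mu> A" if A: "A \<in> sets borel" for A
  proof -
    have "A \<in> sets (completion \<sigma>)" using A radon_sets[OF \<sigma>] by (intro sets_completionI_sets) auto
    then have "emeasure (weighted_measure q \<sigma> u) A = (\<integral>\<^sup>+x\<in>A. u x epowr q \<partial>completion \<sigma>)"
      unfolding weighted_measure_def by (intro emeasure_density epowr_measurable um)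
    then show ?thesis using em[OF A] by simp
  qed
  show ?thesis
  proof (rule that[of v])
    show "radon_measure ?\<mu>"
      unfolding radon_measure_def
    proof (intro conjI allI impI)
      fix K :: "(real^'n) set" assume K: "compact K"
      then have "K \<in> sets borel" by (intro borel_closed compact_imp_closed)
      moreover have "(\<integral>\<^sup>+x\<in>K. u x epowr q \<partial>completion \<sigma>) < \<infinity>" using u K by (simp only: in_L_loc_def)
      ultimately show "emeasure ?\<mu> K < \<infinity>" using em[of K] by simp
    qed (simp add: radon_sets[OF \<sigma>])
    show "W (weighted_measure q \<sigma> u) = W ?\<mu>"
      by (rule ext, rule antisym; rule W_mono) (simp_all add: wm)
  qed (use v in simp_all)
qed

text \<open>All later arguments use the Borel representative \<open>v\<close> of \<open>u\<close> for the measure and the inequality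
  \<open>\<sigma>\<close>-almost everywhere, but \<open>u\<close> itself for the inequality Lebesgue almost everywhere: the two
  functions may well differ on sets of positive Lebesgue measure.\<close>

lemma supersolution_borel_version:
  assumes \<sigma>: "radon_measure (\<sigma> :: (real^'n) measure)" and u: "supersolution \<alpha> p q \<sigma> u"
  obtains v where "v \<in> borel_measurable borel" "AE x in \<sigma>. u x = v x"
    "radon_measure (power_density \<sigma> v)"
    "AE x in \<sigma>. W (power_density \<sigma> v) x \<le> v x"
    "AE x in lborel. W (power_density \<sigma> v) x \<le> u x"
proof -
  have "in_L_loc q \<sigma> u" using u by (simp add: supersolution_def)
  from weighted_measure_borel_version[OF \<sigma> this] obtain v where v: "v \<in> borel_measurable borel" "AE x in \<sigma>. u x = v x"
    "radon_measure (power_density \<sigma> v)"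
    "W (weighted_measure q \<sigma> u) = W (power_density \<sigma> v)" by blast
  have 1: "AE x in \<sigma>. W (power_density \<sigma> v) x \<le> u x"
    using u v(4) by (simp add: supersolution_def)
  have 2: "AE x in \<sigma>. W (power_density \<sigma> v) x \<le> v x"
    using 1 v(2) by eventually_elim simp
  have "AE x in lborel. x \<notin> {x. \<not> W (weighted_measure q \<sigma> u) x \<le> u x}"
    using u by (intro capacity_zero_imp_AE) (simp add: supersolution_def quasi_everywhere_def)
  then have 3: "AE x in lborel. W (power_density \<sigma> v) x \<le> u x"
    by (simp add: v(4))
  show ?thesis using that[OF v(1-3) 2 3] .
qed

lemma solution_imp_supersolution: "solution \<alpha> p q \<sigma> u \<Longrightarrow> supersolution \<alpha> p q (\<sigma> :: (real^'n) measure) u"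
  unfolding solution_def supersolution_def
proof (elim conjE, intro conjI)
  assume "quasi_everywhere \<alpha> p (\<lambda>x. u x = wolff \<alpha> p (weighted_measure q \<sigma> u) x)"
  moreover have "capacity \<alpha> p A \<le> capacity \<alpha> p B" if "A \<subseteq> B" for A B :: "(real^'n) set"
    unfolding capacity_def using that by (intro Inf_superset_mono) auto
  moreover have "{x. \<not> wolff \<alpha> p (weighted_measure q \<sigma> u) x \<le> u x} \<subseteq> {x. u x \<noteq> wolff \<alpha> p (weighted_measure q \<sigma> u) x}"
    by auto
  ultimately show "quasi_everywhere \<alpha> p (\<lambda>x. wolff \<alpha> p (weighted_measure q \<sigma> u) x \<le> u x)"
    unfolding quasi_everywhere_def by (metis le_zero_eq)
qed auto

text \<open>The ball around \<open>x\<close> of radius \<open>norm x + R\<close> contains the ball of radius \<open>R\<close> around the origin.\<close>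

lemma gauge_decay:
  assumes \<eta>: "ball_gauge \<eta>" and R: "0 < R"
  shows "ennreal ((norm x + R) powr (-(N * s))) * \<eta> (0::real^'n) R epowr s \<le> gauge_quot N s \<eta> x (norm x + R)"
proof -
  have "\<eta> 0 R epowr s \<le> \<eta> x (norm x + R) epowr s"
    using s by (intro epowr_mono ball_gauge_mono[OF \<eta>]) auto
  then show ?thesis using R s by (simp add: gauge_quot_eq add_nonneg_pos mult_left_mono)
qed

theorem supersolution_trivial:
  assumes r: "0 < r" "r \<le> real CARD('n) * (p - 1) / (real CARD('n) - \<alpha> * p)"
    and \<sigma>: "radon_measure (\<sigma> :: (real^'n) measure)" and u: "supersolution \<alpha> p q \<sigma> u" "in_L r u"
  shows "trivial_for \<sigma> u"
proof -
  note [measurable_cong] = radon_sets[OF \<sigma>]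
  obtain v where v: "v \<in> borel_measurable borel" "AE x in \<sigma>. u x = v x"
    "radon_measure (power_density \<sigma> v)"
    "AE x in lborel. W (power_density \<sigma> v) x \<le> u x"
    using supersolution_borel_version[OF \<sigma> u(1)] by blast
  define \<mu> where "\<mu> = power_density \<sigma> v"
  note \<mu>sets = radon_sets[OF v(3), folded \<mu>_def]
  note [measurable] = v(1) W_measurable[OF \<mu>sets]
  have b: "0 < N * s * r" "N * s * r \<le> real DIM(real^'n)"
    using r N s p by (auto simp: N_def[symmetric] s_def field_simps)
  have zero: "emeasure \<mu> (ball 0 R) = 0" if R: "0 < R" for R
  proof (rule ccontr)
    assume nz: "emeasure \<mu> (ball 0 R) \<noteq> 0"
    have "emeasure \<mu> (ball 0 R) < top" using radon_ball[OF v(3)] by (simp add: \<mu>_def)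
    then obtain m where m: "emeasure \<mu> (ball 0 R) = ennreal m" "0 < m"
      using nz by (metis ennreal_cases ennreal_eq_0_iff less_irrefl not_le order_le_less)
    define k where "k = m powr s / c_low"
    have k: "k > 0" using m c_low by (simp add: k_def)
    have low: "ennreal (k * (norm x + R) powr (-(N * s))) \<le> W \<mu> x" for x
    proof -
      have "ennreal ((norm x + R) powr (-(N * s))) * ennreal (m powr s) \<le> ennreal ((norm x + R) powr (-(N * s))) * mass \<mu> x (norm x + R) epowr s"
        using m gauge_decay[OF ball_gauge_emeasure[OF \<mu>sets] R, of x] R s by (simp add: gauge_quot_eq add_nonneg_pos)
      also have "\<dots> \<le> ennreal c_low * W \<mu> x"
        using R by (intro W_lower \<mu>sets) (simp add: add_nonneg_pos)
      finally have "ennreal (1 / c_low) * (ennreal ((norm x + R) powr (-(N * s))) * ennreal (m powr s)) \<le> ennreal (1 / c_low) * (ennreal c_low * W \<mu> x)"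
        by (rule mult_left_mono) simp
      moreover have "ennreal (1 / c_low) * (ennreal c_low * W \<mu> x) = W \<mu> x"
        using c_low by (simp add: ennreal_mult_left)
      moreover have "ennreal (1 / c_low) * (ennreal ((norm x + R) powr (-(N * s))) * ennreal (m powr s)) = ennreal (k * (norm x + R) powr (-(N * s)))"
        using c_low by (subst ennreal_mult_left) (auto simp: ennreal_mult[symmetric] k_def mult_ac)
      ultimately show ?thesis by simp
    qed
    have "(\<integral>\<^sup>+(x::real^'n). ennreal ((norm x + R) powr (-(N * s * r))) \<partial>lborel) = top"
      using power_decay_not_integrable[OF b R] .
    then have "top = ennreal (k powr r) * (\<integral>\<^sup>+(x::real^'n). ennreal ((norm x + R) powr (-(N * s * r))) \<partial>lborel)"
      using k by (simp add: ennreal_mult_top)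
    also have "\<dots> = (\<integral>\<^sup>+(x::real^'n). ennreal (k powr r) * ennreal ((norm x + R) powr (-(N * s * r))) \<partial>lborel)"
      by (rule nn_integral_cmult[symmetric]) measurable
    also have "\<dots> = (\<integral>\<^sup>+(x::real^'n). ennreal (k * (norm x + R) powr (-(N * s))) epowr r \<partial>lborel)"
      using k by (simp add: powr_mult powr_powr ennreal_mult[symmetric])
    also have "\<dots> \<le> (\<integral>\<^sup>+x. u x epowr r \<partial>lborel)"
    proof (rule nn_integral_mono_AE)
      show "AE x in lborel. ennreal (k * (norm x + R) powr (-(N * s))) epowr r \<le> u x epowr r"
        using v(4)
      proof eventually_elim
        case (elim x)
        have "ennreal (k * (norm x + R) powr (-(N * s))) \<le> u x"
          using low[of x] elim by (simp add: \<mu>_def)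
        then show ?case using r by (intro epowr_mono) auto
      qed
    qed
    also have "\<dots> < top" using u(2) by (simp add: in_L_def Lnorm_less_top)
    finally show False by simp
  qed
  have "(\<Union>k. ball (0::real^'n) (real (Suc k))) = UNIV"
  proof (intro equalityI subsetI UNIV_I)
    fix x :: "real^'n"
    obtain k :: nat where "norm x < real k" using reals_Archimedean2 by blast
    then show "x \<in> (\<Union>k. ball 0 (real (Suc k)))" by (auto intro!: exI[of _ k])
  qed
  moreover have "(\<Union>k. ball (0::real^'n) (real (Suc k))) \<in> null_sets \<mu>"
    using zero \<mu>sets by (intro null_sets_UN) (auto simp: null_sets_def)
  ultimately have "emeasure \<mu> UNIV = 0" by (auto simp: null_sets_def)
  then have "(\<integral>\<^sup>+x. v x epowr q * indicator UNIV x \<partial>\<sigma>) = 0"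
    unfolding \<mu>_def by (subst (asm) emeasure_density) (auto simp: radon_sets[OF \<sigma>])
  then have "AE x in \<sigma>. v x epowr q = 0" by (subst (asm) nn_integral_0_iff_AE) auto
  with v(2) have "AE x in \<sigma>. u x = 0" by eventually_elim simp
  then show ?thesis by (simp add: trivial_for_def)
qed

theorem intrinsic_potential_in_L:
  assumes r: "0 < r" and \<sigma>: "radon_measure (\<sigma> :: (real^'n) measure)" "emeasure \<sigma> UNIV \<noteq> 0"
    and u: "positive_solution \<alpha> p q \<sigma> u" "in_L r u"
  shows "in_L r (intrinsic_potential \<alpha> p q \<sigma>)"
proof -
  note \<sigma>sets = radon_sets[OF \<sigma>(1)]
  note [measurable_cong] = \<sigma>sets
  have "supersolution \<alpha> p q \<sigma> u"
    using u(1) by (intro solution_imp_supersolution) (simp add: positive_solution_def)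
  then obtain v where v: "v \<in> borel_measurable borel" "AE x in \<sigma>. u x = v x"
    "radon_measure (power_density \<sigma> v)"
    "AE x in \<sigma>. W (power_density \<sigma> v) x \<le> v x"
    "AE x in lborel. W (power_density \<sigma> v) x \<le> u x"
    by (rule supersolution_borel_version[OF \<sigma>(1)]) (rule that)
  define \<mu> where "\<mu> = power_density \<sigma> v"
  note \<mu>sets = radon_sets[OF v(3), folded \<mu>_def]
  note [measurable] = v(1) W_measurable[OF \<mu>sets]
  have \<mu>0: "emeasure \<mu> UNIV \<noteq> 0"
  proof
    assume "emeasure \<mu> UNIV = 0"
    then have "(\<integral>\<^sup>+x. v x epowr q * indicator UNIV x \<partial>\<sigma>) = 0"
      unfolding \<mu>_def by (subst (asm) emeasure_density) (auto simp: \<sigma>sets)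
    then have "AE x in \<sigma>. v x epowr q = 0" by (subst (asm) nn_integral_0_iff_AE) auto
    moreover have "AE x in \<sigma>. u x > 0" using u(1) by (simp add: positive_solution_def)
    ultimately have "AE x in \<sigma>. False" using v(2) by eventually_elim auto
    then obtain Z where "{x \<in> space \<sigma>. \<not> False} \<subseteq> Z" "emeasure \<sigma> Z = 0" "Z \<in> sets \<sigma>" by (rule AE_E)
    then have "emeasure \<sigma> UNIV \<le> 0"
      using emeasure_mono[of UNIV Z \<sigma>] radon_space[OF \<sigma>(1)] by simp
    then show False using \<sigma>(2) by simp
  qed
  obtain C where C: "C > 0" and K: "\<forall>\<sigma> v x \<rho>. radon_measure (\<sigma> :: (real^'n) measure) \<longrightarrow> v \<in> borel_measurable borel \<longrightarrow>
     radon_measure (power_density \<sigma> v) \<longrightarrow> emeasure (power_density \<sigma> v) UNIV \<noteq> 0 \<longrightarrow>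
     (AE x in \<sigma>. W (power_density \<sigma> v) x \<le> v x) \<longrightarrow>
     kgauge \<sigma> x \<rho> \<le> ennreal C * mass (power_density \<sigma> v) x \<rho>"
    using kappa_le_supersolution by (elim exE conjE) (rule that)
  have kle: "kgauge \<sigma> x \<rho> \<le> ennreal C * mass \<mu> x \<rho>" for x \<rho>
    unfolding \<mu>_def using K[rule_format, OF \<sigma>(1) v(1,3) \<mu>0[unfolded \<mu>_def] v(4)] .
  note [measurable (raw)] = gauge_quot_measurable[OF ball_gauge_emeasure[OF \<mu>sets]]
  have pot: "intrinsic_potential \<alpha> p q \<sigma> x \<le> ennreal (C powr s) * W \<mu> x" for x
  proof -
    have "gauge_potential N s (kgauge \<sigma>) x \<le> (\<integral>\<^sup>+\<rho>. ennreal (C powr s) * gauge_quot N s (mass \<mu>) x \<rho> \<partial>mult_haar)"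
      unfolding gauge_potential_def
    proof (rule nn_integral_mono_AE)
      show "AE \<rho> in mult_haar. gauge_quot N s (kgauge \<sigma>) x \<rho> \<le> ennreal (C powr s) * gauge_quot N s (mass \<mu>) x \<rho>"
        using AE_mult_haar_pos
      proof eventually_elim
        case (elim \<rho>)
        have "kgauge \<sigma> x \<rho> epowr s \<le> (ennreal C * mass \<mu> x \<rho>) epowr s"
          using s kle by (intro epowr_mono) auto
        also have "\<dots> = ennreal (C powr s) * mass \<mu> x \<rho> epowr s" using C s by (simp add: epowr_ennreal_mult)
        finally have "ennreal (\<rho> powr (- (N * s))) * kgauge \<sigma> x \<rho> epowr s \<le> ennreal (\<rho> powr (- (N * s))) * (ennreal (C powr s) * mass \<mu> x \<rho> epowr s)"
          by (rule mult_left_mono) simp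
        then show ?case unfolding gauge_quot_eq[OF elim s] by (simp only: mult.left_commute)
      qed
    qed
    also have "\<dots> = ennreal (C powr s) * W \<mu> x"
      unfolding W_eq[OF \<mu>sets] gauge_potential_def by (rule nn_integral_cmult) measurable
    finally show ?thesis by (simp add: intrinsic_potential_eq[OF \<sigma>sets])
  qed
  have "(\<integral>\<^sup>+x. intrinsic_potential \<alpha> p q \<sigma> x epowr r \<partial>lborel) \<le> (\<integral>\<^sup>+x. ennreal ((C powr s) powr r) * W \<mu> x epowr r \<partial>lborel)"
  proof (rule nn_integral_mono)
    fix x
    have "intrinsic_potential \<alpha> p q \<sigma> x epowr r \<le> (ennreal (C powr s) * W \<mu> x) epowr r"
      using r pot by (intro epowr_mono) auto
    then show "intrinsic_potential \<alpha> p q \<sigma> x epowr r \<le> ennreal ((C powr s) powr r) * W \<mu> x epowr r"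
      using r by (simp add: epowr_ennreal_mult)
  qed
  also have "\<dots> = ennreal ((C powr s) powr r) * (\<integral>\<^sup>+x. W \<mu> x epowr r \<partial>lborel)"
    by (rule nn_integral_cmult) measurable
  finally have "(\<integral>\<^sup>+x. intrinsic_potential \<alpha> p q \<sigma> x epowr r \<partial>lborel)
      \<le> ennreal ((C powr s) powr r) * (\<integral>\<^sup>+x. W \<mu> x epowr r \<partial>lborel)" .
  moreover have "(\<integral>\<^sup>+x. W \<mu> x epowr r \<partial>lborel) \<le> (\<integral>\<^sup>+x. u x epowr r \<partial>lborel)"
    using v(5) r by (intro nn_integral_mono_AE) (auto simp: \<mu>_def elim!: eventually_mono intro!: epowr_mono)
  then have "(\<integral>\<^sup>+x. W \<mu> x epowr r \<partial>lborel) < top"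
    using u(2) by (auto simp: in_L_def Lnorm_less_top intro: order_le_less_trans)
  ultimately have fin: "(\<integral>\<^sup>+x. intrinsic_potential \<alpha> p q \<sigma> x epowr r \<partial>lborel) < top"
    by (auto simp: ennreal_mult_less_top intro: order_le_less_trans)
  have "intrinsic_potential \<alpha> p q \<sigma> = gauge_potential N s (kgauge \<sigma>)"
    by (rule ext) (rule intrinsic_potential_eq[OF \<sigma>sets])
  then have "intrinsic_potential \<alpha> p q \<sigma> \<in> borel_measurable lborel"
    using gauge_potential_measurable[OF ball_gauge_kappa[OF \<sigma>sets], of N s] by simp
  then show ?thesis using fin by (simp add: in_L_def Lnorm_less_top measurable_completion)
qed

theorem intrinsic_potential_norm_equiv:
  assumes r: "0 < r"
  shows "\<exists>c1>0. \<exists>c2>0. \<forall>\<sigma> :: (real^'n) measure. radon_measure \<sigma> \<longrightarrow>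
     (let A = Lnorm r (intrinsic_potential \<alpha> p q \<sigma>) epowr r;
          B = (\<integral>\<^sup>+x. (SUP \<rho>\<in>{0<..}. kappa_quot \<alpha> p q \<sigma> x \<rho> epowr (r / (p - 1))) \<partial>lebesgue)
      in ennreal c1 * B \<le> A \<and> A \<le> ennreal c2 * B)"
proof -
  obtain C where C: "C > 0" and K: "\<forall>\<eta> :: real^'n \<Rightarrow> real \<Rightarrow> ennreal. ball_gauge \<eta> \<longrightarrow>
    (\<integral>\<^sup>+x. gauge_potential N s \<eta> x epowr r \<partial>lborel) \<le> ennreal C * (\<integral>\<^sup>+x. gauge_maximal N s \<eta> x epowr r \<partial>lborel)"
    using potential_power_integral_le_maximal[OF s N r] by (elim exE conjE) (rule that)
  show ?thesis
  proof (rule exI[of _ "1 / c_low powr r"], rule conjI, use c_low in simp,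
      rule exI[of _ C], rule conjI[OF C], intro allI impI)
    fix \<sigma> :: "(real^'n) measure" assume \<sigma>: "radon_measure \<sigma>"
    note \<sigma>sets = radon_sets[OF \<sigma>]
    have \<eta>: "ball_gauge (kgauge \<sigma>)" using \<sigma>sets by (rule ball_gauge_kappa)
    define A where "A = (\<integral>\<^sup>+x. gauge_potential N s (kgauge \<sigma>) x epowr r \<partial>lborel)"
    define B where "B = (\<integral>\<^sup>+x. gauge_maximal N s (kgauge \<sigma>) x epowr r \<partial>lborel)"
    have A: "Lnorm r (intrinsic_potential \<alpha> p q \<sigma>) epowr r = A"
      using r by (simp add: Lnorm_epowr A_def intrinsic_potential_eq[OF \<sigma>sets])
    have B: "(\<integral>\<^sup>+x. (SUP \<rho>\<in>{0<..}. kappa_quot \<alpha> p q \<sigma> x \<rho> epowr (r / (p - 1))) \<partial>lebesgue) = B"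
    proof -
      have "B = (\<integral>\<^sup>+x. gauge_maximal N (s * r) (kgauge \<sigma>) x \<partial>lborel)"
        unfolding B_def gauge_maximal_epowr[OF r] ..
      then show ?thesis
        by (simp add: nn_integral_completion gauge_maximal_def kappa_quot_eq s_def)
    qed
    have "B \<le> ennreal (c_low powr r) * A"
      unfolding A_def B_def c_low_def by (rule maximal_power_integral_le_potential[OF \<eta> s N(1) r])
    then have "ennreal (1 / c_low powr r) * B \<le> ennreal (1 / c_low powr r) * (ennreal (c_low powr r) * A)"
      by (rule mult_left_mono) simp
    also have "\<dots> = A" using c_low by (simp add: ennreal_mult_left)
    finally have "ennreal (1 / c_low powr r) * B \<le> A" .
    moreover have "A \<le> ennreal C * B" using K \<eta> unfolding A_def B_def by blast
    ultimately show "let A = Lnorm r (intrinsic_potential \<alpha> p q \<sigma>) epowr r;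
          B = (\<integral>\<^sup>+x. (SUP \<rho>\<in>{0<..}. kappa_quot \<alpha> p q \<sigma> x \<rho> epowr (r / (p - 1))) \<partial>lebesgue)
      in ennreal (1 / c_low powr r) * B \<le> A \<and> A \<le> ennreal C * B"
      unfolding Let_def A B by blast
  qed
qed

section \<open>Existence of a solution\<close>

text \<open>The exponents are such that a bound of the mass in terms of \<open>\<kappa>\<^sup>q\<close> becomes a bound by the
  \<open>(1-\<theta>)\<close>-th power of the density built from \<open>\<kappa>\<close>: the powers of \<open>\<rho>\<close> match because
  \<open>-Ns + N\<theta>s = -Ns(1-\<theta>)\<close>, and those of \<open>\<kappa>\<close> because \<open>q = \<gamma>(1-\<theta>)\<close>.\<close>

lemma gauge_quot_transfer:
  assumes "0 < \<rho>" "0 \<le> D"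
    and le: "mass \<tau> x \<rho> \<le> ennreal (D * \<rho> powr (N * \<theta>)) * (\<kappa> \<sigma> (ball x \<rho>) epowr q * Y epowr q)"
  shows "gauge_quot N s (mass \<tau>) x \<rho>
    \<le> ennreal (D powr s) * (gauge_quot N s (kgauge \<sigma>) x \<rho> epowr (1 - \<theta>) * Y epowr \<theta>)"
proof -
  have e1: "(1 - \<theta>) * s * \<gamma> = \<theta>" using \<gamma>(2) \<theta>(3) by (simp add: mult.commute mult.left_commute)
  have "mass \<tau> x \<rho> epowr s \<le> (ennreal (D * \<rho> powr (N * \<theta>)) * (\<kappa> \<sigma> (ball x \<rho>) epowr q * Y epowr q)) epowr s"
    using s le by (intro epowr_mono) auto
  also have "\<dots> = ennreal ((D * \<rho> powr (N * \<theta>)) powr s) * (\<kappa> \<sigma> (ball x \<rho>) epowr \<theta> * Y epowr \<theta>)"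
    using s assms(2) by (simp add: epowr_ennreal_mult epowr_mult \<theta>(4))
  finally have "gauge_quot N s (mass \<tau>) x \<rho> \<le> ennreal (\<rho> powr (- (N * s))) * (ennreal ((D * \<rho> powr (N * \<theta>)) powr s) * (\<kappa> \<sigma> (ball x \<rho>) epowr \<theta> * Y epowr \<theta>))"
    unfolding gauge_quot_eq[OF assms(1) s] by (rule mult_left_mono) simp
  also have "\<dots> = ennreal (\<rho> powr (- (N * s)) * (D * \<rho> powr (N * \<theta>)) powr s) * (\<kappa> \<sigma> (ball x \<rho>) epowr \<theta> * Y epowr \<theta>)"
    by (rule ennreal_mult_left) auto
  also have "\<rho> powr (- (N * s)) * (D * \<rho> powr (N * \<theta>)) powr s = D powr s * (\<rho> powr (- (N * s))) powr (1 - \<theta>)"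
  proof -
    have "(D * \<rho> powr (N * \<theta>)) powr s = D powr s * \<rho> powr (N * \<theta> * s)"
      using assms by (simp add: powr_mult powr_powr)
    moreover have "\<rho> powr (- (N * s)) * \<rho> powr (N * \<theta> * s) = (\<rho> powr (- (N * s))) powr (1 - \<theta>)"
      by (simp add: powr_add[symmetric] powr_powr algebra_simps)
    ultimately show ?thesis by (simp add: mult.left_commute)
  qed
  also have "ennreal (D powr s * (\<rho> powr (- (N * s))) powr (1 - \<theta>)) * (\<kappa> \<sigma> (ball x \<rho>) epowr \<theta> * Y epowr \<theta>)
     = ennreal (D powr s) * (gauge_quot N s (kgauge \<sigma>) x \<rho> epowr (1 - \<theta>) * Y epowr \<theta>)"
    using assms(1) s \<theta>(1,2) e1
    by (simp add: gauge_quot_eq epowr_ennreal_mult ennreal_mult mult.assoc) (simp add: mult_ac)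
  finally show ?thesis .
qed

text \<open>The constant of \<open>emeasure_ball_le_kappa\<close>.\<close>

definition "c_mass = (c_low * 2 powr (N * s)) powr q"

lemma c_mass: "0 < c_mass" using c_low by (simp add: c_mass_def)

lemma gauge_quot_mass_le:
  assumes \<sigma>: "sets \<sigma> = sets borel" and \<rho>: "0 < \<rho>"
  shows "gauge_quot N s (mass \<sigma>) x \<rho> \<le> ennreal (c_mass powr s) * gauge_quot N s (kgauge \<sigma>) x \<rho> epowr (1 - \<theta>)"
  using gauge_quot_transfer[OF \<rho>, of c_mass \<sigma> x \<sigma> 1] emeasure_ball_le_kappa[OF \<sigma> \<rho>, of x] c_mass
  by (simp add: c_mass_def)

text \<open>Balls around \<open>y\<close> of radius at most \<open>\<rho>\<close> stay in the ball of radius \<open>2\<rho>\<close> around \<open>x\<close>; larger ones are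
  contained in balls of twice the radius around \<open>x\<close>.\<close>

lemma W_local_split:
  assumes \<omega>: "sets \<omega> = sets borel" and \<rho>: "0 < \<rho>" "dist x y < \<rho>"
  shows "W \<omega> y \<le> W (density \<omega> (indicator (ball x (2 * \<rho>)))) y + ennreal (2 powr (N * s)) * W \<omega> x"
proof -
  let ?\<beta> = "density \<omega> (indicator (ball x (2 * \<rho>)))"
  have \<beta>sets: "sets ?\<beta> = sets borel" using \<omega> by simp
  have ind: "indicator (ball x (2 * \<rho>)) \<in> borel_measurable \<omega>"
    using \<omega> by (intro borel_measurable_indicator) simp
  have \<beta>: "emeasure ?\<beta> A = emeasure \<omega> (A \<inter> ball x (2 * \<rho>))" if "A \<in> sets borel" for A
    using that \<omega> by (subst emeasure_density[OF ind]) (auto simp: indicator_inter_arith[symmetric] Int_commute)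
  note [measurable (raw)] = gauge_quot_measurable[OF ball_gauge_emeasure[OF \<omega>]] gauge_quot_measurable[OF ball_gauge_emeasure[OF \<beta>sets]]
  have "W \<omega> y \<le> (\<integral>\<^sup>+t. gauge_quot N s (mass ?\<beta>) y t + ennreal (2 powr (N * s)) * gauge_quot N s (mass \<omega>) x (2 * t) \<partial>mult_haar)"
    unfolding W_eq[OF \<omega>] gauge_potential_def
  proof (rule nn_integral_mono_AE)
    show "AE t in mult_haar. gauge_quot N s (mass \<omega>) y t \<le> gauge_quot N s (mass ?\<beta>) y t + ennreal (2 powr (N * s)) * gauge_quot N s (mass \<omega>) x (2 * t)"
      using AE_mult_haar_pos
    proof eventually_elim
      case (elim t)
      show ?case
      proof (cases "t \<le> \<rho>")
        case True
        then have "ball y t \<subseteq> ball x (2 * \<rho>)"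
          using \<rho> by (intro ball_subset_ball_dist) (simp add: dist_commute)
        then have "mass ?\<beta> y t = mass \<omega> y t" by (simp add: \<beta> Int_absorb2)
        then have "gauge_quot N s (mass ?\<beta>) y t = gauge_quot N s (mass \<omega>) y t" by (simp only: gauge_quot_def)
        then show ?thesis by simp
      next
        case False
        then have "gauge_quot N s (mass \<omega>) y t \<le> ennreal (2 powr (N * s)) * gauge_quot N s (mass \<omega>) x (2 * t)"
          using \<rho> elim s by (intro gauge_quot_double ball_gauge_emeasure \<omega>) (auto simp: dist_commute)
        then show ?thesis by (rule order_trans) simp
      qed
    qed
  qed
  also have "\<dots> = (\<integral>\<^sup>+t. gauge_quot N s (mass ?\<beta>) y t \<partial>mult_haar) + (\<integral>\<^sup>+t. ennreal (2 powr (N * s)) * gauge_quot N s (mass \<omega>) x (2 * t) \<partial>mult_haar)"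
    by (rule nn_integral_add) measurable
  also have "(\<integral>\<^sup>+t. ennreal (2 powr (N * s)) * gauge_quot N s (mass \<omega>) x (2 * t) \<partial>mult_haar)
     = ennreal (2 powr (N * s)) * (\<integral>\<^sup>+t. gauge_quot N s (mass \<omega>) x (2 * t) \<partial>mult_haar)"
    by (rule nn_integral_cmult) measurable
  also have "(\<integral>\<^sup>+t. gauge_quot N s (mass \<omega>) x (2 * t) \<partial>mult_haar) = W \<omega> x"
    unfolding W_eq[OF \<omega>] gauge_potential_def by (rule nn_integral_mult_haar_scale) auto
  also have "(\<integral>\<^sup>+t. gauge_quot N s (mass ?\<beta>) y t \<partial>mult_haar) = W ?\<beta> y"
    unfolding W_eq[OF \<beta>sets] gauge_potential_def ..
  finally show ?thesis .
qed

lemma mass_power_le_W: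
  assumes \<omega>: "sets \<omega> = sets borel" and \<rho>: "0 < \<rho>"
  shows "mass \<omega> x \<rho> epowr \<theta> \<le> ennreal (c_low powr q * \<rho> powr (N * \<theta>)) * W \<omega> x epowr q"
proof -
  have "ennreal (\<rho> powr (N * s)) * (ennreal (\<rho> powr (- (N * s))) * mass \<omega> x \<rho> epowr s) \<le> ennreal (\<rho> powr (N * s)) * (ennreal c_low * W \<omega> x)"
    by (intro mult_left_mono W_lower \<omega> \<rho>) simp
  also have "ennreal (\<rho> powr (N * s)) * (ennreal (\<rho> powr (- (N * s))) * mass \<omega> x \<rho> epowr s) = mass \<omega> x \<rho> epowr s"
    using \<rho> by (simp add: ennreal_mult_left powr_add[symmetric])
  also have "ennreal (\<rho> powr (N * s)) * (ennreal c_low * W \<omega> x) = ennreal (\<rho> powr (N * s) * c_low) * W \<omega> x"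
    using c_low by (intro ennreal_mult_left) auto
  finally have "(mass \<omega> x \<rho> epowr s) epowr q \<le> (ennreal (\<rho> powr (N * s) * c_low) * W \<omega> x) epowr q"
    using q by (intro epowr_mono) auto
  also have "\<dots> = ennreal ((\<rho> powr (N * s) * c_low) powr q) * W \<omega> x epowr q"
    using q c_low by (intro epowr_ennreal_mult) auto
  also have "(\<rho> powr (N * s) * c_low) powr q = c_low powr q * \<rho> powr (N * \<theta>)"
    using c_low by (simp add: powr_mult powr_powr mult.assoc \<theta>(3) mult.commute[of "c_low powr q"])
  finally show ?thesis by (simp add: \<theta>(3))
qed

text \<open>On the ball, \<open>W\<omega>\<close> is split as in \<open>W_local_split\<close>. The local part is integrated with the definition
  of \<open>\<kappa>\<close>, the mass of \<open>\<omega>\<close> near \<open>x\<close> being controlled by \<open>W\<omega>(x)\<close>; for the constant part the mass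
  of \<open>\<sigma>\<close> is bounded by \<open>\<kappa>\<close>. Both terms turn out to have the same form.\<close>

lemma iterate_quot_le:
  "\<exists>C>0. \<forall>\<sigma> \<omega> x \<rho>. radon_measure (\<sigma> :: (real^'n) measure) \<longrightarrow> radon_measure \<omega> \<longrightarrow> 0 < \<rho> \<longrightarrow>
     gauge_quot N s (mass (power_density \<sigma> (W \<omega>))) x \<rho>
       \<le> ennreal C * (gauge_quot N s (kgauge \<sigma>) x \<rho> epowr (1 - \<theta>) * W \<omega> x epowr \<theta>)"
proof -
  define A where "A = 2 powr q * (c_low powr q * 2 powr (N * \<theta>) + 2 powr (N * \<theta>) * c_mass)"
  have A: "A > 0" using c_low c_mass unfolding A_def by (intro mult_pos_pos add_pos_pos) auto
  show ?thesis
  proof (intro exI[of _ "A powr s"] conjI allI impI)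
    show "A powr s > 0" using A by simp
    fix \<sigma> \<omega> :: "(real^'n) measure" and x :: "real^'n" and \<rho>
    assume \<sigma>: "radon_measure \<sigma>" and \<omega>: "radon_measure \<omega>" and \<rho>: "(0::real) < \<rho>"
    note \<sigma>sets = radon_sets[OF \<sigma>] and \<omega>sets = radon_sets[OF \<omega>]
    note [measurable_cong] = \<sigma>sets
    note [measurable] = W_measurable[OF \<omega>sets]
    define B where "B = ball x \<rho>"
    have [measurable]: "B \<in> sets borel" by (simp add: B_def)
    let ?\<beta> = "density \<omega> (indicator (ball x (2 * \<rho>)))"
    have \<beta>sets: "sets ?\<beta> = sets borel" using \<omega>sets by simp
    note [measurable] = W_measurable[OF \<beta>sets]
    have ind: "indicator (ball x (2 * \<rho>)) \<in> borel_measurable \<omega>"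
      using \<omega>sets by (intro borel_measurable_indicator) simp
    have \<beta>U: "emeasure ?\<beta> UNIV = mass \<omega> x (2 * \<rho>)"
      using \<omega>sets by (subst emeasure_density[OF ind]) auto
    have \<beta>fin: "emeasure ?\<beta> UNIV < top" unfolding \<beta>U by (rule radon_ball[OF \<omega>])
    let ?u = "W \<omega> x" and ?k = "\<kappa> \<sigma> B epowr q"
    have "mass (power_density \<sigma> (W \<omega>)) x \<rho> = (\<integral>\<^sup>+y. W \<omega> y epowr q * indicator B y \<partial>\<sigma>)"
      unfolding B_def by (rule emeasure_density) (auto simp: \<sigma>sets)
    also have "\<dots> \<le> (\<integral>\<^sup>+y. ennreal (2 powr q) * (W ?\<beta> y epowr q * indicator B y) + ennreal (2 powr q * 2 powr (N * \<theta>)) * ?u epowr q * indicator B y \<partial>\<sigma>)"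
    proof (rule nn_integral_mono)
      fix y
      show "W \<omega> y epowr q * indicator B y \<le> ennreal (2 powr q) * (W ?\<beta> y epowr q * indicator B y) + ennreal (2 powr q * 2 powr (N * \<theta>)) * ?u epowr q * indicator B y"
      proof (cases "y \<in> B")
        case True
        have "W \<omega> y epowr q \<le> (W ?\<beta> y + ennreal (2 powr (N * s)) * ?u) epowr q"
          using q True \<rho> by (intro epowr_mono W_local_split \<omega>sets) (auto simp: B_def)
        also have "\<dots> \<le> ennreal (2 powr q) * (W ?\<beta> y epowr q + (ennreal (2 powr (N * s)) * ?u) epowr q)"
          using q by (intro epowr_sum_le) auto
        also have "(ennreal (2 powr (N * s)) * ?u) epowr q = ennreal (2 powr (N * \<theta>)) * ?u epowr q"
          using q \<theta>(3) by (simp add: epowr_ennreal_mult powr_powr mult.assoc)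
        finally show ?thesis using True by (simp add: distrib_left ennreal_mult mult.assoc)
      qed simp
    qed
    also have "\<dots> = ennreal (2 powr q) * (\<integral>\<^sup>+y\<in>B. W ?\<beta> y epowr q \<partial>\<sigma>) + ennreal (2 powr q * 2 powr (N * \<theta>)) * ?u epowr q * emeasure \<sigma> B"
      by (subst nn_integral_add, measurable) (simp add: nn_integral_cmult nn_integral_cmult_indicator \<sigma>sets)
    also have "\<dots> \<le> ennreal (2 powr q) * (?k * (ennreal (c_low powr q * (2 * \<rho>) powr (N * \<theta>)) * ?u epowr q))
       + ennreal (2 powr q * 2 powr (N * \<theta>)) * ?u epowr q * (ennreal (c_mass * \<rho> powr (N * \<theta>)) * ?k)"
    proof (intro add_mono mult_left_mono)
      have "(\<integral>\<^sup>+y\<in>B. W ?\<beta> y epowr q \<partial>\<sigma>) \<le> ?k * emeasure ?\<beta> UNIV epowr \<theta>"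
        by (intro kappa_bound radonI_finite \<beta>sets \<beta>fin)
      also have "\<dots> \<le> ?k * (ennreal (c_low powr q * (2 * \<rho>) powr (N * \<theta>)) * ?u epowr q)"
        unfolding \<beta>U using \<rho> by (intro mult_left_mono mass_power_le_W \<omega>sets) auto
      finally show "(\<integral>\<^sup>+y\<in>B. W ?\<beta> y epowr q \<partial>\<sigma>) \<le> ?k * (ennreal (c_low powr q * (2 * \<rho>) powr (N * \<theta>)) * ?u epowr q)" .
      show "emeasure \<sigma> B \<le> ennreal (c_mass * \<rho> powr (N * \<theta>)) * ?k"
        unfolding B_def c_mass_def by (rule emeasure_ball_le_kappa[OF \<sigma>sets \<rho>])
    qed auto
    also have "\<dots> = ennreal (A * \<rho> powr (N * \<theta>)) * (?k * ?u epowr q)"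
    proof -
      define b where "b = ?k * ?u epowr q"
      have "ennreal (2 powr q) * (?k * (ennreal (c_low powr q * (2 * \<rho>) powr (N * \<theta>)) * ?u epowr q)) = ennreal (2 powr q * (c_low powr q * (2 * \<rho>) powr (N * \<theta>))) * b"
        unfolding b_def by (subst ennreal_mult) (auto simp: mult_ac)
      moreover have "ennreal (2 powr q * 2 powr (N * \<theta>)) * ?u epowr q * (ennreal (c_mass * \<rho> powr (N * \<theta>)) * ?k) = ennreal (2 powr q * 2 powr (N * \<theta>) * (c_mass * \<rho> powr (N * \<theta>))) * b"
        unfolding b_def using c_mass by (subst (3) ennreal_mult) (auto simp: mult_ac)
      moreover have "A * \<rho> powr (N * \<theta>) = 2 powr q * (c_low powr q * (2 * \<rho>) powr (N * \<theta>)) + 2 powr q * 2 powr (N * \<theta>) * (c_mass * \<rho> powr (N * \<theta>))"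
        using \<rho> by (simp add: A_def powr_mult algebra_simps)
      ultimately show ?thesis
        using c_mass by (simp add: b_def[symmetric] ennreal_plus distrib_right)
    qed
    finally have "mass (power_density \<sigma> (W \<omega>)) x \<rho> \<le> ennreal (A * \<rho> powr (N * \<theta>)) * (\<kappa> \<sigma> (ball x \<rho>) epowr q * ?u epowr q)"
      by (simp add: B_def)
    then show "gauge_quot N s (mass (power_density \<sigma> (W \<omega>))) x \<rho>
       \<le> ennreal (A powr s) * (gauge_quot N s (kgauge \<sigma>) x \<rho> epowr (1 - \<theta>) * W \<omega> x epowr \<theta>)"
      using A by (intro gauge_quot_transfer \<rho>) auto
  qed
qed

text \<open>One step of the iteration contracts, up to a fixed amount, since it depends on \<open>W\<omega>\<close> only through
  the power \<open>\<theta> < 1\<close>.\<close>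

lemma iterate_integral_le:
  assumes r: "0 < r"
  shows "\<exists>C>0. \<forall>\<sigma> \<omega>. radon_measure (\<sigma> :: (real^'n) measure) \<longrightarrow> radon_measure \<omega> \<longrightarrow>
     (\<integral>\<^sup>+x. W (power_density \<sigma> (W \<omega>)) x epowr r \<partial>lborel)
       \<le> ennreal C * (\<integral>\<^sup>+x. gauge_maximal N s (kgauge \<sigma>) x epowr r \<partial>lborel) + ennreal (1/2) * (\<integral>\<^sup>+x. W \<omega> x epowr r \<partial>lborel)"
proof -
  obtain C where C: "C > 0" and K: "\<forall>\<eta> :: real^'n \<Rightarrow> real \<Rightarrow> ennreal. ball_gauge \<eta> \<longrightarrow>
    (\<integral>\<^sup>+x. gauge_potential N s \<eta> x epowr r \<partial>lborel) \<le> ennreal C * (\<integral>\<^sup>+x. gauge_maximal N s \<eta> x epowr r \<partial>lborel)"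
    using potential_power_integral_le_maximal[OF s N r] by (elim exE conjE) (rule that)
  obtain A where A: "A > 0" and step: "\<forall>\<sigma> \<omega> x \<rho>. radon_measure (\<sigma> :: (real^'n) measure) \<longrightarrow> radon_measure \<omega> \<longrightarrow> 0 < \<rho> \<longrightarrow>
     gauge_quot N s (mass (power_density \<sigma> (W \<omega>))) x \<rho>
       \<le> ennreal A * (gauge_quot N s (kgauge \<sigma>) x \<rho> epowr (1 - \<theta>) * W \<omega> x epowr \<theta>)"
    using iterate_quot_le by (elim exE conjE) (rule that)
  have CA: "0 < C * A powr r" using C A by simp
  obtain Y where Y: "Y > 0" and young: "\<forall>a b. ennreal (C * A powr r) * (a epowr (1 - \<theta>) * b epowr \<theta>) \<le> ennreal Y * a + ennreal (1/2) * b"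
    using young_absorb[OF \<theta>(1,2) CA, of "1/2"] by auto
  show ?thesis
  proof (intro exI[of _ Y] conjI Y allI impI)
    fix \<sigma> \<omega> :: "(real^'n) measure"
    assume \<sigma>: "radon_measure \<sigma>" and \<omega>: "radon_measure \<omega>"
    note \<sigma>sets = radon_sets[OF \<sigma>] and \<omega>sets = radon_sets[OF \<omega>]
    define \<omega>' where "\<omega>' = power_density \<sigma> (W \<omega>)"
    have \<omega>'sets: "sets \<omega>' = sets borel" by (simp add: \<omega>'_def \<sigma>sets)
    define M where "M = gauge_maximal N s (kgauge \<sigma>)"
    have [measurable]: "M \<in> borel_measurable borel" unfolding M_def by (intro gauge_maximal_measurable ball_gauge_kappa \<sigma>sets s)
    note [measurable] = W_measurable[OF \<omega>sets] gauge_maximal_measurable[OF ball_gauge_emeasure[OF \<omega>'sets] s, of N]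
    have max: "gauge_maximal N s (mass \<omega>') x \<le> ennreal A * (M x epowr (1 - \<theta>) * W \<omega> x epowr \<theta>)" for x
      unfolding gauge_maximal_def[of _ _ "mass \<omega>'"]
    proof (rule SUP_least)
      fix \<rho> :: real assume \<rho>: "\<rho> \<in> {0<..}"
      then have "gauge_quot N s (mass \<omega>') x \<rho> \<le> ennreal A * (gauge_quot N s (kgauge \<sigma>) x \<rho> epowr (1 - \<theta>) * W \<omega> x epowr \<theta>)"
        using step \<sigma> \<omega> unfolding \<omega>'_def by auto
      also have "\<dots> \<le> ennreal A * (M x epowr (1 - \<theta>) * W \<omega> x epowr \<theta>)"
        unfolding M_def using \<theta>(2) by (intro mult_left_mono mult_right_mono epowr_mono gauge_quot_le_maximal ball_gauge_kappa \<sigma>sets) auto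
      finally show "gauge_quot N s (mass \<omega>') x \<rho> \<le> ennreal A * (M x epowr (1 - \<theta>) * W \<omega> x epowr \<theta>)" .
    qed
    have "(\<integral>\<^sup>+x. W \<omega>' x epowr r \<partial>lborel) \<le> ennreal C * (\<integral>\<^sup>+x. gauge_maximal N s (mass \<omega>') x epowr r \<partial>lborel)"
      unfolding W_eq[OF \<omega>'sets] using K ball_gauge_emeasure[OF \<omega>'sets] by blast
    also have "\<dots> = (\<integral>\<^sup>+x. ennreal C * gauge_maximal N s (mass \<omega>') x epowr r \<partial>lborel)"
      by (rule nn_integral_cmult[symmetric]) measurable
    also have "\<dots> \<le> (\<integral>\<^sup>+x. ennreal Y * M x epowr r + ennreal (1/2) * W \<omega> x epowr r \<partial>lborel)"
    proof (rule nn_integral_mono)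
      fix x
      have "gauge_maximal N s (mass \<omega>') x epowr r \<le> (ennreal A * (M x epowr (1 - \<theta>) * W \<omega> x epowr \<theta>)) epowr r"
        using r max by (intro epowr_mono) auto
      also have "\<dots> = ennreal (A powr r) * ((M x epowr r) epowr (1 - \<theta>) * (W \<omega> x epowr r) epowr \<theta>)"
        using r A by (simp add: epowr_ennreal_mult epowr_mult mult.commute)
      finally have "ennreal C * gauge_maximal N s (mass \<omega>') x epowr r \<le> ennreal C * (ennreal (A powr r) * ((M x epowr r) epowr (1 - \<theta>) * (W \<omega> x epowr r) epowr \<theta>))"
        by (rule mult_left_mono) simp
      also have "\<dots> = ennreal (C * A powr r) * ((M x epowr r) epowr (1 - \<theta>) * (W \<omega> x epowr r) epowr \<theta>)"
        using C by (intro ennreal_mult_left) auto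
      also have "\<dots> \<le> ennreal Y * M x epowr r + ennreal (1/2) * W \<omega> x epowr r"
        using young by blast
      finally show "ennreal C * gauge_maximal N s (mass \<omega>') x epowr r \<le> ennreal Y * M x epowr r + ennreal (1/2) * W \<omega> x epowr r" .
    qed
    also have "\<dots> = (\<integral>\<^sup>+x. ennreal Y * M x epowr r \<partial>lborel) + (\<integral>\<^sup>+x. ennreal (1/2) * W \<omega> x epowr r \<partial>lborel)"
      by (rule nn_integral_add) measurable
    also have "(\<integral>\<^sup>+x. ennreal Y * M x epowr r \<partial>lborel) = ennreal Y * (\<integral>\<^sup>+x. M x epowr r \<partial>lborel)"
      by (rule nn_integral_cmult) measurable
    also have "(\<integral>\<^sup>+x. ennreal (1/2) * W \<omega> x epowr r \<partial>lborel) = ennreal (1/2) * (\<integral>\<^sup>+x. W \<omega> x epowr r \<partial>lborel)"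
      by (rule nn_integral_cmult) measurable
    finally show "(\<integral>\<^sup>+x. W (power_density \<sigma> (W \<omega>)) x epowr r \<partial>lborel)
       \<le> ennreal Y * (\<integral>\<^sup>+x. gauge_maximal N s (kgauge \<sigma>) x epowr r \<partial>lborel) + ennreal (1/2) * (\<integral>\<^sup>+x. W \<omega> x epowr r \<partial>lborel)"
      by (simp add: \<omega>'_def M_def)
  qed
qed

text \<open>A single point at which the potential is finite bounds the mass of all balls around it.\<close>

lemma radon_of_W_finite:
  assumes \<omega>: "sets (\<omega> :: (real^'n) measure) = sets borel" and fin: "(\<integral>\<^sup>+x. W \<omega> x epowr r \<partial>lborel) < top"
  shows "radon_measure \<omega>"
proof -
  have "AE x in lborel. W \<omega> x < top"
    using W_measurable[OF \<omega>] fin by (intro AE_less_top_of_power_integral) auto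
  moreover have "\<not> (AE x::real^'n in lborel. False)"
  proof
    assume "AE x::real^'n in lborel. False"
    then obtain Z :: "(real^'n) set" where Z: "{x \<in> space lborel. \<not> False} \<subseteq> Z" "emeasure lborel Z = 0" "Z \<in> sets lborel" by (rule AE_E)
    then have "Z = UNIV" by auto
    then show False using Z(2) by simp
  qed
  ultimately have "\<exists>x. W \<omega> x < top"
    by (metis (no_types, lifting) eventually_mono)
  then obtain x where x: "W \<omega> x < top" by blast
  have "mass \<omega> x \<rho> < top" if "0 < \<rho>" for \<rho>
  proof -
    have "ennreal (\<rho> powr (- (N * s))) * mass \<omega> x \<rho> epowr s \<le> ennreal c_low * W \<omega> x"
      by (rule W_lower[OF \<omega> that])
    also have "\<dots> < top" using x by (simp add: ennreal_mult_less_top)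
    finally show ?thesis using that by (auto simp: ennreal_mult_less_top)
  qed
  then show ?thesis
    unfolding radon_measure_def
  proof (intro conjI \<omega> allI impI)
    fix K :: "(real^'n) set" assume "compact K"
    then obtain R where R: "K \<subseteq> ball x R" "0 < R"
      using bounded_subset_ballD[OF compact_imp_bounded] by blast
    have "emeasure \<omega> K \<le> mass \<omega> x R" using R \<omega> by (intro emeasure_mono) auto
    also have "\<dots> < \<infinity>" using \<open>\<And>\<rho>. 0 < \<rho> \<Longrightarrow> mass \<omega> x \<rho> < top\<close> R by simp
    finally show "emeasure \<omega> K < \<infinity>" .
  qed
qed

text \<open>Far from the origin, or at large scales, the total mass of the initial measure is compared with
  the decay of the maximal function built from \<open>\<kappa>\<close>. Near the origin that maximal function is bounded
  below, so its power \<open>1-\<theta>\<close>, which dominates the density of \<open>\<sigma>\<close>, is at most a multiple of itself.\<close>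

lemma initial_maximal_le:
  assumes \<sigma>: "radon_measure (\<sigma> :: (real^'n) measure)" and R: "0 < R" "mass \<sigma> 0 R \<noteq> 0" and e: "0 < e"
  shows "\<exists>C>0. \<forall>x. gauge_maximal N s (mass (scaled_restriction \<sigma> e R)) x
    \<le> ennreal C * gauge_maximal N s (kgauge \<sigma>) x"
proof -
  note \<sigma>sets = radon_sets[OF \<sigma>]
  define \<omega> where "\<omega> = scaled_restriction \<sigma> e R"
  have \<omega>: "emeasure \<omega> A = ennreal e * emeasure \<sigma> (A \<inter> ball 0 R)" if A: "A \<in> sets borel" for A
  proof -
    have dens: "(\<lambda>y. ennreal e * indicator (ball 0 R) y) \<in> borel_measurable \<sigma>"
      by (intro borel_measurable_times_ennreal borel_measurable_indicator) (auto simp: \<sigma>sets)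
    have "emeasure \<omega> A = (\<integral>\<^sup>+y. ennreal e * indicator (A \<inter> ball 0 R) y \<partial>\<sigma>)"
      using A unfolding \<omega>_def by (subst emeasure_density[OF dens]) (auto simp: \<sigma>sets indicator_def intro!: nn_integral_cong)
    then show ?thesis using A by (simp add: nn_integral_cmult_indicator \<sigma>sets)
  qed
  define M where "M = gauge_maximal N s (kgauge \<sigma>)"
  have \<eta>: "ball_gauge (kgauge \<sigma>)" by (rule ball_gauge_kappa[OF \<sigma>sets])
  have "kgauge \<sigma> 0 R \<noteq> 0"
  proof
    assume "kgauge \<sigma> 0 R = 0"
    then show False using emeasure_ball_le_kappa[OF \<sigma>sets R(1), of 0] R(2) by simp
  qed
  then have "0 < kgauge \<sigma> 0 R epowr s" by (simp add: zero_less_iff_neq_zero)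
  then obtain k' where k': "0 < k'" "k' < kgauge \<sigma> 0 R epowr s" using dense by blast
  then obtain k where k: "0 < k" "ennreal k \<le> kgauge \<sigma> 0 R epowr s"
    by (metis ennreal_cases ennreal_less_zero_iff less_imp_le not_less_iff_gr_or_eq top.extremum_strict)
  have decay: "ennreal (k * (norm x + R) powr (-(N * s))) \<le> M x" for x
  proof -
    have "ennreal (k * (norm x + R) powr (-(N * s))) = ennreal ((norm x + R) powr (-(N * s))) * ennreal k"
      using k by (simp add: ennreal_mult mult.commute)
    also have "\<dots> \<le> ennreal ((norm x + R) powr (-(N * s))) * kgauge \<sigma> 0 R epowr s"
      by (intro mult_left_mono k) simp
    also have "\<dots> \<le> gauge_quot N s (kgauge \<sigma>) x (norm x + R)" by (rule gauge_decay[OF \<eta> R(1)])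
    also have "\<dots> \<le> M x" unfolding M_def by (rule gauge_quot_le_maximal[OF \<eta>])
    finally show ?thesis .
  qed
  obtain m where m: "mass \<sigma> 0 R = ennreal m" "0 \<le> m" using radon_ball[OF \<sigma>, of 0 R] by (metis ennreal_cases less_irrefl)
  define C1 where "C1 = 2 powr (N * s) * (e * m) powr s / k"
  define k1 where "k1 = k * (4 * R) powr (-(N * s))"
  have k1: "k1 > 0" using k R by (simp add: k1_def)
  define C2 where "C2 = e powr s * c_mass powr s / k1 powr \<theta>"
  have C: "0 \<le> C1" "0 < C2" using k k1 e c_mass by (auto simp: C1_def C2_def)
  have main: "gauge_quot N s (mass \<omega>) x \<rho> \<le> ennreal (C1 + C2) * M x" if \<rho>: "0 < \<rho>" for x \<rho>
  proof (cases "norm x + R \<le> 2 * \<rho>")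
    case True
    have "mass \<omega> x \<rho> \<le> ennreal e * ennreal m"
      unfolding m(1)[symmetric] by (subst \<omega>) (auto intro!: mult_left_mono emeasure_mono simp: \<sigma>sets)
    then have "mass \<omega> x \<rho> epowr s \<le> ennreal (e * m) epowr s"
      using s e m by (intro epowr_mono) (auto simp: ennreal_mult)
    then have "mass \<omega> x \<rho> epowr s \<le> ennreal ((e * m) powr s)" using e m by simp
    moreover have "\<rho> powr (- (N * s)) \<le> ((norm x + R) / 2) powr (- (N * s))"
      using True R N s by (intro powr_mono2') (auto simp: add_nonneg_pos)
    ultimately have "gauge_quot N s (mass \<omega>) x \<rho> \<le> ennreal (((norm x + R) / 2) powr (- (N * s))) * ennreal ((e * m) powr s)"
      unfolding gauge_quot_eq[OF \<rho> s] by (intro mult_mono ennreal_leI) auto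
    also have "\<dots> = ennreal (((norm x + R) / 2) powr (- (N * s)) * (e * m) powr s)"
      by (rule ennreal_mult[symmetric]) auto
    also have "((norm x + R) / 2) powr (- (N * s)) * (e * m) powr s = C1 * (k * (norm x + R) powr (-(N * s)))"
      using k R by (simp add: C1_def powr_divide powr_minus_divide)
    also have "ennreal \<dots> = ennreal C1 * ennreal (k * (norm x + R) powr (-(N * s)))"
      using C k by (intro ennreal_mult) auto
    also have "\<dots> \<le> ennreal (C1 + C2) * M x"
      using C by (intro mult_mono decay ennreal_leI) auto
    finally show ?thesis .
  next
    case False
    show ?thesis
    proof (cases "ball x \<rho> \<inter> ball 0 R = {}")
      case True
      then have "mass \<omega> x \<rho> = 0" by (simp add: \<omega>)
      then show ?thesis using s by (simp add: gauge_quot_eq[OF \<rho>])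
    next
      case ne: False
      then obtain z where "dist x z < \<rho>" "norm z < R" by auto
      then have "norm x < \<rho> + R"
        using norm_triangle_sub[of x z] by (simp add: dist_norm)
      then have "norm x + R \<le> 4 * R" using False by simp
      then have "(4 * R) powr (-(N * s)) \<le> (norm x + R) powr (-(N * s))"
        using R N s by (intro powr_mono2') (auto simp: add_nonneg_pos)
      then have "ennreal k1 \<le> ennreal (k * (norm x + R) powr (-(N * s)))"
        unfolding k1_def using k by (intro ennreal_leI mult_left_mono) auto
      then have k1M: "ennreal k1 \<le> M x" using decay[of x] by simp
      have "mass \<omega> x \<rho> \<le> ennreal e * mass \<sigma> x \<rho>"
        by (subst \<omega>) (auto intro!: mult_left_mono emeasure_mono simp: \<sigma>sets)
      then have "mass \<omega> x \<rho> epowr s \<le> (ennreal e * mass \<sigma> x \<rho>) epowr s"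
        using s by (intro epowr_mono) auto
      also have "\<dots> = ennreal (e powr s) * mass \<sigma> x \<rho> epowr s" using e s by (intro epowr_ennreal_mult) auto
      finally have "gauge_quot N s (mass \<omega>) x \<rho> \<le> ennreal (\<rho> powr (- (N * s))) * (ennreal (e powr s) * mass \<sigma> x \<rho> epowr s)"
        unfolding gauge_quot_eq[OF \<rho> s] by (rule mult_left_mono) simp
      also have "\<dots> = ennreal (e powr s) * gauge_quot N s (mass \<sigma>) x \<rho>"
        unfolding gauge_quot_eq[OF \<rho> s] by (simp only: mult.left_commute)
      also have "\<dots> \<le> ennreal (e powr s) * (ennreal (c_mass powr s) * gauge_quot N s (kgauge \<sigma>) x \<rho> epowr (1 - \<theta>))"
        by (intro mult_left_mono gauge_quot_mass_le \<sigma>sets \<rho>) simp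
      also have "\<dots> \<le> ennreal (e powr s) * (ennreal (c_mass powr s) * M x epowr (1 - \<theta>))"
        unfolding M_def using \<theta>(2) by (intro mult_left_mono epowr_mono gauge_quot_le_maximal \<eta>) auto
      also have "\<dots> = ennreal (e powr s * c_mass powr s) * M x epowr (1 - \<theta>)"
        by (rule ennreal_mult_left) auto
      also have "e powr s * c_mass powr s = C2 * k1 powr \<theta>"
        using k1 by (simp add: C2_def)
      also have "ennreal (C2 * k1 powr \<theta>) * M x epowr (1 - \<theta>) = ennreal C2 * (ennreal k1 epowr \<theta> * M x epowr (1 - \<theta>))"
        using C k1 by (simp add: ennreal_mult mult.assoc)
      also have "\<dots> \<le> ennreal C2 * (M x epowr \<theta> * M x epowr (1 - \<theta>))"
        using k1M \<theta>(1) by (intro mult_left_mono mult_right_mono epowr_mono) auto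
      also have "\<dots> = ennreal C2 * M x" by (simp add: epowr_add[symmetric])
      also have "\<dots> \<le> ennreal (C1 + C2) * M x"
        using C by (intro mult_right_mono ennreal_leI) auto
      finally show ?thesis .
    qed
  qed
  have "gauge_maximal N s (mass \<omega>) x \<le> ennreal (C1 + C2) * M x" for x
    unfolding gauge_maximal_def[of _ _ "mass \<omega>"] by (intro SUP_least main) auto
  then show ?thesis using C by (intro exI[of _ "C1 + C2"]) (auto simp: \<omega>_def M_def)
qed

text \<open>The potential of \<open>e\<close> times \<open>\<sigma>\<close> on the ball is at least \<open>b e\<^sup>s\<close> there, and
  \<open>b\<^sup>q e\<^sup>\<theta> \<ge> e\<close> as soon as \<open>e\<close> is small. Hence the iteration increases in its first step.\<close>

lemma subsolution_density:
  assumes \<sigma>: "radon_measure (\<sigma> :: (real^'n) measure)" and R: "0 < R" "mass \<sigma> 0 R \<noteq> 0"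
  shows "\<exists>e>0. \<forall>y\<in>ball 0 R. ennreal e \<le> W (scaled_restriction \<sigma> e R) y epowr q"
proof -
  note \<sigma>sets = radon_sets[OF \<sigma>]
  obtain m where m: "mass \<sigma> 0 R = ennreal m" "0 < m"
    using R(2) radon_ball[OF \<sigma>, of 0 R] by (metis ennreal_cases ennreal_eq_0_iff less_irrefl not_le order_le_less)
  define b where "b = (2 * R) powr (-(N * s)) * m powr s / c_low"
  have b: "b > 0" using m R c_low by (simp add: b_def)
  \<comment> \<open>the solution of \<open>b\<^sup>q e\<^sup>\<theta> = e\<close>\<close>
  define e where "e = b powr \<gamma>"
  have e: "e > 0" using b by (simp add: e_def)
  let ?\<omega> = "scaled_restriction \<sigma> e R"
  have dens: "(\<lambda>y. ennreal e * indicator (ball 0 R) y) \<in> borel_measurable \<sigma>"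
    by (intro borel_measurable_times_ennreal borel_measurable_indicator) (auto simp: \<sigma>sets)
  have "ennreal e \<le> W ?\<omega> y epowr q" if y: "y \<in> ball 0 R" for y
  proof -
    have sub: "ball 0 R \<subseteq> ball y (2 * R)" using y by (intro ball_subset_ball_dist) simp
    have "ennreal (e * m) = (\<integral>\<^sup>+z. ennreal e * indicator (ball 0 R) z \<partial>\<sigma>)"
      using m e by (simp add: nn_integral_cmult_indicator \<sigma>sets ennreal_mult)
    also have "\<dots> \<le> mass ?\<omega> y (2 * R)"
      using sub by (subst emeasure_density[OF dens]) (auto simp: \<sigma>sets indicator_def intro!: nn_integral_mono)
    finally have "ennreal (e * m) epowr s \<le> mass ?\<omega> y (2 * R) epowr s"
      using s by (intro epowr_mono) auto
    then have "ennreal ((2 * R) powr (-(N * s))) * ennreal (e * m) epowr s \<le> ennreal ((2 * R) powr (-(N * s))) * mass ?\<omega> y (2 * R) epowr s"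
      by (rule mult_left_mono) simp
    also have "\<dots> \<le> ennreal c_low * W ?\<omega> y"
      using R by (intro W_lower) (auto simp: \<sigma>sets)
    finally have "ennreal (1 / c_low) * (ennreal ((2 * R) powr (-(N * s))) * ennreal (e * m) epowr s) \<le> ennreal (1 / c_low) * (ennreal c_low * W ?\<omega> y)"
      by (rule mult_left_mono) simp
    also have "ennreal (1 / c_low) * (ennreal c_low * W ?\<omega> y) = W ?\<omega> y"
      using c_low by (simp add: ennreal_mult_left)
    also have "ennreal (1 / c_low) * (ennreal ((2 * R) powr (-(N * s))) * ennreal (e * m) epowr s) = ennreal (b * e powr s)"
      using c_low e m by (subst ennreal_mult_left) (auto simp: ennreal_mult[symmetric] b_def powr_mult mult_ac)
    finally have "ennreal (b * e powr s) epowr q \<le> W ?\<omega> y epowr q"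
      using q by (intro epowr_mono) auto
    moreover have "(b * e powr s) powr q = e"
    proof -
      have "b powr q = e powr (1 - \<theta>)" using \<gamma>(2) by (simp add: e_def powr_powr)
      then show ?thesis using e by (simp add: powr_mult powr_powr \<theta>(3) powr_add[symmetric])
    qed
    ultimately show ?thesis using b by simp
  qed
  then show ?thesis using e by blast
qed

text \<open>The iterates increase and are bounded in \<open>L\<^sup>r\<close>. The second fact also shows that every measure that
  occurs is locally finite, so that the estimate for the next step applies. Monotone convergence
  passes to the limit both in the measures and in their potentials.\<close>

theorem positive_solution_exists:
  assumes r: "0 < r" and \<sigma>: "radon_measure (\<sigma> :: (real^'n) measure)" "emeasure \<sigma> UNIV \<noteq> 0"
    and K: "in_L r (intrinsic_potential \<alpha> p q \<sigma>)"
  shows "\<exists>u. positive_solution \<alpha> p q \<sigma> u \<and> in_L r u"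
proof -
  note \<sigma>sets = radon_sets[OF \<sigma>(1)]
  note [measurable_cong] = \<sigma>sets
  have \<eta>: "ball_gauge (kgauge \<sigma>)" by (rule ball_gauge_kappa[OF \<sigma>sets])
  define M where "M = gauge_maximal N s (kgauge \<sigma>)"
  have [measurable]: "M \<in> borel_measurable borel" unfolding M_def by (rule gauge_maximal_measurable[OF \<eta> s])
  define I where "I = (\<integral>\<^sup>+x. M x epowr r \<partial>lborel)"
  have I: "I < top"
  proof -
    have "I \<le> ennreal (c_low powr r) * (\<integral>\<^sup>+x. gauge_potential N s (kgauge \<sigma>) x epowr r \<partial>lborel)"
      unfolding I_def M_def c_low_def by (rule maximal_power_integral_le_potential[OF \<eta> s N(1) r])
    also have "\<dots> < top"
      using K by (simp add: in_L_def Lnorm_less_top intrinsic_potential_eq[OF \<sigma>sets] ennreal_mult_less_top)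
    finally show ?thesis .
  qed
  obtain R where R: "0 < R" "mass \<sigma> 0 R \<noteq> 0" using exists_ball_mass[OF \<sigma>sets \<sigma>(2)] by blast
  obtain e where e: "0 < e" "\<forall>y\<in>ball 0 R. ennreal e \<le> W (scaled_restriction \<sigma> e R) y epowr q"
    using subsolution_density[OF \<sigma>(1) R] by blast
  define \<omega>0 where "\<omega>0 = scaled_restriction \<sigma> e R"
  define step_measure where "step_measure \<mu> = density \<sigma> (\<lambda>y. W \<mu> y epowr q)" for \<mu>
  define \<omega> where "\<omega> j = (step_measure ^^ j) \<omega>0" for j
  have \<omega>_0: "\<omega> 0 = \<omega>0" and \<omega>_Suc: "\<omega> (Suc j) = density \<sigma> (\<lambda>y. W (\<omega> j) y epowr q)" for j
    by (simp_all add: \<omega>_def step_measure_def)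
  have \<omega>sets: "sets (\<omega> j) = sets borel" for j
    by (cases j) (simp_all add: \<omega>_0 \<omega>_Suc \<omega>0_def \<sigma>sets)
  define u where "u j = W (\<omega> j)" for j
  have u_meas [measurable]: "u j \<in> borel_measurable borel" for j unfolding u_def by (rule W_measurable[OF \<omega>sets])
  have dens0: "(\<lambda>y. ennreal e * indicator (ball 0 R) y) \<in> borel_measurable \<sigma>"
    by (intro borel_measurable_times_ennreal borel_measurable_indicator) (auto simp: \<sigma>sets)
  have densj: "(\<lambda>y. u j y epowr q) \<in> borel_measurable \<sigma>" for j by measurable
  have em_Suc: "emeasure (\<omega> (Suc j)) A = (\<integral>\<^sup>+y\<in>A. u j y epowr q \<partial>\<sigma>)" if "A \<in> sets borel" for j A
    unfolding \<omega>_Suc u_def[symmetric] using that by (intro emeasure_density densj) (simp add: \<sigma>sets)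
  have mono: "u j x \<le> u (Suc j) x" for j x
  proof (induction j arbitrary: x)
    case 0
    have "emeasure (\<omega> 0) A \<le> emeasure (\<omega> (Suc 0)) A" if A: "A \<in> sets borel" for A
    proof -
      have "emeasure (\<omega> 0) A = (\<integral>\<^sup>+y\<in>A. ennreal e * indicator (ball 0 R) y \<partial>\<sigma>)"
        unfolding \<omega>_0 \<omega>0_def using A by (intro emeasure_density dens0) (simp add: \<sigma>sets)
      also have "\<dots> \<le> (\<integral>\<^sup>+y\<in>A. u 0 y epowr q \<partial>\<sigma>)"
        using e(2) by (intro nn_integral_mono mult_right_mono) (auto simp: indicator_def u_def \<omega>_0 \<omega>0_def)
      finally show ?thesis using em_Suc[OF A, of 0] by simp
    qed
    then show ?case unfolding u_def by (intro W_mono) simp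
  next
    case (Suc j)
    have "emeasure (\<omega> (Suc j)) A \<le> emeasure (\<omega> (Suc (Suc j))) A" if A: "A \<in> sets borel" for A
      unfolding em_Suc[OF A] using q by (intro nn_integral_mono mult_right_mono epowr_mono Suc.IH) auto
    then show ?case unfolding u_def[of "Suc j"] u_def[of "Suc (Suc j)"] by (intro W_mono) simp
  qed
  have inc: "incseq u" by (intro incseq_SucI le_funI mono)
  obtain C where C: "C > 0" and step: "\<forall>\<sigma> \<omega>. radon_measure (\<sigma> :: (real^'n) measure) \<longrightarrow> radon_measure \<omega> \<longrightarrow>
     (\<integral>\<^sup>+x. W (power_density \<sigma> (W \<omega>)) x epowr r \<partial>lborel)
       \<le> ennreal C * (\<integral>\<^sup>+x. gauge_maximal N s (kgauge \<sigma>) x epowr r \<partial>lborel) + ennreal (1/2) * (\<integral>\<^sup>+x. W \<omega> x epowr r \<partial>lborel)"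
    using iterate_integral_le[OF r] by (elim exE conjE) (rule that)
  define J where "J j = (\<integral>\<^sup>+x. u j x epowr r \<partial>lborel)" for j
  have J0: "J 0 < top"
  proof -
    obtain C1 where C1: "C1 > 0" and KK: "\<forall>\<eta> :: real^'n \<Rightarrow> real \<Rightarrow> ennreal. ball_gauge \<eta> \<longrightarrow>
      (\<integral>\<^sup>+x. gauge_potential N s \<eta> x epowr r \<partial>lborel) \<le> ennreal C1 * (\<integral>\<^sup>+x. gauge_maximal N s \<eta> x epowr r \<partial>lborel)"
      using potential_power_integral_le_maximal[OF s N r] by (elim exE conjE) (rule that)
    obtain C2 where C2: "C2 > 0" and max: "\<forall>x. gauge_maximal N s (mass \<omega>0) x \<le> ennreal C2 * M x"
      using initial_maximal_le[OF \<sigma>(1) R e(1)] unfolding \<omega>0_def M_def by blast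
    have "J 0 \<le> ennreal C1 * (\<integral>\<^sup>+x. gauge_maximal N s (mass \<omega>0) x epowr r \<partial>lborel)"
      unfolding J_def u_def W_eq[OF \<omega>sets] using KK ball_gauge_emeasure[OF \<omega>sets, of 0] by (simp add: \<omega>_0)
    also have "(\<integral>\<^sup>+x. gauge_maximal N s (mass \<omega>0) x epowr r \<partial>lborel) \<le> (\<integral>\<^sup>+x. ennreal (C2 powr r) * M x epowr r \<partial>lborel)"
    proof (rule nn_integral_mono)
      fix x
      have "gauge_maximal N s (mass \<omega>0) x epowr r \<le> (ennreal C2 * M x) epowr r"
        using max r by (intro epowr_mono) auto
      then show "gauge_maximal N s (mass \<omega>0) x epowr r \<le> ennreal (C2 powr r) * M x epowr r"
        using C2 r by (simp add: epowr_ennreal_mult)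
    qed
    also have "\<dots> = ennreal (C2 powr r) * I" unfolding I_def by (rule nn_integral_cmult) measurable
    finally have "J 0 \<le> ennreal C1 * (ennreal (C2 powr r) * I)" by (simp add: mult_left_mono)
    also have "\<dots> < top" using I by (simp add: ennreal_mult_less_top)
    finally show ?thesis .
  qed
  \<comment> \<open>an invariant bound for \<open>J \<mapsto> C I + J/2\<close>\<close>
  define L where "L = J 0 + ennreal (2 * C) * I"
  have L: "L < top" using J0 I by (simp add: L_def ennreal_mult_less_top)
  have J: "J j \<le> L" for j
  proof (induction j)
    case 0
    show ?case by (simp add: L_def)
  next
    case (Suc j)
    have "J j < top" using Suc L by (rule order_le_less_trans)
    then have "radon_measure (\<omega> j)" unfolding J_def u_def by (rule radon_of_W_finite[OF \<omega>sets])
    then have "J (Suc j) \<le> ennreal C * I + ennreal (1/2) * J j"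
      using step \<sigma>(1) unfolding J_def u_def \<omega>_Suc I_def M_def by blast
    also have "\<dots> \<le> ennreal C * I + ennreal (1/2) * L"
      by (intro add_left_mono mult_left_mono Suc) simp
    also have "ennreal (1/2) * L = ennreal (1/2) * J 0 + ennreal C * I"
    proof -
      have "ennreal (1/2) * (ennreal (2 * C) * I) = ennreal (1/2 * (2 * C)) * I"
        using C by (intro ennreal_mult_left) auto
      then show ?thesis unfolding L_def distrib_left by simp
    qed
    also have "ennreal C * I + (ennreal (1/2) * J 0 + ennreal C * I) = ennreal (1/2) * J 0 + ennreal (2 * C) * I"
    proof -
      have "ennreal (2 * C) * I = ennreal C * I + ennreal C * I"
        using C by (simp add: ennreal_plus[of C C, symmetric] distrib_right[symmetric] del: ennreal_plus)
      then show ?thesis by (simp add: add_ac)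
    qed
    also have "ennreal (1/2) * J 0 \<le> 1 * J 0"
    proof (rule mult_right_mono)
      show "ennreal (1/2) \<le> 1" unfolding ennreal_1[symmetric] by (rule ennreal_leI) simp
    qed simp
    finally show ?case by (simp add: L_def)
  qed
  define v where "v x = (SUP j. u j x)" for x
  have [measurable]: "v \<in> borel_measurable borel" unfolding v_def[abs_def] by measurable
  have vint: "(\<integral>\<^sup>+x. v x epowr r \<partial>lborel) \<le> L"
  proof -
    have "(\<integral>\<^sup>+x. v x epowr r \<partial>lborel) = (\<integral>\<^sup>+x. (SUP j. u j x epowr r) \<partial>lborel)"
      unfolding v_def using r by (simp add: epowr_SUP)
    also have "\<dots> = (SUP j. J j)"
      unfolding J_def
    proof (rule nn_integral_monotone_convergence_SUP)
      show "incseq (\<lambda>j x. u j x epowr r)"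
        using inc r by (auto simp: incseq_def le_fun_def intro!: epowr_mono)
    qed measurable
    also have "\<dots> \<le> L" by (intro SUP_least J)
    finally show ?thesis .
  qed
  define \<mu> where "\<mu> = density \<sigma> (\<lambda>y. v y epowr q)"
  have \<mu>sets: "sets \<mu> = sets borel" by (simp add: \<mu>_def \<sigma>sets)
  have densv: "(\<lambda>y. v y epowr q) \<in> borel_measurable \<sigma>" by measurable
  have em_\<mu>: "emeasure \<mu> A = (SUP j. emeasure (\<omega> (Suc j)) A)" if A: "A \<in> sets borel" for A
  proof -
    have "emeasure \<mu> A = (\<integral>\<^sup>+y\<in>A. v y epowr q \<partial>\<sigma>)"
      unfolding \<mu>_def using A by (intro emeasure_density densv) (simp add: \<sigma>sets)
    also have "\<dots> = (\<integral>\<^sup>+y. (SUP j. u j y epowr q * indicator A y) \<partial>\<sigma>)"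
      unfolding v_def using q by (simp add: epowr_SUP SUP_mult_right_ennreal)
    also have "\<dots> = (SUP j. \<integral>\<^sup>+y. u j y epowr q * indicator A y \<partial>\<sigma>)"
    proof (rule nn_integral_monotone_convergence_SUP)
      show "incseq (\<lambda>j y. u j y epowr q * indicator A y)"
        using inc q by (auto simp: incseq_def le_fun_def intro!: epowr_mono mult_right_mono)
      show "(\<lambda>y. u j y epowr q * indicator A y) \<in> borel_measurable \<sigma>" for j
        using A by (intro borel_measurable_times_ennreal densj borel_measurable_indicator) (simp add: \<sigma>sets)
    qed
    finally show ?thesis using em_Suc[OF A] by simp
  qed
  have W\<mu>: "W \<mu> x = v x" for x
  proof -
    note [measurable (raw)] = gauge_quot_measurable[OF ball_gauge_emeasure[OF \<omega>sets]]
    have quot: "gauge_quot N s (mass \<mu>) x \<rho> = (SUP j. gauge_quot N s (mass (\<omega> (Suc j))) x \<rho>)" if "0 < \<rho>" for \<rho>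
      using that s by (simp add: gauge_quot_eq em_\<mu> epowr_SUP SUP_mult_left_ennreal)
    have "W \<mu> x = (\<integral>\<^sup>+\<rho>. (SUP j. gauge_quot N s (mass (\<omega> (Suc j))) x \<rho>) \<partial>mult_haar)"
      unfolding W_eq[OF \<mu>sets] gauge_potential_def
    proof (rule nn_integral_cong_AE)
      show "AE \<rho> in mult_haar. gauge_quot N s (mass \<mu>) x \<rho> = (SUP j. gauge_quot N s (mass (\<omega> (Suc j))) x \<rho>)"
        using AE_mult_haar_pos by eventually_elim (rule quot)
    qed
    also have "\<dots> = (SUP j. \<integral>\<^sup>+\<rho>. gauge_quot N s (mass (\<omega> (Suc j))) x \<rho> \<partial>mult_haar)"
    proof (rule nn_integral_monotone_convergence_SUP)
      show "incseq (\<lambda>j. gauge_quot N s (mass (\<omega> (Suc j))) x)"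
      proof (intro incseq_SucI le_funI)
        fix j \<rho>
        have "mass (\<omega> (Suc j)) x \<rho> \<le> mass (\<omega> (Suc (Suc j))) x \<rho>"
          using q by (simp add: em_Suc) (intro nn_integral_mono mult_right_mono epowr_mono mono, auto)
        then show "gauge_quot N s (mass (\<omega> (Suc j))) x \<rho> \<le> gauge_quot N s (mass (\<omega> (Suc (Suc j)))) x \<rho>"
          unfolding gauge_quot_def using s by (intro epowr_mono divide_right_mono_ennreal) auto
      qed
    qed measurable
    also have "\<dots> = (SUP j. u (Suc j) x)"
      by (simp only: u_def W_eq[OF \<omega>sets] gauge_potential_def)
    also have "\<dots> = v x"
      unfolding v_def
    proof (rule antisym)
      show "(SUP j. u (Suc j) x) \<le> (SUP j. u j x)" by (rule SUP_least) (rule SUP_upper, simp)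
      show "(SUP j. u j x) \<le> (SUP j. u (Suc j) x)"
        by (rule SUP_least) (rule order_trans[OF mono], rule SUP_upper, simp)
    qed
    finally show ?thesis .
  qed
  have \<mu>: "radon_measure \<mu>"
  proof (rule radon_of_W_finite[OF \<mu>sets])
    show "(\<integral>\<^sup>+x. W \<mu> x epowr r \<partial>lborel) < top" unfolding W\<mu> using vint L by (rule order_le_less_trans)
  qed
  have vloc: "in_L_loc q \<sigma> v"
    unfolding in_L_loc_def
  proof (intro conjI allI impI)
    have "v \<in> borel_measurable \<sigma>" by measurable
    then show "v \<in> borel_measurable (completion \<sigma>)" by (rule measurable_completion)
    fix K :: "(real^'n) set" assume K: "compact K"
    then have "K \<in> sets borel" by (intro borel_closed compact_imp_closed)
    then have "(\<integral>\<^sup>+x\<in>K. v x epowr q \<partial>completion \<sigma>) = emeasure \<mu> K"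
      unfolding \<mu>_def nn_integral_completion by (intro emeasure_density[symmetric] densv) (simp add: \<sigma>sets)
    then show "(\<integral>\<^sup>+x\<in>K. v x epowr q \<partial>completion \<sigma>) < \<infinity>"
      using \<mu> K by (simp add: radon_measure_def)
  qed
  have wm: "emeasure (weighted_measure q \<sigma> v) A = emeasure \<mu> A" if A: "A \<in> sets borel" for A
  proof -
    have "A \<in> sets (completion \<sigma>)" using A \<sigma>sets by (intro sets_completionI_sets) auto
    then have "emeasure (weighted_measure q \<sigma> v) A = (\<integral>\<^sup>+x\<in>A. v x epowr q \<partial>completion \<sigma>)"
      unfolding weighted_measure_def by (intro emeasure_density measurable_completion densv)
    also have "\<dots> = emeasure \<mu> A"
      unfolding \<mu>_def nn_integral_completion using A by (intro emeasure_density[symmetric] densv) (simp add: \<sigma>sets)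
    finally show ?thesis .
  qed
  have eq: "v x = W (weighted_measure q \<sigma> v) x" for x
  proof -
    have "W \<mu> x = W (weighted_measure q \<sigma> v) x" by (rule antisym; rule W_mono) (simp_all add: wm)
    then show ?thesis by (simp only: W\<mu>)
  qed
  have pos: "0 < v x" for x
  proof -
    have "emeasure (\<omega> 0) UNIV \<noteq> 0"
    proof -
      have "emeasure (\<omega> 0) UNIV = (\<integral>\<^sup>+y. ennreal e * indicator (ball 0 R) y \<partial>\<sigma>)"
        unfolding \<omega>_0 \<omega>0_def by (subst emeasure_density[OF dens0]) (auto simp: \<sigma>sets)
      also have "\<dots> = ennreal e * mass \<sigma> 0 R" by (simp add: nn_integral_cmult_indicator \<sigma>sets)
      finally show ?thesis using R(2) e(1) by simp
    qed
    then have "0 < u 0 x" unfolding u_def by (intro W_pos \<omega>sets)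
    also have "\<dots> \<le> v x" unfolding v_def by (rule SUP_upper) simp
    finally show ?thesis .
  qed
  \<comment> \<open>the empty set has capacity zero, as the function \<open>0\<close> is admissible for it\<close>
  have qe: "quasi_everywhere \<alpha> p P" if "\<And>x::real^'n. P x" for P
  proof -
    have "capacity \<alpha> p ({} :: (real^'n) set) \<le> Lnorm p (\<lambda>_::real^'n. 0) epowr p"
      unfolding capacity_def by (intro Inf_lower) auto
    then show ?thesis using that by (simp add: quasi_everywhere_def Lnorm_def)
  qed
  have "solution \<alpha> p q \<sigma> v"
    unfolding solution_def using vloc eq by (auto intro!: qe)
  then have "positive_solution \<alpha> p q \<sigma> v"
    unfolding positive_solution_def using pos by (auto intro!: qe)
  moreover have "in_L r v"
    using vint L by (auto simp: in_L_def Lnorm_less_top intro: order_le_less_trans measurable_completion)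
  ultimately show ?thesis by blast
qed

end

section \<open>The characterization\<close>

theorem theorem1p7:
  fixes \<alpha> p q r :: real
  assumes "1 < p" and "0 < q" and "q < p - 1"
    and "0 < \<alpha>" and "\<alpha> < real CARD('n::finite) / p"
  shows
    "(real CARD('n) * (p - 1) / (real CARD('n) - \<alpha> * p) < r \<longrightarrow>
        (\<forall>\<sigma> :: (real^'n) measure. radon_measure \<sigma> \<and> emeasure \<sigma> UNIV \<noteq> 0 \<longrightarrow>
           ((\<exists>u. positive_solution \<alpha> p q \<sigma> u \<and> in_L r u) \<longleftrightarrow> in_L r (intrinsic_potential \<alpha> p q \<sigma>))) \<and>
        (\<exists>c1 > 0. \<exists>c2 > 0. \<forall>\<sigma> :: (real^'n) measure. radon_measure \<sigma> \<longrightarrow>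
           (let A = Lnorm r (intrinsic_potential \<alpha> p q \<sigma>) epowr r;
                B = (\<integral>\<^sup>+x. (SUP \<rho>\<in>{0<..}. kappa_quot \<alpha> p q \<sigma> x \<rho> epowr (r / (p - 1))) \<partial>lebesgue)
            in ennreal c1 * B \<le> A \<and> A \<le> ennreal c2 * B))) \<and>
     (0 < r \<and> r \<le> real CARD('n) * (p - 1) / (real CARD('n) - \<alpha> * p) \<longrightarrow>
        (\<forall>\<sigma> :: (real^'n) measure. \<forall>u. radon_measure \<sigma> \<and> supersolution \<alpha> p q \<sigma> u \<and> in_L r u \<longrightarrow>
           trivial_for \<sigma> u))"
proof -
  interpret wolff_exponents \<alpha> p q "TYPE('n)"
    using assms by unfold_locales
  have crit: "0 < real CARD('n) * (p - 1) / (real CARD('n) - \<alpha> * p)"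
    using assms(1) \<alpha>_less(1) by simp
  show ?thesis
  proof (intro conjI impI allI)
    assume "real CARD('n) * (p - 1) / (real CARD('n) - \<alpha> * p) < r"
    with crit have r: "0 < r" by linarith
    show "(\<exists>u. positive_solution \<alpha> p q \<sigma> u \<and> in_L r u) \<longleftrightarrow> in_L r (intrinsic_potential \<alpha> p q \<sigma>)"
      if "radon_measure \<sigma> \<and> emeasure \<sigma> UNIV \<noteq> 0" for \<sigma> :: "(real^'n) measure"
      using that intrinsic_potential_in_L[OF r, of \<sigma>] positive_solution_exists[OF r, of \<sigma>] by blast
    show "\<exists>c1 > 0. \<exists>c2 > 0. \<forall>\<sigma> :: (real^'n) measure. radon_measure \<sigma> \<longrightarrow>
           (let A = Lnorm r (intrinsic_potential \<alpha> p q \<sigma>) epowr r;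
                B = (\<integral>\<^sup>+x. (SUP \<rho>\<in>{0<..}. kappa_quot \<alpha> p q \<sigma> x \<rho> epowr (r / (p - 1))) \<partial>lebesgue)
            in ennreal c1 * B \<le> A \<and> A \<le> ennreal c2 * B)"
      by (rule intrinsic_potential_norm_equiv[OF r])
  next
    assume r: "0 < r \<and> r \<le> real CARD('n) * (p - 1) / (real CARD('n) - \<alpha> * p)"
    show "trivial_for \<sigma> u" if "radon_measure \<sigma> \<and> supersolution \<alpha> p q \<sigma> u \<and> in_L r u"
      for \<sigma> :: "(real^'n) measure" and u
      using that r by (intro supersolution_trivial) auto
  qed
qed

end
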